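(* Let $(G,X,H)$ be a degree-feasible configuration. Then $(G,X,H)$ is minimal uncolorable if and only if $(G,X,H)$ is constructible.
   Context: A hypergraph $G=(V,E,i)$ consists of finite sets $V=V(G)$ (vertices) and $E=E(G)$ (edges) and a map $i=i_G:E\to 2^V$ with $|i(e)|\ge 2$ for all $e$; distinct edges may have the same vertex set (parallel edges). An edge is ordinary if $|i(e)|=2$ and a hyperedge if $|i(e)|\ge 3$; a graph is a hypergraph with only ordinary edges. The degree $d_G(v)$ is the number of edges $e$ with $v\in i_G(e)$. For distinct $u,v$, $\mu_G(u,v)$ is the number of edges $e$ with $i_G(e)=\{u,v\}$, and $A(G)$ is the set of pairs $\{u,v\}$ with $\mu_G(u,v)\ge1$. For $Y\subseteq V(G)$, $G[Y]$ is the induced subhypergraph (vertex set $Y$, edges $e$ with $i_G(e)\subseteq Y$); $Y$ is independent if $G[Y]$ has no edges. $G$ is connected if any two vertices are joined by a hyperpath (sequence of distinct vertices $v_1,\dots,v_{q+1}$ and distinct edges $e_1,\dots,e_q$ with $\{v_j,v_{j+1}\}\subseteq i(e_j)$). A separating vertex of $G$ is a vertex $v$ such that $G$ is the union of two induced subhypergraphs $G_1,G_2$ with $V(G_1)\cap V(G_2)=\{v\}$ and $|V(G_i)|\ge2$; a block of $G$ is a maximal connected subhypergraph without separating vertex. For a simple graph $F$ and $t\ge1$, $tF$ is obtained by replacing each edge by $t$ parallel edges; $K_n$ is the complete graph, $C_n$ the cycle, $K_{(n,t)}$ the complete $n$-partite graph with all parts of size $t$, $K_{t,t}=K_{(2,t)}$.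 We write $G=\langle e\rangle$ if $E(G)=\{e\}$ and $V(G)=i_G(e)$. A cover of a hypergraph $G$ is a pair $(X,H)$ where $X$ assigns to each $v\in V(G)$ a set $X_v$, these sets pairwise disjoint, and $H$ is a hypergraph with $V(H)=\bigcup_v X_v$, each $X_v$ independent in $H$, and for each $e\in E(G)$ there is a (possibly empty) matching $M_e$ in $H[\bigcup_{v\in i_G(e)}X_v]$ (edges pairwise vertex-disjoint) with $|i_H(\tilde e)\cap X_v|=1$ for all $\tilde e\in M_e$ and $v\in i_G(e)$, and $E(H)=\bigcup_{e}M_e$. An independent transversal of $(X,H)$ is an independent set $T$ of $H$ with $|T\cap X_v|=1$ for all $v$. A feasible configuration is a triple $(G,X,H)$ with $G$ a connected hypergraph and $(X,H)$ a cover of $G$; it is degree-feasible if $|X_v|\ge d_G(v)$ for all $v$; colorable if $(X,H)$ has an independent transversal, uncolorable otherwise; minimal uncolorable if it is uncolorable but $(G,X,H-e)$ is colorable for every $e\in E(H)$. K-configuration: $G=tK_n$ ($t,n\ge1$) and each $X_v$ has a partition $(X_v^1,\dots,X_v^{n-1})$ such that for each $i$, $H^i=H[\bigcup_v X_v^i]$ is a $K_{(n,t)}$ whose parts are the sets $X_v^i$, and $H=H^1\cup\dots\cup H^{n-1}$. Odd C-configuration: $G=tC_n$, $t\ge1$, $n\ge5$ odd, each $X_v$ has a partition $(X_v^1,X_v^2)$ such that for $i\in\{1,2\}$ and $\{u,v\}\in A(G)$, $H[X_u^i\cup X_v^i]$ is a $K_{t,t}$ with parts $X_u^i,X_v^i$,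 and $H$ is the union of all these graphs. Even C-configuration: $G=tC_n$, $t\ge1$, $n\ge4$ even, each $X_v$ has a partition $(X_v^1,X_v^2)$, and there is $\{w,w'\}\in A(G)$ such that for $i\in\{1,2\}$ and every $\{u,v\}\in A(G)\setminus\{\{w,w'\}\}$, $H[X_u^i\cup X_v^i]$ is a $K_{t,t}$ with parts $X_u^i,X_v^i$; $H[X_w^1\cup X_{w'}^2]$ is a $K_{t,t}$ with parts $X_w^1,X_{w'}^2$; $H[X_w^2\cup X_{w'}^1]$ is a $K_{t,t}$ with parts $X_w^2,X_{w'}^1$; and $H$ is the union of these graphs. A C-configuration is an odd or even C-configuration. E-configuration: $G=\langle e\rangle$ for an edge $e$ of $G$, $|X_v|=1$ for all $v$, and $H\cong G$ (a single edge through all vertices of $H$). Merging: for feasible configurations $(G^1,X^1,H^1)$, $(G^2,X^2,H^2)$ with disjoint vertex sets and edge sets, vertices $v^j\in V(G^j)$ and a new vertex $v^*$, let $G$ be obtained from $G^1\cup G^2$ by identifying $v^1$ and $v^2$ into $v^*$ (every edge incident to $v^j$ now incident to $v^*$ instead), $H=H^1\cup H^2$, $X_{v^*}=X^1_{v^1}\cup X^2_{v^2}$ and $X_v=X^j_v$ for other $v\in V(G^j)$. The class of constructible configurations is the smallest class of feasible configurations containing all K-, C- and E-configurations and closed under merging. *)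

theory Defs
  imports Main "HOL-Library.Disjoint_Sets" "HOL-Library.Infinite_Typeclass"
begin

section \<open>Hypergraphs\<close>

text \<open>Edges are abstract objects, so parallel edges are possible. Values of \<open>inc G\<close> outside
  \<open>edges G\<close> carry no meaning, and no definition below depends on them.\<close>

record ('v, 'e) hypergraph =
  verts :: "'v set"
  edges :: "'e set"
  inc :: "'e \<Rightarrow> 'v set"

definition wf_hypergraph :: "('v, 'e) hypergraph \<Rightarrow> bool" where
  "wf_hypergraph G \<longleftrightarrow> finite (verts G) \<and> finite (edges G) \<and>
     (\<forall>e\<in>edges G. inc G e \<subseteq> verts G \<and> card (inc G e) \<ge> 2)"

definition degree :: "('v, 'e) hypergraph \<Rightarrow> 'v \<Rightarrow> nat" where
  "degree G v = card {e \<in> edges G. v \<in> inc G e}"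

definition mult :: "('v, 'e) hypergraph \<Rightarrow> 'v \<Rightarrow> 'v \<Rightarrow> nat" where
  "mult G u v = card {e \<in> edges G. inc G e = {u, v}}"

definition adj_pairs :: "('v, 'e) hypergraph \<Rightarrow> 'v set set" where
  "adj_pairs G = {{u, v} | u v. u \<in> verts G \<and> v \<in> verts G \<and> u \<noteq> v \<and> mult G u v \<ge> 1}"

definition induced :: "('v, 'e) hypergraph \<Rightarrow> 'v set \<Rightarrow> ('v, 'e) hypergraph" where
  "induced G Y = G\<lparr>verts := Y, edges := {e \<in> edges G. inc G e \<subseteq> Y}\<rparr>"

definition independent :: "('v, 'e) hypergraph \<Rightarrow> 'v set \<Rightarrow> bool" where
  "independent G Y \<longleftrightarrow> Y \<subseteq> verts G \<and> edges (induced G Y) = {}"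

definition delete_edge :: "('v, 'e) hypergraph \<Rightarrow> 'e \<Rightarrow> ('v, 'e) hypergraph" where
  "delete_edge G e = G\<lparr>edges := edges G - {e}\<rparr>"

definition hyperpath ::
  "('v, 'e) hypergraph \<Rightarrow> 'v list \<Rightarrow> 'e list \<Rightarrow> bool" where
  "hyperpath G vs es \<longleftrightarrow> distinct vs \<and> distinct es \<and> set vs \<subseteq> verts G \<and> set es \<subseteq> edges G \<and>
     length vs = length es + 1 \<and>
     (\<forall>j<length es. {vs ! j, vs ! (j + 1)} \<subseteq> inc G (es ! j))"

definition connected_hypergraph :: "('v, 'e) hypergraph \<Rightarrow> bool" where
  "connected_hypergraph G \<longleftrightarrow>
     (\<forall>u\<in>verts G. \<forall>v\<in>verts G. \<exists>vs es. hyperpath G vs es \<and> hd vs = u \<and> last vs = v)"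

definition isomorphic :: "('v, 'e) hypergraph \<Rightarrow> ('w, 'f) hypergraph \<Rightarrow> bool" where
  "isomorphic G H \<longleftrightarrow> (\<exists>f g. bij_betw f (verts G) (verts H) \<and> bij_betw g (edges G) (edges H) \<and>
     (\<forall>e\<in>edges G. inc H (g e) = f ` inc G e))"

text \<open>\<open>is_union H S\<close>: the hypergraph \<open>H\<close> is the union of the hypergraphs in \<open>S\<close>.\<close>

definition is_union :: "('v, 'e) hypergraph \<Rightarrow> ('v, 'e) hypergraph set \<Rightarrow> bool" where
  "is_union H S \<longleftrightarrow> verts H = (\<Union>K\<in>S. verts K) \<and> edges H = (\<Union>K\<in>S. edges K) \<and>
     (\<forall>K\<in>S. \<forall>e\<in>edges K. inc H e = inc K e)"

section \<open>Special graphs\<close>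

text \<open>\<open>is_tfold t V A G\<close>: \<open>G = tF\<close>, where \<open>F\<close> is the simple graph with vertex set \<open>V\<close> whose edges
  are the two-element sets in \<open>A\<close>.\<close>

definition is_tfold :: "nat \<Rightarrow> 'v set \<Rightarrow> 'v set set \<Rightarrow> ('v, 'e) hypergraph \<Rightarrow> bool" where
  "is_tfold t V A G \<longleftrightarrow> verts G = V \<and> (\<forall>e\<in>edges G. inc G e \<in> A) \<and>
     (\<forall>a\<in>A. card {e \<in> edges G. inc G e = a} = t)"

definition is_tK :: "nat \<Rightarrow> nat \<Rightarrow> ('v, 'e) hypergraph \<Rightarrow> bool" where
  "is_tK t n G \<longleftrightarrow>
     (\<exists>V. finite V \<and> card V = n \<and> is_tfold t V {{u, v} | u v. u \<in> V \<and> v \<in> V \<and> u \<noteq> v} G)"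

definition is_tC :: "nat \<Rightarrow> nat \<Rightarrow> ('v, 'e) hypergraph \<Rightarrow> bool" where
  "is_tC t n G \<longleftrightarrow> n \<ge> 3 \<and>
     (\<exists>vs. distinct vs \<and> length vs = n \<and>
        is_tfold t (set vs) {{vs ! i, vs ! ((i + 1) mod n)} | i. i < n} G)"

text \<open>\<open>is_K_multipartite n t P K\<close>: \<open>K\<close> is a \<open>K\<^bsub>(n,t)\<^esub>\<close> (a simple graph) and \<open>P\<close> is the set of
  its parts.\<close>

definition is_K_multipartite ::
  "nat \<Rightarrow> nat \<Rightarrow> 'x set set \<Rightarrow> ('x, 'f) hypergraph \<Rightarrow> bool" where
  "is_K_multipartite n t P K \<longleftrightarrow> finite P \<and> card P = n \<and> disjoint P \<and>
     (\<forall>p\<in>P. finite p \<and> card p = t) \<and>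
     is_tfold 1 (\<Union>P) {{x, y} | x y p q. p \<in> P \<and> q \<in> P \<and> p \<noteq> q \<and> x \<in> p \<and> y \<in> q} K"

section \<open>Covers and configurations\<close>

text \<open>Values of \<open>X\<close> outside \<open>verts G\<close> carry no meaning. The matchings \<open>M e\<close> of distinct edges
  are not required to be disjoint.\<close>

definition matching :: "('x, 'f) hypergraph \<Rightarrow> 'f set \<Rightarrow> bool" where
  "matching H M \<longleftrightarrow> M \<subseteq> edges H \<and>
     (\<forall>e\<in>M. \<forall>f\<in>M. e \<noteq> f \<longrightarrow> inc H e \<inter> inc H f = {})"

definition cover ::
  "('v, 'e) hypergraph \<Rightarrow> ('v \<Rightarrow> 'x set) \<Rightarrow> ('x, 'f) hypergraph \<Rightarrow> bool" where
  "cover G X H \<longleftrightarrow> wf_hypergraph H \<and> disjoint_family_on X (verts G) \<and>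
     verts H = (\<Union>v\<in>verts G. X v) \<and>
     (\<forall>v\<in>verts G. independent H (X v)) \<and>
     (\<exists>M. (\<forall>e\<in>edges G. matching (induced H (\<Union>v\<in>inc G e. X v)) (M e) \<and>
              (\<forall>f\<in>M e. \<forall>v\<in>inc G e. card (inc H f \<inter> X v) = 1)) \<and>
          edges H = (\<Union>e\<in>edges G. M e))"

definition independent_transversal ::
  "('v, 'e) hypergraph \<Rightarrow> ('v \<Rightarrow> 'x set) \<Rightarrow> ('x, 'f) hypergraph \<Rightarrow> 'x set \<Rightarrow> bool" where
  "independent_transversal G X H T \<longleftrightarrow>
     independent H T \<and> (\<forall>v\<in>verts G. card (T \<inter> X v) = 1)"

definition feasible ::
  "('v, 'e) hypergraph \<Rightarrow> ('v \<Rightarrow> 'x set) \<Rightarrow> ('x, 'f) hypergraph \<Rightarrow> bool" where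
  "feasible G X H \<longleftrightarrow> wf_hypergraph G \<and> connected_hypergraph G \<and> cover G X H"

definition degree_feasible ::
  "('v, 'e) hypergraph \<Rightarrow> ('v \<Rightarrow> 'x set) \<Rightarrow> ('x, 'f) hypergraph \<Rightarrow> bool" where
  "degree_feasible G X H \<longleftrightarrow> feasible G X H \<and> (\<forall>v\<in>verts G. card (X v) \<ge> degree G v)"

definition colorable ::
  "('v, 'e) hypergraph \<Rightarrow> ('v \<Rightarrow> 'x set) \<Rightarrow> ('x, 'f) hypergraph \<Rightarrow> bool" where
  "colorable G X H \<longleftrightarrow> (\<exists>T. independent_transversal G X H T)"

definition minimal_uncolorable ::
  "('v, 'e) hypergraph \<Rightarrow> ('v \<Rightarrow> 'x set) \<Rightarrow> ('x, 'f) hypergraph \<Rightarrow> bool" where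
  "minimal_uncolorable G X H \<longleftrightarrow>
     \<not> colorable G X H \<and> (\<forall>e\<in>edges H. colorable G X (delete_edge H e))"

section \<open>Constructible configurations\<close>

text \<open>In the following definitions \<open>P v i\<close> is the class \<open>X\<^sub>v\<^sup>i\<close> of the partition of \<open>X v\<close>. Classes
  need not be required to be nonempty, since they all turn out to have size \<open>t \<ge> 1\<close>.\<close>

definition indexed_partition :: "'i set \<Rightarrow> ('i \<Rightarrow> 'x set) \<Rightarrow> 'x set \<Rightarrow> bool" where
  "indexed_partition I P S \<longleftrightarrow> (\<Union>i\<in>I. P i) = S \<and> disjoint_family_on P I"

definition K_configuration ::
  "('v, 'e) hypergraph \<Rightarrow> ('v \<Rightarrow> 'x set) \<Rightarrow> ('x, 'f) hypergraph \<Rightarrow> bool" where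
  "K_configuration G X H \<longleftrightarrow> feasible G X H \<and>
     (\<exists>t n. t \<ge> 1 \<and> n \<ge> 1 \<and> is_tK t n G \<and>
       (\<exists>P :: 'v \<Rightarrow> nat \<Rightarrow> 'x set.
         (\<forall>v\<in>verts G. indexed_partition {1..<n} (P v) (X v)) \<and>
         (\<forall>i\<in>{1..<n}. is_K_multipartite n t ((\<lambda>v. P v i) ` verts G)
            (induced H (\<Union>v\<in>verts G. P v i))) \<and>
         is_union H ((\<lambda>i. induced H (\<Union>v\<in>verts G. P v i)) ` {1..<n})))"

definition odd_C_configuration ::
  "('v, 'e) hypergraph \<Rightarrow> ('v \<Rightarrow> 'x set) \<Rightarrow> ('x, 'f) hypergraph \<Rightarrow> bool" where
  "odd_C_configuration G X H \<longleftrightarrow> feasible G X H \<and>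
     (\<exists>t n. t \<ge> 1 \<and> n \<ge> 5 \<and> odd n \<and> is_tC t n G \<and>
       (\<exists>P :: 'v \<Rightarrow> nat \<Rightarrow> 'x set.
         (\<forall>v\<in>verts G. indexed_partition {1, 2} (P v) (X v)) \<and>
         (\<forall>i\<in>{1, 2}. \<forall>u v. {u, v} \<in> adj_pairs G \<longrightarrow>
            is_K_multipartite 2 t {P u i, P v i} (induced H (P u i \<union> P v i))) \<and>
         is_union H {induced H (P u i \<union> P v i) | u v i. i \<in> {1, 2} \<and> {u, v} \<in> adj_pairs G}))"

definition even_C_configuration ::
  "('v, 'e) hypergraph \<Rightarrow> ('v \<Rightarrow> 'x set) \<Rightarrow> ('x, 'f) hypergraph \<Rightarrow> bool" where
  "even_C_configuration G X H \<longleftrightarrow> feasible G X H \<and>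
     (\<exists>t n. t \<ge> 1 \<and> n \<ge> 4 \<and> even n \<and> is_tC t n G \<and>
       (\<exists>(P :: 'v \<Rightarrow> nat \<Rightarrow> 'x set) w w'.
         (\<forall>v\<in>verts G. indexed_partition {1, 2} (P v) (X v)) \<and>
         {w, w'} \<in> adj_pairs G \<and>
         (\<forall>i\<in>{1, 2}. \<forall>u v. {u, v} \<in> adj_pairs G - {{w, w'}} \<longrightarrow>
            is_K_multipartite 2 t {P u i, P v i} (induced H (P u i \<union> P v i))) \<and>
         is_K_multipartite 2 t {P w 1, P w' 2} (induced H (P w 1 \<union> P w' 2)) \<and>
         is_K_multipartite 2 t {P w 2, P w' 1} (induced H (P w 2 \<union> P w' 1)) \<and>
         is_union H
           ({induced H (P u i \<union> P v i) | u v i. i \<in> {1, 2} \<and> {u, v} \<in> adj_pairs G - {{w, w'}}} \<union>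
            {induced H (P w 1 \<union> P w' 2), induced H (P w 2 \<union> P w' 1)})))"

definition C_configuration ::
  "('v, 'e) hypergraph \<Rightarrow> ('v \<Rightarrow> 'x set) \<Rightarrow> ('x, 'f) hypergraph \<Rightarrow> bool" where
  "C_configuration G X H \<longleftrightarrow> odd_C_configuration G X H \<or> even_C_configuration G X H"

definition E_configuration ::
  "('v, 'e) hypergraph \<Rightarrow> ('v \<Rightarrow> 'x set) \<Rightarrow> ('x, 'f) hypergraph \<Rightarrow> bool" where
  "E_configuration G X H \<longleftrightarrow> feasible G X H \<and>
     (\<exists>e. edges G = {e} \<and> verts G = inc G e) \<and>
     (\<forall>v\<in>verts G. card (X v) = 1) \<and> isomorphic H G"

definition identify :: "'v \<Rightarrow> 'v \<Rightarrow> 'v \<Rightarrow> 'v \<Rightarrow> 'v" where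
  "identify v1 v2 w v = (if v = v1 \<or> v = v2 then w else v)"

text \<open>\<open>is_merging G1 X1 H1 v1 G2 X2 H2 v2 w G X H\<close>: the triple \<open>(G, X, H)\<close> is obtained from
  \<open>(G1, X1, H1)\<close> and \<open>(G2, X2, H2)\<close> by merging \<open>v1\<close> and \<open>v2\<close> to the new vertex \<open>w\<close>. This is a
  relation because \<open>inc\<close> and \<open>X\<close> are only determined on edges and vertices, respectively.\<close>

definition is_merging ::
  "('v, 'e) hypergraph \<Rightarrow> ('v \<Rightarrow> 'x set) \<Rightarrow> ('x, 'f) hypergraph \<Rightarrow> 'v \<Rightarrow>
   ('v, 'e) hypergraph \<Rightarrow> ('v \<Rightarrow> 'x set) \<Rightarrow> ('x, 'f) hypergraph \<Rightarrow> 'v \<Rightarrow> 'v \<Rightarrow>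
   ('v, 'e) hypergraph \<Rightarrow> ('v \<Rightarrow> 'x set) \<Rightarrow> ('x, 'f) hypergraph \<Rightarrow> bool" where
  "is_merging G1 X1 H1 v1 G2 X2 H2 v2 w G X H \<longleftrightarrow>
     verts G1 \<inter> verts G2 = {} \<and> edges G1 \<inter> edges G2 = {} \<and>
     verts H1 \<inter> verts H2 = {} \<and> edges H1 \<inter> edges H2 = {} \<and>
     v1 \<in> verts G1 \<and> v2 \<in> verts G2 \<and> w \<notin> verts G1 \<union> verts G2 \<and>
     verts G = identify v1 v2 w ` (verts G1 \<union> verts G2) \<and>
     edges G = edges G1 \<union> edges G2 \<and>
     (\<forall>e\<in>edges G1. inc G e = identify v1 v2 w ` inc G1 e) \<and>
     (\<forall>e\<in>edges G2. inc G e = identify v1 v2 w ` inc G2 e) \<and>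
     is_union H {H1, H2} \<and>
     X w = X1 v1 \<union> X2 v2 \<and>
     (\<forall>v\<in>verts G1 - {v1}. X v = X1 v) \<and>
     (\<forall>v\<in>verts G2 - {v2}. X v = X2 v)"

text \<open>The vertices of \<open>G\<close> range over an infinite type: merging consumes three fresh vertices
  \<open>v1\<close>, \<open>v2\<close>, \<open>w\<close> for one vertex of the result, so over a finite type the closure would miss
  configurations for lack of vertex names. All other types may be finite, because edges of \<open>G\<close>
  and vertices and edges of \<open>H\<close> are never renamed.\<close>

inductive constructible ::
  "('v::infinite, 'e) hypergraph \<Rightarrow> ('v \<Rightarrow> 'x set) \<Rightarrow> ('x, 'f) hypergraph \<Rightarrow> bool" where
  K: "K_configuration G X H \<Longrightarrow> constructible G X H"
| C: "C_configuration G X H \<Longrightarrow> constructible G X H"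
| E: "E_configuration G X H \<Longrightarrow> constructible G X H"
| merge: "constructible G1 X1 H1 \<Longrightarrow> constructible G2 X2 H2 \<Longrightarrow>
    is_merging G1 X1 H1 v1 G2 X2 H2 v2 w G X H \<Longrightarrow> feasible G X H \<Longrightarrow> constructible G X H"

end

theory Submission
  imports Defs
begin

text \<open>A \<^emph>\<open>hole\<close> at \<open>v\<close> is a colouring of \<open>G - v\<close>. If \<open>(G, X, H)\<close> is degree-feasible and
  uncolorable, then every colour of \<open>v\<close> is blocked by exactly one edge at \<open>v\<close> and conversely, so
  the hole can be moved along any edge \<open>e\<close>: give \<open>v\<close> the colour blocked by \<open>e\<close> and uncolour another
  vertex of \<open>e\<close>. Moving holes around keeps prescribed colours at vertices whose removal leaves
  \<open>G\<close> connected. If \<open>G\<close> has no separating vertex, this shows that a hyperedge of \<open>G\<close> is its only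
  edge and, if all edges are ordinary, that every colour at \<open>u\<close> has \<open>\<mu>(u, v)\<close> neighbours in
  \<open>X\<^sub>v\<close> and that two vertices \<open>u\<close>, \<open>w\<close> with \<open>G - u - w\<close> connected and a common neighbour are
  adjacent. Hence the underlying simple graph is complete or a cycle, and the neighbourhoods in \<open>H\<close>
  give a K- or C-configuration. At a separating vertex \<open>v\<close>, the colours of \<open>v\<close> blocked from
  one side do not depend on the colouring, so the configuration is a merging. Conversely, K-, C-
  and E-configurations are minimal uncolorable, and so are mergings of such configurations.\<close>

text \<open>Transversals are handled as choice functions on a vertex set \<open>S\<close> that may
  be a proper part of \<open>V\<close>: a hole is the case \<open>S = V - {v}\<close>, and moving it
  is a function update. The rigidity of holes is a counting fact: an edge of \<open>G\<close> blocks
  at most one colour at an uncoloured vertex, and there are at least as many colours as edges.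
  Blocking is attributed to edges of \<open>G\<close>, not of \<open>H\<close>, because matchings of
  parallel edges may overlap. For constructible configurations the obstacle is that minimal
  uncolorability alone does not survive a merging: to colour one side completely, the other side
  must be coloured without its merged vertex. The invariant \<open>critical\<close> therefore also
  demands a hole at every vertex. In the other direction the induction is on the number of vertices.
  At a separating vertex each side receives exactly as many colours as it has edges there, so
  degree-feasibility is inherited; minimality ensures that no edge of \<open>H\<close> leads from
  one side to a colour blocked from the other, so that the two parts together contain all of
  \<open>H\<close>.\<close>

definition ptrans ::
  "('v \<Rightarrow> 'x set) \<Rightarrow> ('x, 'f) hypergraph \<Rightarrow> 'v set \<Rightarrow> ('v \<Rightarrow> 'x) \<Rightarrow> bool" where
  "ptrans X H S \<phi> \<longleftrightarrow> (\<forall>v\<in>S. \<phi> v \<in> X v) \<and> (\<forall>f\<in>edges H. \<not> inc H f \<subseteq> \<phi> ` S)"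

text \<open>A transversal contains the image of its choice function, and independence passes to
  subsets. Conversely, disjointness of the lists makes the image of \<open>\<phi>\<close> meet each
  \<open>X v\<close> in \<open>\<phi> v\<close> alone.\<close>

lemma colorable_iff_ptrans:
  assumes "verts H = (\<Union>v\<in>verts G. X v)" "disjoint_family_on X (verts G)"
  shows "colorable G X H \<longleftrightarrow> (\<exists>\<phi>. ptrans X H (verts G) \<phi>)"
proof
  assume "colorable G X H"
  then obtain T where T: "\<forall>f\<in>edges H. \<not> inc H f \<subseteq> T" "\<forall>v\<in>verts G. card (T \<inter> X v) = 1"
    unfolding colorable_def independent_transversal_def independent_def induced_def by auto
  define \<phi> where "\<phi> v = the_elem (T \<inter> X v)" for v
  have \<phi>: "T \<inter> X v = {\<phi> v}" if "v \<in> verts G" for v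
    using T(2) that unfolding \<phi>_def by (metis card_1_singletonE the_elem_eq)
  then have "\<phi> ` verts G \<subseteq> T" by auto
  moreover have "\<phi> v \<in> X v" if "v \<in> verts G" for v
    using \<phi>[OF that] by blast
  ultimately have "ptrans X H (verts G) \<phi>"
    using T(1) unfolding ptrans_def by (meson order_trans)
  then show "\<exists>\<phi>. ptrans X H (verts G) \<phi>" by blast
next
  assume "\<exists>\<phi>. ptrans X H (verts G) \<phi>"
  then obtain \<phi> where \<phi>: "ptrans X H (verts G) \<phi>" by blast
  have "(\<phi> ` verts G) \<inter> X v = {\<phi> v}" if "v \<in> verts G" for v
    using \<phi> that assms(2) unfolding ptrans_def disjoint_family_on_def
    by auto (metis disjoint_iff)
  then have "independent_transversal G X H (\<phi> ` verts G)"
    using \<phi> assms(1) unfolding ptrans_def independent_transversal_def independent_def induced_def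
    by auto
  then show "colorable G X H" unfolding colorable_def by blast
qed

lemma delete_edge_simps [simp]:
  "verts (delete_edge H f) = verts H" "edges (delete_edge H f) = edges H - {f}"
  "inc (delete_edge H f) = inc H"
  by (simp_all add: delete_edge_def)

lemma induced_simps [simp]:
  "verts (induced H Y) = Y" "edges (induced H Y) = {e \<in> edges H. inc H e \<subseteq> Y}"
  "inc (induced H Y) = inc H"
  by (simp_all add: induced_def)

lemma ptrans_delete_edge:
  assumes "\<not> ptrans X H S \<phi>" "ptrans X (delete_edge H f) S \<phi>"
  shows "f \<in> edges H" "inc H f \<subseteq> \<phi> ` S"
  using assms unfolding ptrans_def by auto

lemma minimal_uncolorable_iff_ptrans:
  assumes "verts H = (\<Union>v\<in>verts G. X v)" "disjoint_family_on X (verts G)"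
  shows "minimal_uncolorable G X H \<longleftrightarrow>
    (\<nexists>\<phi>. ptrans X H (verts G) \<phi>) \<and>
    (\<forall>f\<in>edges H. \<exists>\<phi>. ptrans X (delete_edge H f) (verts G) \<phi>)"
  using assms unfolding minimal_uncolorable_def by (simp add: colorable_iff_ptrans)

lemma disjoint_family_image_eq:
  assumes "disjoint_family_on X V" "\<forall>v\<in>V. \<phi> v \<in> X v" "v \<in> V" "x \<in> X v" "x \<in> \<phi> ` V"
  shows "\<phi> v = x"
proof -
  obtain w where w: "w \<in> V" "x = \<phi> w" using assms(5) by blast
  then have "x \<in> X w" using assms(2) by simp
  then have "w = v" using assms(1,3,4) w(1) unfolding disjoint_family_on_def by blast
  then show ?thesis using w by simp
qed

lemma cover_props:
  assumes "cover G X H"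
  shows "wf_hypergraph H" "disjoint_family_on X (verts G)" "verts H = (\<Union>v\<in>verts G. X v)"
  using assms unfolding cover_def by auto

lemma feasible_props:
  assumes "feasible G X H"
  shows "wf_hypergraph G" "connected_hypergraph G" "cover G X H" "wf_hypergraph H"
    "disjoint_family_on X (verts G)" "verts H = (\<Union>v\<in>verts G. X v)"
  using assms cover_props[of G X H] unfolding feasible_def by auto

lemma wf_hypergraph_inc:
  assumes "wf_hypergraph H" "f \<in> edges H"
  shows "inc H f \<subseteq> verts H" "card (inc H f) \<ge> 2" "inc H f \<noteq> {}" "finite (inc H f)"
proof -
  show "inc H f \<subseteq> verts H" "card (inc H f) \<ge> 2" using assms unfolding wf_hypergraph_def by auto
  then show "inc H f \<noteq> {}" by auto
  show "finite (inc H f)" using \<open>card (inc H f) \<ge> 2\<close> card.infinite by fastforce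
qed

text \<open>A colouring that is proper once \<open>f\<close> is deleted must use all ends of
  \<open>f\<close>. It would then also use all ends of a parallel edge \<open>g\<close>, which is
  still present.\<close>

lemma minimal_uncolorable_simple:
  assumes "feasible G X H" "minimal_uncolorable G X H" "f \<in> edges H" "g \<in> edges H"
    "inc H f = inc H g"
  shows "f = g"
proof (rule ccontr)
  assume "f \<noteq> g"
  note * = assms(2)[unfolded minimal_uncolorable_iff_ptrans[OF feasible_props(6,5)[OF assms(1)]]]
  from * assms(3) obtain \<phi> where \<phi>: "ptrans X (delete_edge H f) (verts G) \<phi>" by blast
  then have "inc H f \<subseteq> \<phi> ` verts G" using * ptrans_delete_edge by metis
  with \<phi> assms(4,5) \<open>f \<noteq> g\<close> show False unfolding ptrans_def by auto
qed

section \<open>Connectivity by cuts\<close>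

text \<open>Connectivity is used below by growing a set of reached vertices until no edge leaves it;
  this form delivers the leaving edge at once and spares the bookkeeping of distinct vertices and
  edges in hyperpaths.\<close>

definition cut_connected :: "('v, 'e) hypergraph \<Rightarrow> bool" where
  "cut_connected G \<longleftrightarrow> (\<forall>A. A \<subseteq> verts G \<longrightarrow> A \<noteq> {} \<longrightarrow> A \<noteq> verts G \<longrightarrow>
     (\<exists>e\<in>edges G. inc G e \<inter> A \<noteq> {} \<and> inc G e \<inter> (verts G - A) \<noteq> {}))"

lemma hyperpath_take:
  assumes "hyperpath G vs es" "j \<le> length es"
  shows "hyperpath G (take (Suc j) vs) (take j es)"
  using assms unfolding hyperpath_def
  by (auto dest: in_set_takeD)

lemma hyperpath_snoc:
  assumes "hyperpath G vs es" "e \<in> edges G" "e \<notin> set es" "b \<in> verts G" "b \<notin> set vs"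
    "last vs \<in> inc G e" "b \<in> inc G e"
  shows "hyperpath G (vs @ [b]) (es @ [e])"
proof -
  have len: "length vs = length es + 1" using assms(1) unfolding hyperpath_def by blast
  then have "last vs = vs ! length es" by (subst last_conv_nth) auto
  then show ?thesis
    using assms len unfolding hyperpath_def by (auto simp: nth_append less_Suc_eq)
qed

text \<open>The edge by which a hyperpath from \<open>A\<close> to the outside reaches its earliest
  vertex outside \<open>A\<close> crosses the cut.\<close>

lemma connected_imp_cut_connected:
  assumes "connected_hypergraph G"
  shows "cut_connected G"
  unfolding cut_connected_def
proof (intro allI impI)
  fix A assume A: "A \<subseteq> verts G" "A \<noteq> {}" "A \<noteq> verts G"
  then obtain u v where uv: "u \<in> A" "v \<in> verts G" "v \<notin> A" by blast
  then obtain vs es where p: "hyperpath G vs es" "hd vs = u" "last vs = v"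
    using assms A(1) unfolding connected_hypergraph_def by blast
  have len: "length vs = length es + 1" and ne: "vs \<noteq> []" using p(1) unfolding hyperpath_def by auto
  have "\<exists>j\<le>length es. vs ! j \<notin> A"
    using uv(3) p(3) len ne by (intro exI[of _ "length es"]) (auto simp: last_conv_nth)
  then obtain k where k: "k \<le> length es \<and> vs ! k \<notin> A"
      "\<And>j. j < k \<Longrightarrow> \<not> (j \<le> length es \<and> vs ! j \<notin> A)"
    using exists_least_iff[of "\<lambda>j. j \<le> length es \<and> vs ! j \<notin> A"] by blast
  have "k \<noteq> 0" using uv(1) p(2) k(1) hd_conv_nth[OF ne] by (cases "k = 0") auto
  then obtain j where j: "k = Suc j" using not0_implies_Suc by blast
  have "{vs ! j, vs ! Suc j} \<subseteq> inc G (es ! j)" "es ! j \<in> edges G" "vs ! Suc j \<in> verts G"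
    using p(1) k(1) j len unfolding hyperpath_def by auto
  moreover have "vs ! j \<in> A" "vs ! Suc j \<notin> A" using k(1) k(2)[of j] j by auto
  ultimately show "\<exists>e\<in>edges G. inc G e \<inter> A \<noteq> {} \<and> inc G e \<inter> (verts G - A) \<noteq> {}"
    by (intro bexI[of _ "es ! j"]) auto
qed

lemma cut_connected_imp_connected:
  assumes "cut_connected G" "wf_hypergraph G"
  shows "connected_hypergraph G"
  unfolding connected_hypergraph_def
proof (intro ballI)
  fix u v assume u: "u \<in> verts G" and v: "v \<in> verts G"
  let ?P = "\<lambda>a vs es. hyperpath G vs es \<and> hd vs = u \<and> last vs = a"
  define R where "R = {a. \<exists>vs es. ?P a vs es}"
  have pref: "vs ! j \<in> R" "?P (vs ! j) (take (Suc j) vs) (take j es)"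
    if "?P a vs es" "j \<le> length es" for a vs es j
  proof -
    have "length vs = length es + 1" using that unfolding hyperpath_def by blast
    moreover from this have "hd (take (Suc j) vs) = hd vs" by (cases vs) auto
    moreover have "last (take (Suc j) vs) = vs ! j"
      using calculation(1) that(2) by (simp add: take_Suc_conv_app_nth)
    ultimately show "?P (vs ! j) (take (Suc j) vs) (take j es)"
      using that hyperpath_take[of G vs es j] by auto
    then show "vs ! j \<in> R" unfolding R_def by blast
  qed
  have "?P u [u] []" using u by (simp add: hyperpath_def)
  then have "u \<in> R" unfolding R_def by blast
  have R: "R \<subseteq> verts G"
  proof
    fix a assume "a \<in> R"
    then obtain vs es where p: "?P a vs es" unfolding R_def by blast
    then have "vs \<noteq> []" unfolding hyperpath_def by auto
    then have "a \<in> set vs" using p last_in_set by blast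
    then show "a \<in> verts G" using p unfolding hyperpath_def by blast
  qed
  have "R = verts G"
  proof (rule ccontr)
    assume "R \<noteq> verts G"
    then obtain e where e: "e \<in> edges G" "inc G e \<inter> R \<noteq> {}" "inc G e \<inter> (verts G - R) \<noteq> {}"
      using assms(1) R \<open>u \<in> R\<close> unfolding cut_connected_def by blast
    then obtain b where b: "b \<in> inc G e" "b \<in> verts G" "b \<notin> R" by blast
    \<comment> \<open>A hyperpath may not repeat an edge. A shortest one to a vertex of
      \<open>e\<close> cannot contain \<open>e\<close>, since its prefix up to the vertex before
      \<open>e\<close> would already end in \<open>e\<close>; so \<open>e\<close> may be
      appended.\<close>
    let ?Q = "\<lambda>n. \<exists>a vs es. a \<in> inc G e \<and> ?P a vs es \<and> length es = n"
    from e(2) have "\<exists>n. ?Q n" unfolding R_def by blast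
    then obtain n where n: "?Q n" "\<And>m. m < n \<Longrightarrow> \<not> ?Q m"
      using exists_least_iff[of ?Q] by blast
    then obtain a vs es where p: "a \<in> inc G e" "?P a vs es" "length es = n" by blast
    have len: "length vs = length es + 1" using p unfolding hyperpath_def by blast
    have "e \<notin> set es"
    proof
      assume "e \<in> set es"
      then obtain j where j: "j < length es" "es ! j = e" by (metis in_set_conv_nth)
      then have "vs ! j \<in> inc G e" using p(2) unfolding hyperpath_def by auto
      then have "?Q j" using pref(2)[OF p(2), of j] j(1) by (metis length_take less_imp_le min.absorb2)
      then show False using n(2) j(1) p(3) by blast
    qed
    moreover have "b \<notin> set vs"
    proof
      assume "b \<in> set vs"
      then obtain j where "j < length vs" "vs ! j = b" by (metis in_set_conv_nth)
      then show False using pref(1)[OF p(2), of j] b(3) len by simp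
    qed
    ultimately have "hyperpath G (vs @ [b]) (es @ [e])"
      using hyperpath_snoc[of G vs es e b] p b e(1) by blast
    moreover have "hd (vs @ [b]) = u" using p len by (cases vs) auto
    ultimately have "b \<in> R" unfolding R_def by force
    then show False using b(3) by blast
  qed
  then show "\<exists>vs es. ?P v vs es" using v unfolding R_def by blast
qed

section \<open>Signs along a cycle\<close>

lemma prod_Suc_mod:
  fixes s :: "nat \<Rightarrow> int"
  assumes "n > 0"
  shows "(\<Prod>k<n. s (Suc k mod n)) = (\<Prod>k<n. s k)"
proof -
  obtain m where m: "n = Suc m" using assms gr0_implies_Suc by blast
  have "(\<Prod>k<n. s (Suc k mod n)) = (\<Prod>k<m. s (Suc k mod n)) * s (Suc m mod n)"
    unfolding m by simp
  also have "\<dots> = (\<Prod>k<m. s (Suc k)) * s 0" unfolding m by simp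
  also have "\<dots> = (\<Prod>k<n. s k)" unfolding m by (subst prod.lessThan_Suc_shift) simp
  finally show ?thesis .
qed

text \<open>If \<open>s\<close> changes by the factor \<open>- \<tau> k\<close> along every edge \<open>k \<noteq> j\<close> of a cycle, then the edge
  \<open>j\<close> behaves likewise if and only if the product of all factors is 1.\<close>

lemma signed_cycle_closing:
  fixes s \<tau> :: "nat \<Rightarrow> int"
  assumes j: "j < n" and s: "\<And>k. k < n \<Longrightarrow> s k \<in> {1, -1}" and \<tau>: "\<And>k. k < n \<Longrightarrow> \<tau> k \<in> {1, -1}"
    and step: "\<And>k. k < n \<Longrightarrow> k \<noteq> j \<Longrightarrow> s (Suc k mod n) = - \<tau> k * s k"
  shows "s (Suc j mod n) = (\<Prod>k<n. - \<tau> k) * (- \<tau> j) * s j"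
proof -
  have sq: "s k * s k = 1" "\<tau> k * \<tau> k = 1" if "k < n" for k using s[OF that] \<tau>[OF that] by auto
  let ?R = "\<Prod>k\<in>{..<n} - {j}. - \<tau> k"
  \<comment> \<open>Each \<open>s k\<close> occurs twice in the product over consecutive pairs, so
    this product is 1; splitting off the pair at \<open>j\<close> determines its factor.\<close>
  have "1 = (\<Prod>k<n. s k * s k)" using sq by simp
  also have "\<dots> = (\<Prod>k<n. s (Suc k mod n) * s k)"
    unfolding prod.distrib using prod_Suc_mod[of n s] j by simp
  also have "\<dots> = (s (Suc j mod n) * s j) * (\<Prod>k\<in>{..<n} - {j}. s (Suc k mod n) * s k)"
    using j by (subst prod.remove[of _ j]) auto
  also have "(\<Prod>k\<in>{..<n} - {j}. s (Suc k mod n) * s k) = ?R"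
    using step sq(1) by (intro prod.cong) (auto simp: mult.assoc)
  finally have 1: "s (Suc j mod n) * s j * ?R = 1" by simp
  have 2: "(\<Prod>k<n. - \<tau> k) = - \<tau> j * ?R" using j by (subst prod.remove[of _ j]) auto
  have R: "?R * ?R = 1"
    unfolding prod.distrib[symmetric] using sq(2) by (intro prod.neutral) auto
  have "(\<Prod>k<n. - \<tau> k) * (- \<tau> j) * s j = (\<tau> j * \<tau> j) * ?R * s j" unfolding 2 by simp
  also have "\<dots> = ?R * s j * (s (Suc j mod n) * s j * ?R)" using sq(2)[OF j] 1 by simp
  also have "\<dots> = (?R * ?R) * (s j * s j) * s (Suc j mod n)" by (simp add: mult_ac)
  finally show ?thesis using R sq(1)[OF j] by simp
qed

text \<open>Start with \<open>\<sigma>\<close> just after the edge \<open>j\<close> and apply the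
  prescribed factors once round the cycle. The walk ends at \<open>j\<close>, so the exempted edge
  is the only one never crossed.\<close>

lemma signed_cycle_exists:
  fixes \<tau> :: "nat \<Rightarrow> int"
  assumes j: "j < n" and \<tau>: "\<And>k. k < n \<Longrightarrow> \<tau> k \<in> {1, -1}" and \<sigma>: "\<sigma> \<in> {1, -1}"
  shows "\<exists>s. (\<forall>k<n. s k \<in> {1, -1}) \<and> (\<forall>k<n. k \<noteq> j \<longrightarrow> s (Suc k mod n) = - \<tau> k * s k) \<and>
    s (Suc j mod n) = \<sigma>"
proof -
  define d where "d = rec_nat \<sigma> (\<lambda>m z. - \<tau> ((Suc j + m) mod n) * z)"
  have d0: "d 0 = \<sigma>" and dS: "d (Suc m) = - \<tau> ((Suc j + m) mod n) * d m" for m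
    unfolding d_def by simp_all
  have d: "d m \<in> {1, -1}" for m
  proof (induction m)
    case 0 then show ?case using \<sigma> d0 by simp
  next
    case (Suc m)
    have "\<tau> ((Suc j + m) mod n) \<in> {1, -1}" using \<tau> j by simp
    with Suc show ?case using dS[of m] by auto
  qed
  \<comment> \<open>The number of steps from \<open>Suc j mod n\<close> forward to \<open>k\<close>;
    the second branch is the case in which the walk has wrapped around.\<close>
  define off where "off k = (if k > j then k - j - 1 else k + n - j - 1)" for k
  have off0: "off (Suc j mod n) = 0"
  proof (cases "Suc j = n")
    case True then show ?thesis unfolding off_def by auto
  next
    case False then show ?thesis using j unfolding off_def by simp
  qed
  have offS: "off (Suc k mod n) = Suc (off k)" "(Suc j + off k) mod n = k" if "k < n" "k \<noteq> j" for k
  proof -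
    show "(Suc j + off k) mod n = k" using that j unfolding off_def by auto
    show "off (Suc k mod n) = Suc (off k)"
    proof (cases "Suc k = n")
      case True then show ?thesis using that j unfolding off_def by auto
    next
      case False then show ?thesis using that j unfolding off_def by auto
    qed
  qed
  show ?thesis
    using d d0 dS off0 offS by (intro exI[of _ "\<lambda>k. d (off k)"]) auto
qed

section \<open>Critical configurations\<close>

text \<open>The third clause does not follow from the others: a single empty list with an edgeless
  \<open>H\<close> is minimal uncolorable, but leaves no hole at any other vertex. Merging needs
  these holes to complete a colouring of one side.\<close>

definition critical ::
  "('v, 'e) hypergraph \<Rightarrow> ('v \<Rightarrow> 'x set) \<Rightarrow> ('x, 'f) hypergraph \<Rightarrow> bool" where
  "critical G X H \<longleftrightarrow> (\<nexists>\<phi>. ptrans X H (verts G) \<phi>) \<and>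
     (\<forall>f\<in>edges H. \<exists>\<phi>. ptrans X (delete_edge H f) (verts G) \<phi>) \<and>
     (\<forall>v\<in>verts G. \<exists>\<phi>. ptrans X H (verts G - {v}) \<phi>)"

lemma critical_imp_minimal_uncolorable:
  assumes "feasible G X H" "critical G X H"
  shows "minimal_uncolorable G X H"
  using assms(2) minimal_uncolorable_iff_ptrans[OF feasible_props(6,5)[OF assms(1)]]
  unfolding critical_def by blast

text \<open>A hole at \<open>v\<close> comes from deleting an edge \<open>f\<close> that meets
  \<open>X v\<close>: the resulting colouring uses all ends of \<open>f\<close>, so uncolouring
  \<open>v\<close> breaks \<open>f\<close>, and \<open>f\<close> may be put back. For a single
  vertex the hole is the empty colouring.\<close>

lemma criticalI:
  assumes "feasible G X H" "\<nexists>\<phi>. ptrans X H (verts G) \<phi>"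
    and del: "\<And>f. f \<in> edges H \<Longrightarrow> \<exists>\<phi>. ptrans X (delete_edge H f) (verts G) \<phi>"
    and hit: "\<And>v. v \<in> verts G \<Longrightarrow> verts G = {v} \<or> (\<exists>f\<in>edges H. inc H f \<inter> X v \<noteq> {})"
  shows "critical G X H"
proof -
  note F = feasible_props[OF assms(1)]
  have "\<exists>\<phi>. ptrans X H (verts G - {v}) \<phi>" if v: "v \<in> verts G" for v
  proof (cases "verts G = {v}")
    case True
    then have "ptrans X H (verts G - {v}) \<phi>" for \<phi>
      using wf_hypergraph_inc(3)[OF F(4)] unfolding ptrans_def by auto
    then show ?thesis by blast
  next
    case False
    then obtain f z where f: "f \<in> edges H" "z \<in> inc H f" "z \<in> X v" using hit[OF v] by blast
    obtain \<phi> where \<phi>: "ptrans X (delete_edge H f) (verts G) \<phi>" using del[OF f(1)] by blast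
    have "inc H f \<subseteq> \<phi> ` verts G" using ptrans_delete_edge(2)[OF _ \<phi>] assms(2) by blast
    then have "\<phi> v = z"
      using disjoint_family_image_eq[OF F(5) _ v f(3)] \<phi> f(2) unfolding ptrans_def by blast
    have "z \<notin> \<phi> ` (verts G - {v})"
    proof
      assume "z \<in> \<phi> ` (verts G - {v})"
      then obtain u where "u \<in> verts G" "u \<noteq> v" "z = \<phi> u" by blast
      moreover from this have "z \<in> X u" using \<phi> unfolding ptrans_def by blast
      ultimately show False using F(5) v f(3) unfolding disjoint_family_on_def by blast
    qed
    then have "\<not> inc H f \<subseteq> \<phi> ` (verts G - {v})" using f(2) by blast
    moreover have "\<not> inc H g \<subseteq> \<phi> ` (verts G - {v})" if "g \<in> edges H" "g \<noteq> f" for g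
    proof -
      have "\<not> inc H g \<subseteq> \<phi> ` verts G" using \<phi> that unfolding ptrans_def by simp
      then show ?thesis by blast
    qed
    ultimately have "ptrans X H (verts G - {v}) \<phi>"
      using \<phi> unfolding ptrans_def by (metis DiffD1)
    then show ?thesis by blast
  qed
  then show ?thesis using assms(2) del unfolding critical_def by blast
qed

section \<open>Merging\<close>

lemma is_merging_sym:
  assumes "is_merging G1 X1 H1 v1 G2 X2 H2 v2 w G X H"
  shows "is_merging G2 X2 H2 v2 G1 X1 H1 v1 w G X H"
proof -
  have "identify v2 v1 w = identify v1 v2 w" unfolding identify_def by auto
  then show ?thesis using assms unfolding is_merging_def by (simp add: Un_commute Int_commute insert_commute)
qed

lemma is_merging_props:
  assumes "is_merging G1 X1 H1 v1 G2 X2 H2 v2 w G X H"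
  shows "verts G1 \<inter> verts G2 = {}" "v1 \<in> verts G1" "v2 \<in> verts G2" "w \<notin> verts G1" "w \<notin> verts G2"
    "verts G = insert w ((verts G1 - {v1}) \<union> (verts G2 - {v2}))"
    "edges H = edges H1 \<union> edges H2" "\<And>f. f \<in> edges H1 \<Longrightarrow> inc H f = inc H1 f"
    "\<And>f. f \<in> edges H2 \<Longrightarrow> inc H f = inc H2 f"
    "X w = X1 v1 \<union> X2 v2" "\<And>v. v \<in> verts G1 - {v1} \<Longrightarrow> X v = X1 v"
    "\<And>v. v \<in> verts G2 - {v2} \<Longrightarrow> X v = X2 v"
    "verts H1 \<inter> verts H2 = {}" "edges H1 \<inter> edges H2 = {}"
proof -
  have m: "verts G1 \<inter> verts G2 = {}" "v1 \<in> verts G1" "v2 \<in> verts G2" "w \<notin> verts G1 \<union> verts G2"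
    "verts G = identify v1 v2 w ` (verts G1 \<union> verts G2)" "is_union H {H1, H2}"
    "X w = X1 v1 \<union> X2 v2" "\<forall>v\<in>verts G1 - {v1}. X v = X1 v" "\<forall>v\<in>verts G2 - {v2}. X v = X2 v"
    "verts H1 \<inter> verts H2 = {}" "edges H1 \<inter> edges H2 = {}"
    using assms unfolding is_merging_def by - (elim conjE, assumption)+
  show 1: "verts G1 \<inter> verts G2 = {}" "v1 \<in> verts G1" "v2 \<in> verts G2" "w \<notin> verts G1" "w \<notin> verts G2"
    using m(1-4) by simp_all
  have "verts G = identify v1 v2 w ` (verts G1 \<union> verts G2)" by (rule m)
  then show "verts G = insert w ((verts G1 - {v1}) \<union> (verts G2 - {v2}))"
  proof (rule ssubst, intro subset_antisym subsetI)
    fix x assume "x \<in> insert w ((verts G1 - {v1}) \<union> (verts G2 - {v2}))"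
    then consider "x = w" | "x \<in> verts G1 - {v1}" | "x \<in> verts G2 - {v2}" by blast
    then show "x \<in> identify v1 v2 w ` (verts G1 \<union> verts G2)"
    proof cases
      case 1
      then have "x = identify v1 v2 w v1" unfolding identify_def by simp
      then show ?thesis using m(2) by blast
    next
      case 2
      then have "x = identify v1 v2 w x" using m(1,3) unfolding identify_def by auto
      then show ?thesis using 2 by blast
    next
      case 3
      then have "x = identify v1 v2 w x" using m(1,2) unfolding identify_def by auto
      then show ?thesis using 3 by blast
    qed
  qed (use 1 in \<open>auto simp: identify_def\<close>)
  show "edges H = edges H1 \<union> edges H2" "X w = X1 v1 \<union> X2 v2"
    "verts H1 \<inter> verts H2 = {}" "edges H1 \<inter> edges H2 = {}"
    using m(6,7,10,11) unfolding is_union_def by simp_all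
  show "inc H f = inc H1 f" if "f \<in> edges H1" for f using m(6) that unfolding is_union_def by simp
  show "inc H f = inc H2 f" if "f \<in> edges H2" for f using m(6) that unfolding is_union_def by simp
  show "X v = X1 v" if "v \<in> verts G1 - {v1}" for v using m(8) that by simp
  show "X v = X2 v" if "v \<in> verts G2 - {v2}" for v using m(9) that by simp
qed

text \<open>Each edge of \<open>H\<close> lives on one side, and the colours of the sides are
  disjoint, so properness is decided separately on each side. The first side supplies the colour of
  \<open>w\<close>, which is why \<open>S2\<close> omits \<open>v2\<close>; \<open>K1\<close> may be
  \<open>H1\<close> or \<open>H1\<close> without an edge.\<close>

lemma merging_glue:
  assumes m: "is_merging G1 X1 H1 v1 G2 X2 H2 v2 w G X H"
    and F: "feasible G1 X1 H1" "feasible G2 X2 H2"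
    and S: "S1 \<subseteq> verts G1" "S2 \<subseteq> verts G2 - {v2}"
    and p: "ptrans X1 K1 S1 \<phi>1" "ptrans X2 H2 S2 \<phi>2"
    and K: "edges K1 \<subseteq> edges H1" "inc K1 = inc H1" "edges K \<subseteq> edges K1 \<union> edges H2" "inc K = inc H"
  shows "ptrans X K (identify v1 v2 w ` S1 \<union> S2)
    (\<lambda>u. if u = w then \<phi>1 v1 else if u \<in> verts G1 then \<phi>1 u else \<phi>2 u)"
    (is "ptrans X K ?S _")
proof -
  note M = is_merging_props[OF m]
  define \<phi> where "\<phi> u = (if u = w then \<phi>1 v1 else if u \<in> verts G1 then \<phi>1 u else \<phi>2 u)" for u
  have a: "\<phi> (identify v1 v2 w s) = \<phi>1 s" "\<phi>1 s \<in> X (identify v1 v2 w s)" if "s \<in> S1" for s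
  proof -
    have "s \<in> verts G1" "s \<noteq> v2" "\<phi>1 s \<in> X1 s" using that S M p unfolding ptrans_def by auto
    then show "\<phi> (identify v1 v2 w s) = \<phi>1 s" "\<phi>1 s \<in> X (identify v1 v2 w s)"
      using M(4,10,11) unfolding identify_def \<phi>_def by auto
  qed
  have b: "\<phi> s = \<phi>2 s" "\<phi>2 s \<in> X s" if "s \<in> S2" for s
  proof -
    have "s \<in> verts G2 - {v2}" "s \<noteq> w" "s \<notin> verts G1" "\<phi>2 s \<in> X2 s"
      using that S M p unfolding ptrans_def by auto
    then show "\<phi> s = \<phi>2 s" "\<phi>2 s \<in> X s" using M(12) unfolding \<phi>_def by auto
  qed
  have im: "\<phi> ` ?S = \<phi>1 ` S1 \<union> \<phi>2 ` S2"
    using a(1) b(1) by (simp only: image_Un image_image cong: image_cong)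
  have sub: "\<phi>1 ` S1 \<subseteq> verts H1" "\<phi>2 ` S2 \<subseteq> verts H2"
    using p S feasible_props(6)[OF F(1)] feasible_props(6)[OF F(2)] unfolding ptrans_def by auto
  have "\<not> inc K f \<subseteq> \<phi> ` ?S" if "f \<in> edges K" for f
  proof (cases "f \<in> edges K1")
    case True
    then have "f \<in> edges H1" using K(1) by blast
    with True have "inc K f = inc H1 f" "inc H1 f \<subseteq> verts H1" "\<not> inc H1 f \<subseteq> \<phi>1 ` S1"
      using K M(8) p(1) wf_hypergraph_inc(1)[OF feasible_props(4)[OF F(1)]] unfolding ptrans_def
      by auto
    then show ?thesis using im sub(2) M(13) by blast
  next
    case False
    then have "f \<in> edges H2" using K that by auto
    then have "inc K f = inc H2 f" "inc H2 f \<subseteq> verts H2" "\<not> inc H2 f \<subseteq> \<phi>2 ` S2"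
      using K M(9) p(2) wf_hypergraph_inc(1)[OF feasible_props(4)[OF F(2)]] unfolding ptrans_def
      by auto
    then show ?thesis using im sub(1) M(13) by blast
  qed
  moreover have "\<forall>v\<in>?S. \<phi> v \<in> X v" using a b by auto
  ultimately show ?thesis unfolding ptrans_def \<phi>_def[abs_def] by blast
qed

text \<open>Giving \<open>v1\<close> the colour of \<open>w\<close> keeps the image inside the image
  of \<open>\<phi>\<close>, so no edge of this side can become contained in it.\<close>

lemma merging_restrict:
  assumes m: "is_merging G1 X1 H1 v1 G2 X2 H2 v2 w G X H"
    and \<phi>: "ptrans X K (verts G) \<phi>" "\<phi> w \<in> X1 v1"
    and K: "edges K1 \<subseteq> edges H1" "edges K1 \<subseteq> edges K" "inc K1 = inc H1" "inc K = inc H"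
  shows "ptrans X1 K1 (verts G1) (\<phi>(v1 := \<phi> w))"
proof -
  note M = is_merging_props[OF m]
  have "(\<phi>(v1 := \<phi> w)) ` verts G1 \<subseteq> \<phi> ` verts G" using M(6) by auto
  moreover have "inc K1 f = inc K f" if "f \<in> edges K1" for f using that K M(8) by auto
  moreover have "\<phi> v \<in> X1 v" if "v \<in> verts G1" "v \<noteq> v1" for v
    using that \<phi>(1) M(6,11) unfolding ptrans_def by auto
  moreover have "(\<phi>(v1 := \<phi> w)) v \<in> X1 v" if "v \<in> verts G1" for v
    using calculation(3)[OF that] \<phi>(2) by simp
  ultimately show ?thesis using \<phi>(1) K(2) unfolding ptrans_def by (metis order_trans subsetD)
qed

text \<open>A colouring of the whole takes its colour at \<open>w\<close> from one of the sides and
  would colour that side completely. Deletions and holes on one side are completed by a hole at the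
  merged vertex of the other.\<close>

lemma merging_critical:
  assumes m: "is_merging G1 X1 H1 v1 G2 X2 H2 v2 w G X H"
    and F: "feasible G1 X1 H1" "feasible G2 X2 H2"
    and c: "critical G1 X1 H1" "critical G2 X2 H2"
  shows "critical G X H"
proof -
  note M = is_merging_props[OF m]
  \<comment> \<open>Generalised over both configurations so that it applies again after the two
    sides are exchanged.\<close>
  have half: "(f \<in> edges H1 \<longrightarrow> (\<exists>\<phi>. ptrans X (delete_edge H f) (verts G) \<phi>)) \<and>
      (v \<in> verts G1 - {v1} \<longrightarrow> (\<exists>\<phi>. ptrans X H (verts G - {v}) \<phi>)) \<and>
      (\<exists>\<phi>. ptrans X H (verts G - {w}) \<phi>)"
    if m: "is_merging G1 X1 H1 v1 G2 X2 H2 v2 w G X H"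
      and F: "feasible G1 X1 H1" "feasible G2 X2 H2"
      and c: "critical G1 X1 H1" "critical G2 X2 H2"
    for G1 X1 H1 v1 G2 X2 H2 v2 f v
  proof (intro conjI impI)
    note M = is_merging_props[OF m]
    obtain \<phi>2 where \<phi>2: "ptrans X2 H2 (verts G2 - {v2}) \<phi>2"
      using c(2) M(3) unfolding critical_def by blast
    have S: "identify v1 v2 w ` verts G1 \<union> (verts G2 - {v2}) = verts G"
      using M(1-6) unfolding identify_def by (auto simp: image_iff)
    {
      assume f: "f \<in> edges H1"
      then obtain \<phi>1 where \<phi>1: "ptrans X1 (delete_edge H1 f) (verts G1) \<phi>1"
        using c(1) unfolding critical_def by blast
      show "\<exists>\<phi>. ptrans X (delete_edge H f) (verts G) \<phi>"
        using merging_glue[OF m F order_refl order_refl \<phi>1 \<phi>2, of "delete_edge H f"] M(7)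
        unfolding S by auto
    }
    {
      assume v: "v \<in> verts G1 - {v1}"
      then obtain \<phi>1 where \<phi>1: "ptrans X1 H1 (verts G1 - {v}) \<phi>1"
        using c(1) unfolding critical_def by blast
      have S: "identify v1 v2 w ` (verts G1 - {v}) \<union> (verts G2 - {v2}) = verts G - {v}"
        using M(1-6) v unfolding identify_def by (auto simp: image_iff)
      show "\<exists>\<phi>. ptrans X H (verts G - {v}) \<phi>"
        using merging_glue[OF m F Diff_subset order_refl \<phi>1 \<phi>2, of H] M(7) unfolding S by auto
    }
    obtain \<phi>1 where \<phi>1: "ptrans X1 H1 (verts G1 - {v1}) \<phi>1"
      using c(1) M(2) unfolding critical_def by blast
    have S: "identify v1 v2 w ` (verts G1 - {v1}) \<union> (verts G2 - {v2}) = verts G - {w}"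
      using M(1-6) unfolding identify_def by (auto simp: image_iff)
    show "\<exists>\<phi>. ptrans X H (verts G - {w}) \<phi>"
      using merging_glue[OF m F Diff_subset order_refl \<phi>1 \<phi>2, of H] M(7) unfolding S by auto
  qed
  note h = half[OF m F c] half[OF is_merging_sym[OF m] F(2,1) c(2,1)]
  have "\<not> ptrans X H (verts G) \<phi>" for \<phi>
  proof
    assume \<phi>: "ptrans X H (verts G) \<phi>"
    then have "\<phi> w \<in> X1 v1 \<or> \<phi> w \<in> X2 v2" using M(6,10) unfolding ptrans_def by auto
    then show False
    proof
      assume "\<phi> w \<in> X1 v1"
      from merging_restrict[OF m \<phi> this, of H1] M(7) c(1) show False
        unfolding critical_def by auto
    next
      assume "\<phi> w \<in> X2 v2"
      from merging_restrict[OF is_merging_sym[OF m] \<phi> this, of H2] M(7) c(2) show False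
        unfolding critical_def by auto
    qed
  qed
  then show ?thesis using h M(6,7) unfolding critical_def by (metis Un_iff insert_iff)
qed

section \<open>E-configurations\<close>

text \<open>All lists are singletons, so there is only one candidate colouring; its image is
  \<open>verts H\<close>, which is the single edge of \<open>H\<close>.\<close>

lemma E_configuration_critical:
  assumes "E_configuration G X H"
  shows "critical G X H"
proof -
  have F: "feasible G X H" using assms unfolding E_configuration_def by blast
  note FP = feasible_props[OF F]
  obtain e where e: "edges G = {e}" "verts G = inc G e"
    using assms unfolding E_configuration_def by blast
  have X: "\<forall>v\<in>verts G. card (X v) = 1" and iso: "isomorphic H G"
    using assms unfolding E_configuration_def by blast+
  from iso obtain p q where pq: "bij_betw p (verts H) (verts G)" "bij_betw q (edges H) (edges G)"
    "\<forall>f\<in>edges H. inc G (q f) = p ` inc H f" unfolding isomorphic_def by blast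
  obtain f where f: "edges H = {f}"
    using pq(2) e(1) by (metis bij_betw_same_card card_1_singletonE card.empty card_insert_disjoint empty_iff finite.emptyI One_nat_def)
  then have "q f = e" using pq(2) e(1) by (auto simp: bij_betw_def)
  \<comment> \<open>The isomorphism sends the only edge \<open>f\<close> to \<open>e\<close>, and
    \<open>e\<close> contains all vertices of \<open>G\<close>; injectivity of \<open>p\<close> then
    shows that \<open>f\<close> contains all vertices of \<open>H\<close>.\<close>
  then have "p ` inc H f = p ` verts H" using pq(1,3) f e(2) by (auto simp: bij_betw_def)
  then have incf: "inc H f = verts H"
    using pq(1) wf_hypergraph_inc(1)[OF FP(4), of f] f
    by (metis bij_betw_def inj_on_image_eq_iff insertI1 order_refl)
  have im: "\<phi> ` verts G = verts H" if "\<forall>v\<in>verts G. \<phi> v \<in> X v" for \<phi>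
  proof -
    have "X v = {\<phi> v}" if "v \<in> verts G" for v
      using that X \<open>\<forall>v\<in>verts G. \<phi> v \<in> X v\<close> by (metis card_1_singletonE singletonD)
    then show ?thesis using FP(6) by auto
  qed
  have "\<exists>\<phi>. \<forall>v\<in>verts G. \<phi> v \<in> X v"
  proof (rule bchoice, rule ballI)
    fix v assume "v \<in> verts G"
    then have "X v \<noteq> {}" using X by (metis card.empty zero_neq_one)
    then show "\<exists>x. x \<in> X v" by blast
  qed
  then obtain \<phi> where \<phi>: "\<forall>v\<in>verts G. \<phi> v \<in> X v" by blast
  show ?thesis
  proof (rule criticalI[OF F])
    show "\<nexists>\<phi>. ptrans X H (verts G) \<phi>" using im f incf unfolding ptrans_def by blast
    show "\<exists>\<phi>. ptrans X (delete_edge H g) (verts G) \<phi>" if "g \<in> edges H" for g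
      using that f \<phi> by (intro exI[of _ \<phi>]) (auto simp: ptrans_def)
    show "verts G = {v} \<or> (\<exists>f\<in>edges H. inc H f \<inter> X v \<noteq> {})" if "v \<in> verts G" for v
      using that f incf FP(6) \<phi> by blast
  qed
qed

section \<open>K-configurations\<close>

lemma is_K_multipartite_edgeE:
  assumes "is_K_multipartite n t P K" "f \<in> edges K"
  obtains x y p q where "p \<in> P" "q \<in> P" "p \<noteq> q" "x \<in> p" "y \<in> q" "inc K f = {x, y}"
  using assms unfolding is_K_multipartite_def is_tfold_def by blast

lemma is_K_multipartite_card:
  assumes "is_K_multipartite n t P K" "p \<in> P" "q \<in> P" "p \<noteq> q" "x \<in> p" "y \<in> q"
  shows "card {e \<in> edges K. inc K e = {x, y}} = 1"
  using assms unfolding is_K_multipartite_def is_tfold_def by blast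

lemma is_K_multipartite_parts:
  assumes "is_K_multipartite n t P K"
  shows "card P = n" "p \<in> P \<Longrightarrow> card p = t" "p \<in> P \<Longrightarrow> t \<ge> 1 \<Longrightarrow> p \<noteq> {}"
  using assms unfolding is_K_multipartite_def by auto

lemma card_edges_induced:
  assumes "x \<in> Y" "y \<in> Y"
  shows "{e \<in> edges (induced H Y). inc (induced H Y) e = {x, y}} = {e \<in> edges H. inc H e = {x, y}}"
  using assms by auto

lemma card_1_edge:
  assumes "card {e \<in> edges H. inc H e = a} = 1"
  shows "\<exists>e\<in>edges H. inc H e = a" "f \<in> edges H \<Longrightarrow> inc H f = a \<Longrightarrow> g \<in> edges H \<Longrightarrow> inc H g = a \<Longrightarrow> f = g"
proof -
  obtain e where e: "{e \<in> edges H. inc H e = a} = {e}" using assms by (rule card_1_singletonE)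
  then show "\<exists>e\<in>edges H. inc H e = a" by blast
  show "f = g" if "f \<in> edges H" "inc H f = a" "g \<in> edges H" "inc H g = a"
    using that e by (metis (mono_tags, lifting) mem_Collect_eq singletonD)
qed

text \<open>A colouring picks one of \<open>n - 1\<close> classes at each of \<open>n\<close>
  vertices, so two vertices share a class and their colours are adjacent. Without the edge joining
  two such colours, this one coincidence is allowed and the remaining vertices take pairwise
  different other classes.\<close>

lemma K_configuration_critical:
  assumes "K_configuration G X H"
  shows "critical G X H"
proof -
  have F: "feasible G X H" using assms unfolding K_configuration_def by blast
  note FP = feasible_props[OF F]
  let ?V = "verts G"
  obtain t n P where t: "t \<ge> 1" "n \<ge> 1" "is_tK t n G"
    and P: "\<forall>v\<in>?V. indexed_partition {1..<n} (P v) (X v)"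
    and K: "\<forall>i\<in>{1..<n}. is_K_multipartite n t ((\<lambda>v. P v i) ` ?V) (induced H (\<Union>v\<in>?V. P v i))"
    and U: "is_union H ((\<lambda>i. induced H (\<Union>v\<in>?V. P v i)) ` {1..<n})"
    using assms unfolding K_configuration_def by blast
  have V: "finite ?V" "card ?V = n" using t(3) unfolding is_tK_def is_tfold_def by auto
  have inj: "P u i \<noteq> P v i" if "i \<in> {1..<n}" "u \<in> ?V" "v \<in> ?V" "u \<noteq> v" for i u v
  proof -
    have "card ((\<lambda>v. P v i) ` ?V) = card ?V" using is_K_multipartite_parts(1) K that(1) V(2) by blast
    then have "inj_on (\<lambda>v. P v i) ?V" using V(1) eq_card_imp_inj_on by blast
    then show ?thesis using that by (auto dest: inj_onD)
  qed
  have ne: "P v i \<noteq> {}" if "i \<in> {1..<n}" "v \<in> ?V" for i v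
    using is_K_multipartite_parts(3) K t(1) that by blast
  have edge: "card {e \<in> edges H. inc H e = {x, y}} = 1"
    if "i \<in> {1..<n}" "u \<in> ?V" "v \<in> ?V" "u \<noteq> v" "x \<in> P u i" "y \<in> P v i" for i u v x y
  proof -
    let ?Y = "\<Union>v\<in>?V. P v i"
    have "card {e \<in> edges (induced H ?Y). inc (induced H ?Y) e = {x, y}} = 1"
      by (rule is_K_multipartite_card[OF K[rule_format, OF that(1)] imageI[OF that(2)]
          imageI[OF that(3)] inj[OF that(1-4)] that(5,6)])
    moreover have "x \<in> ?Y" "y \<in> ?Y" using that by blast+
    ultimately show ?thesis by (simp only: card_edges_induced)
  qed
  have edgeE: "\<exists>i\<in>{1..<n}. \<exists>u\<in>?V. \<exists>v\<in>?V. \<exists>x y. u \<noteq> v \<and> x \<in> P u i \<and> y \<in> P v i \<and> inc H f = {x, y}"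
    if "f \<in> edges H" for f
  proof -
    obtain i where i: "i \<in> {1..<n}" "f \<in> edges (induced H (\<Union>v\<in>?V. P v i))"
      using U \<open>f \<in> edges H\<close> unfolding is_union_def by blast
    obtain x y p q where pq: "p \<in> (\<lambda>v. P v i) ` ?V" "q \<in> (\<lambda>v. P v i) ` ?V" "p \<noteq> q" "x \<in> p" "y \<in> q"
      "inc (induced H (\<Union>v\<in>?V. P v i)) f = {x, y}"
      using is_K_multipartite_edgeE K i by (metis (no_types, lifting))
    then obtain u v where uv: "u \<in> ?V" "p = P u i" "v \<in> ?V" "q = P v i" by blast
    then have "u \<noteq> v" using pq(3) by blast
    then show ?thesis using i(1) uv pq(4-6) by (metis induced_simps(3))
  qed
  have sub: "P v i \<subseteq> X v" if "i \<in> {1..<n}" "v \<in> ?V" for i v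
    using P that unfolding indexed_partition_def by blast
  have un: "u = v \<and> i = j" if "x \<in> P u i" "x \<in> P v j" "u \<in> ?V" "v \<in> ?V" "i \<in> {1..<n}" "j \<in> {1..<n}"
    for u v i j x
  proof -
    have "x \<in> X u" "x \<in> X v" using that sub by blast+
    then have "u = v" using FP(5) that unfolding disjoint_family_on_def by blast
    moreover have "i = j"
      using P that \<open>u = v\<close> unfolding indexed_partition_def disjoint_family_on_def by blast
    ultimately show ?thesis by blast
  qed
  show ?thesis
  proof (rule criticalI[OF F])
    show "\<nexists>\<phi>. ptrans X H ?V \<phi>"
    proof
      assume "\<exists>\<phi>. ptrans X H ?V \<phi>"
      then obtain \<phi> where \<phi>: "ptrans X H ?V \<phi>" by blast
      have "\<forall>v\<in>?V. \<exists>i. i \<in> {1..<n} \<and> \<phi> v \<in> P v i"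
        using \<phi> P unfolding ptrans_def indexed_partition_def by blast
      then obtain c where c: "\<forall>v\<in>?V. c v \<in> {1..<n} \<and> \<phi> v \<in> P v (c v)" by metis
      have "c ` ?V \<subseteq> {1..<n}" using c by blast
      then have "card (c ` ?V) \<le> card {1..<n}" by (intro card_mono) auto
      then have "card (c ` ?V) < card ?V" using V t(2) by simp
      then have "\<not> inj_on c ?V" using pigeonhole by blast
      then obtain u v where uv: "u \<in> ?V" "v \<in> ?V" "u \<noteq> v" "c u = c v" unfolding inj_on_def by blast
      then have "card {e \<in> edges H. inc H e = {\<phi> u, \<phi> v}} = 1"
        using edge[of "c u" u v "\<phi> u" "\<phi> v"] c by metis
      from card_1_edge(1)[OF this] show False using \<phi> uv unfolding ptrans_def by blast
    qed
  next
    fix f assume f: "f \<in> edges H"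
    then obtain i u v x y where i: "i \<in> {1..<n}" "u \<in> ?V" "v \<in> ?V" "u \<noteq> v" "x \<in> P u i" "y \<in> P v i"
      "inc H f = {x, y}" using edgeE[OF f] by blast
    \<comment> \<open>Both sides equal \<open>n - 2\<close>: the vertices other than
      \<open>u\<close>, \<open>v\<close> can be matched with the classes other than
      \<open>i\<close>.\<close>
    have "card (?V - {u, v}) = card ({1..<n} - {i})"
      using i V by (simp add: card_Diff_subset)
    then obtain g where g: "bij_betw g (?V - {u, v}) ({1..<n} - {i})"
      using V(1) finite_same_card_bij[of "?V - {u, v}" "{1..<n} - {i}"] by auto
    define c where "c a = (if a = u \<or> a = v then i else g a)" for a
    have c: "c a \<in> {1..<n}" if "a \<in> ?V" for a
      using bij_betwE[OF g] i(1) that unfolding c_def by auto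
    have cuv: "{a, b} = {u, v}" if "a \<in> ?V" "b \<in> ?V" "a \<noteq> b" "c a = c b" for a b
    proof -
      have *: "g a \<noteq> i" if "a \<in> ?V - {u, v}" for a using bij_betwE[OF g] that by auto
      have **: "a = b" if "a \<in> ?V - {u, v}" "b \<in> ?V - {u, v}" "g a = g b"
        using bij_betw_imp_inj_on[OF g] that by (auto dest: inj_onD)
      show ?thesis using that * ** unfolding c_def by (auto split: if_splits)
    qed
    define \<phi> where "\<phi> a = (if a = u then x else if a = v then y else (SOME z. z \<in> P a (c a)))" for a
    have \<phi>: "\<phi> a \<in> P a (c a)" if "a \<in> ?V" for a
    proof -
      have "\<exists>z. z \<in> P a (c a)" using ne[OF c[OF that] that] by blast
      then have "(SOME z. z \<in> P a (c a)) \<in> P a (c a)" by (rule someI_ex)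
      moreover have "c u = i" "c v = i" unfolding c_def by simp_all
      ultimately show ?thesis using i unfolding \<phi>_def by simp
    qed
    have "\<not> inc H f' \<subseteq> \<phi> ` ?V" if f': "f' \<in> edges H" "f' \<noteq> f" for f'
    proof
      assume s: "inc H f' \<subseteq> \<phi> ` ?V"
      obtain j a b x' y' where j: "j \<in> {1..<n}" "a \<in> ?V" "b \<in> ?V" "a \<noteq> b" "x' \<in> P a j" "y' \<in> P b j"
        "inc H f' = {x', y'}" using edgeE[OF f'(1)] by blast
      have *: "x' = \<phi> a \<and> j = c a" if "x' \<in> P a j" "x' \<in> \<phi> ` ?V" "a \<in> ?V" for x' a
      proof -
        obtain d where d: "d \<in> ?V" "x' = \<phi> d" using \<open>x' \<in> \<phi> ` ?V\<close> by blast
        then show ?thesis using un[of x' a j d "c d"] that \<phi>[OF d(1)] c[OF d(1)] j(1) by simp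
      qed
      \<comment> \<open>Only \<open>u\<close> and \<open>v\<close> share a class, so an edge inside
        the colouring joins \<open>x\<close> and \<open>y\<close> and is parallel to
        \<open>f\<close>; but each such pair carries exactly one edge.\<close>
      have "x' = \<phi> a" "y' = \<phi> b" "c a = c b" using *[of x' a] *[of y' b] j s by auto
      then have "inc H f' = inc H f" using cuv[OF j(2-4)] j(7) i(4,7) unfolding \<phi>_def by (auto simp: doubleton_eq_iff)
      then show False using card_1_edge(2)[OF edge[OF i(1-6)]] f f' i(7) by metis
    qed
    moreover have "\<phi> a \<in> X a" if "a \<in> ?V" for a using \<phi>[OF that] sub[OF c[OF that] that] by blast
    ultimately have "ptrans X (delete_edge H f) ?V \<phi>" unfolding ptrans_def by auto
    then show "\<exists>\<phi>. ptrans X (delete_edge H f) ?V \<phi>" by blast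
  next
    fix v assume v: "v \<in> ?V"
    \<comment> \<open>For \<open>n = 1\<close> there is no class at all and the list of the only
      vertex is empty; this is the exceptional first alternative.\<close>
    show "?V = {v} \<or> (\<exists>f\<in>edges H. inc H f \<inter> X v \<noteq> {})"
    proof (cases "?V = {v}")
      case False
      then obtain u where u: "u \<in> ?V" "u \<noteq> v" using v by blast
      have "card {u, v} \<le> n" using u v V by (metis card_mono empty_subsetI insert_subset)
      then have 1: "1 \<in> {1..<n}" using u by simp
      then obtain x y where "x \<in> P v 1" "y \<in> P u 1" using ne u v by (meson all_not_in_conv)
      then have "\<exists>f\<in>edges H. inc H f = {x, y}" "x \<in> X v"
        using card_1_edge(1)[OF edge[OF 1 v u(1) u(2)[symmetric]]] sub[OF 1 v] by blast+
      then show ?thesis by blast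
    qed simp
  qed
qed

section \<open>C-configurations\<close>

text \<open>The classes \<open>X\<^sub>v\<^sup>1\<close>, \<open>X\<^sub>v\<^sup>2\<close> of a C-configuration are indexed by the signs \<open>1\<close>, \<open>-1\<close>;
  \<open>\<tau> k = -1\<close> marks the edges of the cycle at which the classes are swapped.\<close>

lemma signed_cycle_critical:
  fixes Q :: "'v \<Rightarrow> int \<Rightarrow> 'x set" and \<tau> :: "nat \<Rightarrow> int"
  assumes F: "feasible G X H" and vs: "distinct vs" "set vs = verts G" "length vs = n" "n \<ge> 2"
    and Q: "\<And>v. v \<in> verts G \<Longrightarrow> X v = Q v 1 \<union> Q v (-1)"
      "\<And>v. v \<in> verts G \<Longrightarrow> Q v 1 \<inter> Q v (-1) = {}"
      "\<And>v s. v \<in> verts G \<Longrightarrow> s \<in> {1, -1} \<Longrightarrow> Q v s \<noteq> {}"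
    and \<tau>: "\<And>k. k < n \<Longrightarrow> \<tau> k \<in> {1, -1}"
    and edgeE: "\<And>f. f \<in> edges H \<Longrightarrow> \<exists>k<n. \<exists>s\<in>{1, -1}. \<exists>x\<in>Q (vs ! k) s.
      \<exists>y\<in>Q (vs ! (Suc k mod n)) (\<tau> k * s). inc H f = {x, y}"
    and edge: "\<And>k s x y. k < n \<Longrightarrow> s \<in> {1, -1} \<Longrightarrow> x \<in> Q (vs ! k) s \<Longrightarrow>
      y \<in> Q (vs ! (Suc k mod n)) (\<tau> k * s) \<Longrightarrow> card {f \<in> edges H. inc H f = {x, y}} = 1"
    and prod: "(\<Prod>k<n. - \<tau> k) = -1"
  shows "critical G X H"
proof -
  note FP = feasible_props[OF F]
  let ?V = "verts G"
  have nthV: "vs ! k \<in> ?V" if "k < n" for k using vs(2,3) that nth_mem by blast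
  have next_V: "vs ! (Suc k mod n) \<in> ?V" "Suc k mod n < n" if "k < n" for k
    using nthV[of "Suc k mod n"] vs(4) by simp_all
  have \<tau>s: "\<tau> k * s \<in> {1, -1}" if "k < n" "s \<in> {1, -1}" for k s using \<tau>[OF that(1)] that(2) by auto
  have sub: "Q v s \<subseteq> X v" if "s \<in> {1, -1}" "v \<in> ?V" for s v
    using Q(1)[OF that(2)] that(1) by auto
  have un: "u = v \<and> s = s'" if "x \<in> Q u s" "x \<in> Q v s'" "u \<in> ?V" "v \<in> ?V" "s \<in> {1, -1}" "s' \<in> {1, -1}"
    for u v s s' x
  proof -
    have "x \<in> X u" "x \<in> X v" using that sub by blast+
    then have "u = v" using FP(5) that unfolding disjoint_family_on_def by blast
    moreover have "s = s'" using Q(2)[of u] that \<open>u = v\<close> by auto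
    ultimately show ?thesis by blast
  qed
  show ?thesis
  proof (rule criticalI[OF F])
    show "\<nexists>\<phi>. ptrans X H ?V \<phi>"
    proof
      assume "\<exists>\<phi>. ptrans X H ?V \<phi>"
      then obtain \<phi> where \<phi>: "ptrans X H ?V \<phi>" by blast
      define s :: "nat \<Rightarrow> int" where "s k = (if \<phi> (vs ! k) \<in> Q (vs ! k) 1 then 1 else -1)" for k
      have s: "s k \<in> {1, -1}" "\<phi> (vs ! k) \<in> Q (vs ! k) (s k)" if "k < n" for k
        using \<phi> Q(1)[OF nthV[OF that]] nthV[OF that] unfolding ptrans_def s_def by auto
      \<comment> \<open>Consecutive signs related by \<open>\<tau> k\<close> would pick adjacent
        colours, so a colouring forces the opposite sign at every edge of the cycle.\<close>
      have step: "s (Suc k mod n) = - \<tau> k * s k" if k: "k < n" for k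
      proof (rule ccontr)
        assume "s (Suc k mod n) \<noteq> - \<tau> k * s k"
        then have "s (Suc k mod n) = \<tau> k * s k"
          using s(1)[OF k] s(1)[OF next_V(2)[OF k]] \<tau>[OF k] by auto
        then have "card {f \<in> edges H. inc H f = {\<phi> (vs ! k), \<phi> (vs ! (Suc k mod n))}} = 1"
          using edge[OF k s(1)[OF k] s(2)[OF k]] s(2)[OF next_V(2)[OF k]] by simp
        from card_1_edge(1)[OF this] show False
          using \<phi> nthV[OF k] next_V(1)[OF k] unfolding ptrans_def by blast
      qed
      \<comment> \<open>Going round the cycle gives the factor \<open>\<tau> 0\<close> at the edge
        0, whereas \<open>step\<close> demands \<open>- \<tau> 0\<close>.\<close>
      have "s (Suc 0 mod n) = (\<Prod>k<n. - \<tau> k) * (- \<tau> 0) * s 0"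
        using signed_cycle_closing[of 0 n s \<tau>] s(1) \<tau> step vs(4) by simp
      then show False using step[of 0] prod vs(4) s(1)[of 0] \<tau>[of 0] by auto
    qed
  next
    fix f assume f: "f \<in> edges H"
    then obtain j \<sigma> x y where j: "j < n" "\<sigma> \<in> {1, -1}" "x \<in> Q (vs ! j) \<sigma>"
      "y \<in> Q (vs ! (Suc j mod n)) (\<tau> j * \<sigma>)" "inc H f = {x, y}" using edgeE[OF f] by blast
    from signed_cycle_exists[OF j(1) \<tau> \<tau>s[OF j(1,2)]]
    obtain s where s: "(\<forall>k<n. s k \<in> {1, -1}) \<and>
      (\<forall>k<n. k \<noteq> j \<longrightarrow> s (Suc k mod n) = - \<tau> k * s k) \<and> s (Suc j mod n) = \<tau> j * \<sigma>" ..
    then have s: "\<And>k. k < n \<Longrightarrow> s k \<in> {1, -1}"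
      "\<And>k. k < n \<Longrightarrow> k \<noteq> j \<Longrightarrow> s (Suc k mod n) = - \<tau> k * s k" "s (Suc j mod n) = \<tau> j * \<sigma>"
      by simp_all
    \<comment> \<open>With total product -1 the exempted edge comes out with the factor
      \<open>\<tau> j\<close>: the classes chosen at its ends are exactly those containing the ends
      of the deleted edge.\<close>
    have "s (Suc j mod n) = \<tau> j * s j"
      using signed_cycle_closing[of j n s \<tau>] j(1) s(1,2) \<tau> prod by simp
    then have sj: "s j = \<sigma>" using s(3) \<tau>[OF j(1)] by auto
    have jj: "Suc j mod n \<noteq> j" using j(1) vs(4) by (cases "Suc j = n") auto
    \<comment> \<open>The chosen colours are arbitrary in their classes except at the ends of the
      edge \<open>j\<close>, where they must be the ends of \<open>f\<close>.\<close>
    define c where "c k = (if k = j then x else if k = Suc j mod n then y else (SOME z. z \<in> Q (vs ! k) (s k)))" for k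
    have c: "c k \<in> Q (vs ! k) (s k)" if "k < n" for k
    proof -
      have "\<exists>z. z \<in> Q (vs ! k) (s k)" using Q(3)[OF nthV[OF that] s(1)[OF that]] by blast
      then have "(SOME z. z \<in> Q (vs ! k) (s k)) \<in> Q (vs ! k) (s k)" by (rule someI_ex)
      then show ?thesis using j s(3) sj unfolding c_def by auto
    qed
    define ix where "ix v = (THE k. k < n \<and> vs ! k = v)" for v
    have ix: "ix (vs ! k) = k" if "k < n" for k
      unfolding ix_def using that vs nth_eq_iff_index_eq by blast
    have im: "(c \<circ> ix) ` ?V = c ` {..<n}"
    proof -
      have "?V = (\<lambda>k. vs ! k) ` {..<n}" using vs by (auto simp: set_conv_nth)
      then show ?thesis using ix by (auto simp: image_image intro!: image_cong)
    qed
    have "\<not> inc H f' \<subseteq> c ` {..<n}" if f': "f' \<in> edges H" "f' \<noteq> f" for f'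
    proof
      assume sb: "inc H f' \<subseteq> c ` {..<n}"
      obtain k s' x' y' where k: "k < n" "s' \<in> {1, -1}" "x' \<in> Q (vs ! k) s'"
        "y' \<in> Q (vs ! (Suc k mod n)) (\<tau> k * s')" "inc H f' = {x', y'}" using edgeE[OF f'(1)] by blast
      have *: "z = c l \<and> s l = r" if "z \<in> Q (vs ! l) r" "r \<in> {1, -1}" "l < n" "z \<in> c ` {..<n}" for z l r
      proof -
        obtain m where m: "m < n" "z = c m" using \<open>z \<in> c ` {..<n}\<close> by blast
        then have "vs ! l = vs ! m \<and> r = s m"
          using un[of z "vs ! l" r "vs ! m" "s m"] that c[OF m(1)] nthV s(1)[OF m(1)] by simp
        then have "l = m" using vs m(1) that(3) nth_eq_iff_index_eq by blast
        then show ?thesis using m \<open>vs ! l = vs ! m \<and> r = s m\<close> by simp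
      qed
      have x': "x' = c k" "s k = s'" using *[of x' k s'] k sb by auto
      have y': "y' = c (Suc k mod n)" "s (Suc k mod n) = \<tau> k * s'"
        using *[of y' "Suc k mod n" "\<tau> k * s'"] k sb \<tau>s[OF k(1,2)] next_V(2)[OF k(1)] by auto
      have "k = j"
      proof (rule ccontr)
        assume "k \<noteq> j"
        then show False using s(2)[OF k(1)] x' y' k(2) \<tau>[OF k(1)] by auto
      qed
      then have "inc H f' = inc H f" using x' y' k(5) j(5) jj unfolding c_def by simp
      then show False using card_1_edge(2)[OF edge[OF j(1-4)]] f f' j(5) by metis
    qed
    moreover have "(c \<circ> ix) v \<in> X v" if "v \<in> ?V" for v
    proof -
      obtain k where k: "k < n" "v = vs ! k" using \<open>v \<in> ?V\<close> vs by (metis in_set_conv_nth)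
      then show ?thesis using c[OF k(1)] sub[OF s(1)[OF k(1)] nthV[OF k(1)]] ix by auto
    qed
    ultimately have "ptrans X (delete_edge H f) ?V (c \<circ> ix)" unfolding ptrans_def im by simp
    then show "\<exists>\<phi>. ptrans X (delete_edge H f) ?V \<phi>" by blast
  next
    fix v assume v: "v \<in> ?V"
    then obtain k where k: "k < n" "v = vs ! k" using vs by (metis in_set_conv_nth)
    have 1: "(1::int) \<in> {1, -1}" by simp
    obtain x y where xy: "x \<in> Q (vs ! k) 1" "y \<in> Q (vs ! (Suc k mod n)) (\<tau> k * 1)"
      using Q(3)[OF nthV[OF k(1)] 1] Q(3)[OF next_V(1)[OF k(1)] \<tau>s[OF k(1) 1]] by blast
    have "\<exists>f\<in>edges H. inc H f = {x, y}" using card_1_edge(1)[OF edge[OF k(1) 1 xy]] .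
    moreover have "x \<in> X v" using xy(1) sub[OF 1 nthV[OF k(1)]] k(2) by blast
    ultimately show "?V = {v} \<or> (\<exists>f\<in>edges H. inc H f \<inter> X v \<noteq> {})" by blast
  qed
qed


lemma bipartite_props:
  assumes "is_K_multipartite 2 t {A, B} (induced H (A \<union> B))"
  shows "A \<noteq> B" "t \<ge> 1 \<Longrightarrow> A \<noteq> {}" "t \<ge> 1 \<Longrightarrow> B \<noteq> {}"
    "x \<in> A \<Longrightarrow> y \<in> B \<Longrightarrow> card {e \<in> edges H. inc H e = {x, y}} = 1"
    "f \<in> edges (induced H (A \<union> B)) \<Longrightarrow> \<exists>x\<in>A. \<exists>y\<in>B. inc H f = {x, y}"
proof -
  show AB: "A \<noteq> B" using is_K_multipartite_parts(1)[OF assms] by auto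
  show "t \<ge> 1 \<Longrightarrow> A \<noteq> {}" "t \<ge> 1 \<Longrightarrow> B \<noteq> {}"
    using is_K_multipartite_parts(3)[OF assms] by auto
  show "card {e \<in> edges H. inc H e = {x, y}} = 1" if "x \<in> A" "y \<in> B"
  proof -
    have "card {e \<in> edges (induced H (A \<union> B)). inc (induced H (A \<union> B)) e = {x, y}} = 1"
      by (rule is_K_multipartite_card[OF assms, of A B]) (use AB that in auto)
    moreover have "x \<in> A \<union> B" "y \<in> A \<union> B" using that by auto
    ultimately show ?thesis by (simp only: card_edges_induced)
  qed
  show "\<exists>x\<in>A. \<exists>y\<in>B. inc H f = {x, y}" if f: "f \<in> edges (induced H (A \<union> B))"
  proof -
    obtain x y p q where pq: "p \<in> {A, B}" "q \<in> {A, B}" "p \<noteq> q" "x \<in> p" "y \<in> q"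
      "inc (induced H (A \<union> B)) f = {x, y}"
      using is_K_multipartite_edgeE[OF assms f] by metis
    then consider "x \<in> A" "y \<in> B" | "y \<in> A" "x \<in> B" by auto
    then show ?thesis using pq(6) by cases (auto simp: insert_commute)
  qed
qed

lemma cycle_bipartite_critical:
  fixes Q :: "'v \<Rightarrow> int \<Rightarrow> 'x set" and \<tau> :: "nat \<Rightarrow> int"
  assumes F: "feasible G X H" and vs: "distinct vs" "set vs = verts G" "length vs = n" "n \<ge> 2"
    and Q: "\<And>v. v \<in> verts G \<Longrightarrow> X v = Q v 1 \<union> Q v (-1)"
      "\<And>v. v \<in> verts G \<Longrightarrow> Q v 1 \<inter> Q v (-1) = {}"
    and \<tau>: "\<And>k. k < n \<Longrightarrow> \<tau> k \<in> {1, -1}" and t: "t \<ge> 1"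
    and bip: "\<And>k s. k < n \<Longrightarrow> s \<in> {1, -1} \<Longrightarrow> is_K_multipartite 2 t
      {Q (vs ! k) s, Q (vs ! (Suc k mod n)) (\<tau> k * s)}
      (induced H (Q (vs ! k) s \<union> Q (vs ! (Suc k mod n)) (\<tau> k * s)))"
    and cov: "\<And>f. f \<in> edges H \<Longrightarrow> \<exists>k<n. \<exists>s\<in>{1, -1}.
      f \<in> edges (induced H (Q (vs ! k) s \<union> Q (vs ! (Suc k mod n)) (\<tau> k * s)))"
    and prod: "(\<Prod>k<n. - \<tau> k) = -1"
  shows "critical G X H"
proof (rule signed_cycle_critical[OF F vs Q _ \<tau> _ _ prod])
  show "Q v s \<noteq> {}" if v: "v \<in> verts G" and s: "s \<in> {1, -1}" for v s
  proof -
    obtain k where "k < n" "v = vs ! k" using v vs by (metis in_set_conv_nth)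
    then show ?thesis using bipartite_props(2)[OF bip[of k s]] s t by blast
  qed
  show "\<exists>k<n. \<exists>s\<in>{1, -1}. \<exists>x\<in>Q (vs ! k) s. \<exists>y\<in>Q (vs ! (Suc k mod n)) (\<tau> k * s). inc H f = {x, y}"
    if f: "f \<in> edges H" for f
  proof -
    from cov[OF f] obtain k s where k: "k < n" "s \<in> {1, -1}"
      "f \<in> edges (induced H (Q (vs ! k) s \<union> Q (vs ! (Suc k mod n)) (\<tau> k * s)))" by blast
    show ?thesis using bipartite_props(5)[OF bip[OF k(1,2)] k(3)] k(1,2) by blast
  qed
  show "card {f \<in> edges H. inc H f = {x, y}} = 1" if "k < n" "s \<in> {1, -1}" "x \<in> Q (vs ! k) s"
    "y \<in> Q (vs ! (Suc k mod n)) (\<tau> k * s)" for k s x y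
    using bipartite_props(4)[OF bip[OF that(1,2)] that(3,4)] .
qed

lemma adj_pairs_tfold:
  assumes "is_tfold t (set vs) {{vs ! i, vs ! ((i + 1) mod n)} | i. i < n} G"
    "t \<ge> 1" "distinct vs" "length vs = n" "n \<ge> 2"
  shows "adj_pairs G = {{vs ! i, vs ! (Suc i mod n)} | i. i < n}" (is "_ = ?A")
proof
  have A: "is_tfold t (set vs) ?A G" using assms(1) by simp
  show "adj_pairs G \<subseteq> ?A"
  proof
    fix a assume "a \<in> adj_pairs G"
    then obtain u v where a: "a = {u, v}" "mult G u v \<ge> 1" unfolding adj_pairs_def by blast
    have "{e \<in> edges G. inc G e = {u, v}} \<noteq> {}"
    proof
      assume "{e \<in> edges G. inc G e = {u, v}} = {}"
      then have "mult G u v = 0" by (simp only: mult_def card.empty)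
      then show False using a(2) by simp
    qed
    then obtain e where "e \<in> edges G" "inc G e = a" using a(1) by blast
    then show "a \<in> ?A" using A unfolding is_tfold_def by blast
  qed
  show "?A \<subseteq> adj_pairs G"
  proof
    fix a assume a: "a \<in> ?A"
    then obtain i where i: "i < n" "a = {vs ! i, vs ! (Suc i mod n)}" by blast
    have "Suc i mod n < n" using assms(5) by simp
    moreover have "Suc i mod n \<noteq> i" using i(1) assms(5) by (cases "Suc i = n") auto
    moreover from calculation have "vs ! i \<noteq> vs ! (Suc i mod n)"
      using assms(3,4) i(1) by (metis nth_eq_iff_index_eq)
    moreover have "mult G (vs ! i) (vs ! (Suc i mod n)) \<ge> 1"
      using A a assms(2) i(2) unfolding is_tfold_def mult_def by auto
    moreover have "verts G = set vs" using A unfolding is_tfold_def by blast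
    moreover from calculation have "vs ! i \<in> verts G" "vs ! (Suc i mod n) \<in> verts G"
      using i(1) assms(4) by simp_all
    ultimately show "a \<in> adj_pairs G"
      unfolding adj_pairs_def i(2) mem_Collect_eq
      by (intro exI[of _ "vs ! i"] exI[of _ "vs ! (Suc i mod n)"] conjI refl)
  qed
qed

text \<open>No classes are swapped, so every factor \<open>- \<tau> k\<close> is -1 and oddness of
  \<open>n\<close> makes the product -1. The signs 1 and -1 stand for the class indices 1 and
  2.\<close>

lemma odd_C_configuration_critical:
  assumes "odd_C_configuration G X H"
  shows "critical G X H"
proof -
  have F: "feasible G X H" using assms unfolding odd_C_configuration_def by blast
  obtain t n P where t: "t \<ge> 1" "n \<ge> 5" "odd n" "is_tC t n G"
    and P: "\<forall>v\<in>verts G. indexed_partition {1, 2} (P v) (X v)"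
    and K: "\<forall>i\<in>{1, 2}. \<forall>u v. {u, v} \<in> adj_pairs G \<longrightarrow>
        is_K_multipartite 2 t {P u i, P v i} (induced H (P u i \<union> P v i))"
    and U: "is_union H {induced H (P u i \<union> P v i) | u v i. i \<in> {1, 2 :: nat} \<and> {u, v} \<in> adj_pairs G}"
    using assms unfolding odd_C_configuration_def by blast
  obtain vs where vs: "distinct vs" "length vs = n"
    "is_tfold t (set vs) {{vs ! i, vs ! ((i + 1) mod n)} | i. i < n} G"
    using t(4) unfolding is_tC_def by blast
  have n: "n \<ge> 2" using t(2) by simp
  have V: "set vs = verts G" using vs(3) unfolding is_tfold_def by blast
  note adj = adj_pairs_tfold[OF vs(3) t(1) vs(1,2) n]
  define Q where "Q v s = P v (if s = 1 then 1 else 2 :: nat)" for v and s :: int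
  show ?thesis
  proof (rule cycle_bipartite_critical[OF F vs(1) V vs(2) n, of Q "\<lambda>_. 1" t])
    show "X v = Q v 1 \<union> Q v (-1)" "Q v 1 \<inter> Q v (-1) = {}" if "v \<in> verts G" for v
      using P that unfolding Q_def indexed_partition_def disjoint_family_on_def by auto
    show "is_K_multipartite 2 t {Q (vs ! k) s, Q (vs ! (Suc k mod n)) (1 * s)}
      (induced H (Q (vs ! k) s \<union> Q (vs ! (Suc k mod n)) (1 * s)))" if "k < n" for k s
    proof -
      have "{vs ! k, vs ! (Suc k mod n)} \<in> adj_pairs G" unfolding adj using that by blast
      then show ?thesis using K unfolding Q_def by simp
    qed
    show "\<exists>k<n. \<exists>s\<in>{1, -1}. f \<in> edges (induced H (Q (vs ! k) s \<union> Q (vs ! (Suc k mod n)) (1 * s)))"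
      if f: "f \<in> edges H" for f
    proof -
      obtain u v i where u: "i \<in> {1, 2 :: nat}" "{u, v} \<in> adj_pairs G" "f \<in> edges (induced H (P u i \<union> P v i))"
        using U f unfolding is_union_def by blast
      obtain k where k: "k < n" "{u, v} = {vs ! k, vs ! (Suc k mod n)}" using u(2) unfolding adj by blast
      have "P u i \<union> P v i = P (vs ! k) i \<union> P (vs ! (Suc k mod n)) i"
        using k(2) by (auto simp: doubleton_eq_iff)
      then have "f \<in> edges (induced H (Q (vs ! k) (if i = 1 then 1 else -1) \<union>
          Q (vs ! (Suc k mod n)) (1 * (if i = 1 then 1 else -1))))"
        using u(1,3) unfolding Q_def by auto
      moreover have "(if i = 1 then 1 else -1) \<in> {1, -1 :: int}" by simp
      ultimately show ?thesis using k(1) by blast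
    qed
    show "(\<Prod>k<n. - (1 :: int)) = - 1" using t(3) by simp
  qed (use t in auto)
qed

text \<open>The swapped pair contributes a factor 1 and each of the other \<open>n - 1\<close> edges
  a factor -1; since \<open>n\<close> is even, the product is again -1.\<close>

lemma even_C_configuration_critical:
  assumes "even_C_configuration G X H"
  shows "critical G X H"
proof -
  have F: "feasible G X H" using assms unfolding even_C_configuration_def by blast
  obtain t n P w w' where t: "t \<ge> 1" "n \<ge> 4" "even n" "is_tC t n G"
    and P: "\<forall>v\<in>verts G. indexed_partition {1, 2} (P v) (X v)"
    and ww: "{w, w'} \<in> adj_pairs G"
    and K: "\<forall>i\<in>{1, 2}. \<forall>u v. {u, v} \<in> adj_pairs G - {{w, w'}} \<longrightarrow>
        is_K_multipartite 2 t {P u i, P v i} (induced H (P u i \<union> P v i))"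
    and K1: "is_K_multipartite 2 t {P w 1, P w' 2} (induced H (P w 1 \<union> P w' 2))"
    and K2: "is_K_multipartite 2 t {P w 2, P w' 1} (induced H (P w 2 \<union> P w' 1))"
    and U: "is_union H ({induced H (P u i \<union> P v i) | u v i.
        i \<in> {1, 2 :: nat} \<and> {u, v} \<in> adj_pairs G - {{w, w'}}} \<union>
        {induced H (P w 1 \<union> P w' 2), induced H (P w 2 \<union> P w' 1)})"
    using assms unfolding even_C_configuration_def by blast
  obtain vs where vs: "distinct vs" "length vs = n"
    "is_tfold t (set vs) {{vs ! i, vs ! ((i + 1) mod n)} | i. i < n} G"
    using t(4) unfolding is_tC_def by blast
  have n: "n \<ge> 2" using t(2) by simp
  have V: "set vs = verts G" using vs(3) unfolding is_tfold_def by blast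
  note adj = adj_pairs_tfold[OF vs(3) t(1) vs(1,2) n]
  obtain j where j: "j < n" "{w, w'} = {vs ! j, vs ! (Suc j mod n)}" using ww unfolding adj by blast
  \<comment> \<open>Two different positions on a cycle give the same vertex pair only if the cycle
    has length 2.\<close>
  have pair: "{vs ! k, vs ! (Suc k mod n)} \<noteq> {w, w'}" if k: "k < n" "k \<noteq> j" for k
  proof
    assume "{vs ! k, vs ! (Suc k mod n)} = {w, w'}"
    then have "vs ! k = vs ! (Suc j mod n) \<and> vs ! (Suc k mod n) = vs ! j"
      using j k nth_eq_iff_index_eq[OF vs(1)] vs(2) by (auto simp: doubleton_eq_iff)
    moreover have "Suc j mod n < n" "Suc k mod n < n" using n by simp_all
    ultimately have "k = Suc j mod n" "Suc k mod n = j"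
      using j(1) k(1) nth_eq_iff_index_eq[OF vs(1), of k "Suc j mod n"]
        nth_eq_iff_index_eq[OF vs(1), of "Suc k mod n" j] vs(2) by blast+
    then show False using t(2) j(1) k(1) by (cases "Suc j = n"; cases "Suc k = n") auto
  qed
  define Q where "Q v s = P v (if s = 1 then 1 else 2 :: nat)" for v and s :: int
  define \<tau> where "\<tau> k = (if k = j then -1 else 1 :: int)" for k
  \<comment> \<open>The pair is unordered, so either of \<open>w\<close>, \<open>w'\<close> may come
    first on the cycle; the two swapped bipartite graphs are the same in both cases.\<close>
  have wj: "w = vs ! j \<and> w' = vs ! (Suc j mod n) \<or> w' = vs ! j \<and> w = vs ! (Suc j mod n)"
    using j(2) by (auto simp: doubleton_eq_iff)
  show ?thesis
  proof (rule cycle_bipartite_critical[OF F vs(1) V vs(2) n, of Q \<tau> t])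
    show "X v = Q v 1 \<union> Q v (-1)" "Q v 1 \<inter> Q v (-1) = {}" if "v \<in> verts G" for v
      using P that unfolding Q_def indexed_partition_def disjoint_family_on_def by auto
    show "is_K_multipartite 2 t {Q (vs ! k) s, Q (vs ! (Suc k mod n)) (\<tau> k * s)}
      (induced H (Q (vs ! k) s \<union> Q (vs ! (Suc k mod n)) (\<tau> k * s)))" if "k < n" "s \<in> {1, -1}" for k s
    proof (cases "k = j")
      case False
      then have "{vs ! k, vs ! (Suc k mod n)} \<in> adj_pairs G - {{w, w'}}"
        unfolding adj using that pair by blast
      then show ?thesis using K False unfolding Q_def \<tau>_def by simp
    next
      case True
      from that(2) consider "s = 1" | "s = -1" by blast
      then show ?thesis
        using wj K1 K2 unfolding True Q_def \<tau>_def by cases (auto simp: insert_commute Un_commute)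
    qed
    show "\<exists>k<n. \<exists>s\<in>{1, -1}. f \<in> edges (induced H (Q (vs ! k) s \<union> Q (vs ! (Suc k mod n)) (\<tau> k * s)))"
      if f: "f \<in> edges H" for f
    proof -
      consider u v i where "i \<in> {1, 2 :: nat}" "{u, v} \<in> adj_pairs G - {{w, w'}}"
          "f \<in> edges (induced H (P u i \<union> P v i))"
        | "f \<in> edges (induced H (P w 1 \<union> P w' 2))" | "f \<in> edges (induced H (P w 2 \<union> P w' 1))"
        using U f unfolding is_union_def by blast
      then show ?thesis
      proof cases
        case 1
        then obtain k where k: "k < n" "{u, v} = {vs ! k, vs ! (Suc k mod n)}" unfolding adj by blast
        then have "k \<noteq> j" using 1(2) j(2) by auto
        have "P u i \<union> P v i = P (vs ! k) i \<union> P (vs ! (Suc k mod n)) i"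
          using k(2) by (auto simp: doubleton_eq_iff)
        then have "f \<in> edges (induced H (Q (vs ! k) (if i = 1 then 1 else -1) \<union>
            Q (vs ! (Suc k mod n)) (\<tau> k * (if i = 1 then 1 else -1))))"
          using 1(1,3) \<open>k \<noteq> j\<close> unfolding Q_def \<tau>_def by auto
        moreover have "(if i = 1 then 1 else -1) \<in> {1, -1 :: int}" by simp
        ultimately show ?thesis using k(1) by blast
      next
        case 2
        then have "f \<in> edges (induced H (Q (vs ! j) (if w = vs ! j then 1 else -1) \<union>
            Q (vs ! (Suc j mod n)) (\<tau> j * (if w = vs ! j then 1 else -1))))"
          using wj unfolding Q_def \<tau>_def by (auto simp: Un_commute)
        moreover have "(if w = vs ! j then 1 else -1) \<in> {1, -1 :: int}" by simp
        ultimately show ?thesis using j(1) by blast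
      next
        case 3
        then have "f \<in> edges (induced H (Q (vs ! j) (if w = vs ! j then -1 else 1) \<union>
            Q (vs ! (Suc j mod n)) (\<tau> j * (if w = vs ! j then -1 else 1))))"
          using wj unfolding Q_def \<tau>_def by (auto simp: Un_commute)
        moreover have "(if w = vs ! j then -1 else 1) \<in> {1, -1 :: int}" by simp
        ultimately show ?thesis using j(1) by blast
      qed
    qed
    have "(\<Prod>k<n. - \<tau> k) = - \<tau> j * (\<Prod>k\<in>{..<n} - {j}. - \<tau> k)"
      using j(1) by (subst prod.remove[of _ j]) auto
    also have "(\<Prod>k\<in>{..<n} - {j}. - \<tau> k) = (\<Prod>k\<in>{..<n} - {j}. - 1)"
      by (rule prod.cong) (auto simp: \<tau>_def)
    also have "\<dots> = -1" using j(1) t(3) by simp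
    finally show "(\<Prod>k<n. - \<tau> k) = - 1" by (simp add: \<tau>_def)
  qed (use t in \<open>auto simp: \<tau>_def\<close>)
qed

section \<open>Constructible configurations are critical\<close>

lemma constructible_feasible: "constructible G X H \<Longrightarrow> feasible G X H"
  by (induction rule: constructible.induct)
    (auto simp: K_configuration_def C_configuration_def odd_C_configuration_def
      even_C_configuration_def E_configuration_def)

lemma constructible_critical: "constructible G X H \<Longrightarrow> critical G X H"
proof (induction rule: constructible.induct)
  case (K G X H)
  then show ?case by (rule K_configuration_critical)
next
  case (C G X H)
  then show ?case
    unfolding C_configuration_def
    using odd_C_configuration_critical even_C_configuration_critical by blast
next
  case (E G X H)
  then show ?case by (rule E_configuration_critical)
next
  case (merge G1 X1 H1 G2 X2 H2 v1 v2 w G X H)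
  then show ?case
    using merging_critical[OF merge.hyps(3) constructible_feasible[OF merge.hyps(1)]
        constructible_feasible[OF merge.hyps(2)] merge.IH] by blast
qed

section \<open>Degree-feasible uncolorable configurations\<close>

text \<open>The matchings hidden in the existential quantifier of \<open>cover\<close> are fixed
  once and for all, so that every blocked colour can be charged to an edge of
  \<open>G\<close>.\<close>

locale cover_matching =
  fixes G :: "('v, 'e) hypergraph" and X :: "'v \<Rightarrow> 'x set" and H :: "('x, 'f) hypergraph"
    and M :: "'e \<Rightarrow> 'f set"
  assumes wfG: "wf_hypergraph G" and wfH: "wf_hypergraph H"
    and disj: "disjoint_family_on X (verts G)"
    and vertsH: "verts H = (\<Union>v\<in>verts G. X v)"
    and edgesH: "edges H = (\<Union>e\<in>edges G. M e)"
    and M_sub: "\<And>e f. e \<in> edges G \<Longrightarrow> f \<in> M e \<Longrightarrow> inc H f \<subseteq> (\<Union>v\<in>inc G e. X v)"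
    and M_card: "\<And>e f v. e \<in> edges G \<Longrightarrow> f \<in> M e \<Longrightarrow> v \<in> inc G e \<Longrightarrow> card (inc H f \<inter> X v) = 1"
    and M_disj: "\<And>e f f'. e \<in> edges G \<Longrightarrow> f \<in> M e \<Longrightarrow> f' \<in> M e \<Longrightarrow> f \<noteq> f' \<Longrightarrow> inc H f \<inter> inc H f' = {}"

lemma cover_matching_exists:
  assumes "wf_hypergraph G" "cover G X H"
  obtains M where "cover_matching G X H M"
proof -
  obtain M where M: "\<forall>e\<in>edges G. matching (induced H (\<Union>v\<in>inc G e. X v)) (M e) \<and>
      (\<forall>f\<in>M e. \<forall>v\<in>inc G e. card (inc H f \<inter> X v) = 1)" "edges H = (\<Union>e\<in>edges G. M e)"
    using assms(2) unfolding cover_def by blast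
  have "cover_matching G X H M"
  proof
    show "inc H f \<subseteq> (\<Union>v\<in>inc G e. X v)" if "e \<in> edges G" "f \<in> M e" for e f
      using M(1) that unfolding matching_def induced_simps by blast
    show "card (inc H f \<inter> X v) = 1" if "e \<in> edges G" "f \<in> M e" "v \<in> inc G e" for e f v
      using M(1) that by blast
    show "inc H f \<inter> inc H f' = {}" if "e \<in> edges G" "f \<in> M e" "f' \<in> M e" "f \<noteq> f'" for e f f'
      using M(1) that unfolding matching_def by simp
  qed (use assms M(2) cover_props[OF assms(2)] in auto)
  then show ?thesis by (rule that)
qed

context cover_matching
begin

abbreviation "V \<equiv> verts G"
abbreviation "E \<equiv> edges G"

lemma finV: "finite V" and finE: "finite E"
  using wfG unfolding wf_hypergraph_def by auto

lemma incV: "e \<in> E \<Longrightarrow> inc G e \<subseteq> V" and inc_finite: "e \<in> E \<Longrightarrow> finite (inc G e)"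
  using wf_hypergraph_inc[OF wfG] by blast+

lemma other_vertex:
  assumes "e \<in> E"
  obtains w where "w \<in> inc G e" "w \<noteq> v"
proof -
  have "\<not> inc G e \<subseteq> {v}"
  proof
    assume "inc G e \<subseteq> {v}"
    then have "card (inc G e) \<le> card {v}" by (intro card_mono) auto
    then show False using wf_hypergraph_inc(2)[OF wfG assms] by simp
  qed
  then show ?thesis using that by blast
qed

lemma finX: "v \<in> V \<Longrightarrow> finite (X v)"
  using wfH vertsH unfolding wf_hypergraph_def by (metis UN_upper finite_subset)

lemma X_unique: "x \<in> X u \<Longrightarrow> x \<in> X v \<Longrightarrow> u \<in> V \<Longrightarrow> v \<in> V \<Longrightarrow> u = v"
  using disj unfolding disjoint_family_on_def by blast

lemma M_single:
  assumes "e \<in> E" "f \<in> M e" "v \<in> inc G e" "x \<in> inc H f" "x \<in> X v" "y \<in> inc H f" "y \<in> X v"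
  shows "x = y"
proof -
  obtain z where z: "inc H f \<inter> X v = {z}" using M_card[OF assms(1-3)] by (rule card_1_singletonE)
  have "x \<in> inc H f \<inter> X v" "y \<in> inc H f \<inter> X v" using assms(4-7) by blast+
  then show ?thesis unfolding z by simp
qed

lemma M_point:
  assumes "e \<in> E" "f \<in> M e" "v \<in> inc G e"
  obtains x where "x \<in> inc H f" "x \<in> X v"
proof -
  obtain z where "inc H f \<inter> X v = {z}" using M_card[OF assms(1-3)] by (rule card_1_singletonE)
  then show ?thesis using that by blast
qed

lemma M_eq:
  assumes "e \<in> E" "f \<in> M e" "f' \<in> M e" "x \<in> inc H f" "x \<in> inc H f'"
  shows "f = f'"
  using M_disj[OF assms(1-3)] assms(4,5) by blast

text \<open>An edge in \<open>M e\<close> has exactly one end in each list along \<open>e\<close>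
  and no others, so it lies in the image just when the colouring hits that end at every vertex of
  \<open>e\<close>.\<close>

lemma inc_subset_image_iff:
  assumes "S \<subseteq> V" "\<forall>v\<in>S. \<phi> v \<in> X v" "e \<in> E" "f \<in> M e"
  shows "inc H f \<subseteq> \<phi> ` S \<longleftrightarrow> inc G e \<subseteq> S \<and> (\<forall>w\<in>inc G e. \<phi> w \<in> inc H f)"
proof
  assume s: "inc H f \<subseteq> \<phi> ` S"
  have "w \<in> S \<and> \<phi> w \<in> inc H f" if w: "w \<in> inc G e" for w
  proof -
    obtain z where z: "z \<in> inc H f" "z \<in> X w" using M_point[OF assms(3,4) w] .
    then obtain u where u: "u \<in> S" "z = \<phi> u" using s by blast
    then have "z \<in> X u" using assms(2) by blast
    then have "u = w" using X_unique[of z u w] z(2) u(1) assms(1) w incV[OF assms(3)] by blast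
    then show ?thesis using u z(1) by blast
  qed
  then show "inc G e \<subseteq> S \<and> (\<forall>w\<in>inc G e. \<phi> w \<in> inc H f)" by blast
next
  assume s: "inc G e \<subseteq> S \<and> (\<forall>w\<in>inc G e. \<phi> w \<in> inc H f)"
  show "inc H f \<subseteq> \<phi> ` S"
  proof
    fix z assume z: "z \<in> inc H f"
    then obtain w where w: "w \<in> inc G e" "z \<in> X w" using M_sub[OF assms(3,4)] by blast
    then have "z = \<phi> w" using M_single[OF assms(3,4) w(1) z w(2)] s assms(2) by blast
    then show "z \<in> \<phi> ` S" using w(1) s by blast
  qed
qed

lemma ptrans_iff:
  assumes "S \<subseteq> V"
  shows "ptrans X H S \<phi> \<longleftrightarrow> (\<forall>v\<in>S. \<phi> v \<in> X v) \<and>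
    (\<forall>e\<in>E. inc G e \<subseteq> S \<longrightarrow> (\<forall>f\<in>M e. \<exists>w\<in>inc G e. \<phi> w \<notin> inc H f))"
proof (cases "\<forall>v\<in>S. \<phi> v \<in> X v")
  case True
  have "(\<forall>f\<in>edges H. \<not> inc H f \<subseteq> \<phi> ` S) \<longleftrightarrow> (\<forall>e\<in>E. \<forall>f\<in>M e. \<not> inc H f \<subseteq> \<phi> ` S)"
    unfolding edgesH by blast
  also have "\<dots> \<longleftrightarrow> (\<forall>e\<in>E. inc G e \<subseteq> S \<longrightarrow> (\<forall>f\<in>M e. \<exists>w\<in>inc G e. \<phi> w \<notin> inc H f))"
    by (auto simp: inc_subset_image_iff[OF assms True])
  finally show ?thesis unfolding ptrans_def by blast
next
  case False
  then show ?thesis unfolding ptrans_def by blast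
qed

lemma ptrans_cong:
  assumes "\<And>v. v \<in> S \<Longrightarrow> \<phi> v = \<psi> v"
  shows "ptrans X H S \<phi> \<longleftrightarrow> ptrans X H S \<psi>"
proof -
  have "\<phi> ` S = \<psi> ` S" using assms by (intro image_cong) auto
  then show ?thesis using assms unfolding ptrans_def by simp
qed

text \<open>The colour \<open>x\<close> is unavailable at the uncoloured vertex \<open>v\<close> because of \<open>e\<close>.\<close>

definition blocks :: "('v \<Rightarrow> 'x) \<Rightarrow> 'v \<Rightarrow> 'x \<Rightarrow> 'e \<Rightarrow> bool" where
  "blocks \<phi> v x e \<longleftrightarrow> (\<exists>f\<in>M e. x \<in> inc H f \<and> (\<forall>w\<in>inc G e - {v}. \<phi> w \<in> inc H f))"

text \<open>The edges in \<open>M e\<close> are disjoint, so the colour at any other vertex of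
  \<open>e\<close> determines the edge of \<open>H\<close> involved, and that edge has a single end
  in \<open>X v\<close>.\<close>

lemma blocks_functional:
  assumes "e \<in> E" "v \<in> inc G e" "blocks \<phi> v x e" "blocks \<phi> v y e" "x \<in> X v" "y \<in> X v"
  shows "x = y"
proof -
  obtain f where f: "f \<in> M e" "x \<in> inc H f" "\<forall>w\<in>inc G e - {v}. \<phi> w \<in> inc H f"
    using assms(3) unfolding blocks_def by blast
  obtain f' where f': "f' \<in> M e" "y \<in> inc H f'" "\<forall>w\<in>inc G e - {v}. \<phi> w \<in> inc H f'"
    using assms(4) unfolding blocks_def by blast
  obtain w where "w \<in> inc G e" "w \<noteq> v" using other_vertex[OF assms(1)] .
  then have "f = f'" using M_eq[OF assms(1) f(1) f'(1)] f(3) f'(3) by blast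
  then show ?thesis using M_single[OF assms(1) f(1) assms(2)] f f' assms(5,6) by blast
qed

lemma ptrans_extend:
  assumes "ptrans X H S \<phi>" "S \<subseteq> V" "u \<in> V" "u \<notin> S" "x \<in> X u"
    and nb: "\<And>e. e \<in> E \<Longrightarrow> u \<in> inc G e \<Longrightarrow> inc G e \<subseteq> insert u S \<Longrightarrow> \<not> blocks \<phi> u x e"
  shows "ptrans X H (insert u S) (\<phi>(u := x))"
proof -
  note 1 = assms(1)[unfolded ptrans_iff[OF assms(2)]]
  have S: "insert u S \<subseteq> V" using assms(2,3) by blast
  have "\<exists>w\<in>inc G e. (\<phi>(u := x)) w \<notin> inc H f" if e: "e \<in> E" "inc G e \<subseteq> insert u S" "f \<in> M e" for e f
  proof (cases "u \<in> inc G e")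
    case True
    then show ?thesis using nb[OF e(1) True e(2)] e(3) unfolding blocks_def by auto
  next
    case False
    then have "inc G e \<subseteq> S" using e(2) by blast
    then obtain w where "w \<in> inc G e" "\<phi> w \<notin> inc H f" using 1 e by blast
    then show ?thesis using False by (intro bexI[of _ w]) auto
  qed
  moreover have "(\<phi>(u := x)) v \<in> X v" if "v \<in> insert u S" for v
    using that 1 assms(5) by auto
  ultimately show ?thesis unfolding ptrans_iff[OF S] by blast
qed

text \<open>Greedy step: every edge completed by colouring \<open>u\<close> forbids at most one
  colour there.\<close>

lemma ptrans_extend_card:
  assumes "ptrans X H S \<phi>" "S \<subseteq> V" "u \<in> V" "u \<notin> S"
    and c: "card {e \<in> E. u \<in> inc G e \<and> inc G e \<subseteq> insert u S} < card (X u)"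
  shows "\<exists>x\<in>X u. ptrans X H (insert u S) (\<phi>(u := x))"
proof (rule ccontr)
  assume no: "\<not> ?thesis"
  let ?F = "{e \<in> E. u \<in> inc G e \<and> inc G e \<subseteq> insert u S}"
  have "\<forall>x\<in>X u. \<exists>e. e \<in> ?F \<and> blocks \<phi> u x e"
    using ptrans_extend[OF assms(1-4)] no by blast
  from bchoice[OF this] obtain g where g: "\<forall>x\<in>X u. g x \<in> ?F \<and> blocks \<phi> u x (g x)" ..
  have "inj_on g (X u)"
  proof (rule inj_onI)
    fix x y assume "x \<in> X u" "y \<in> X u" "g x = g y"
    then show "x = y" using blocks_functional[of "g x" u \<phi> x y] g by auto
  qed
  then have "card (X u) \<le> card ?F" using g finE by (intro card_inj_on_le[of g]) auto
  then show False using c by simp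
qed

text \<open>Deleting \<open>R\<close> here shrinks the edges that meet \<open>R\<close> instead of
  removing them: such an edge still links its remaining vertices. This suits holes, which can move
  along an edge through \<open>R\<close> without changing the colours on \<open>R\<close>; for a
  single vertex it is the negation of being separating.\<close>

definition conn_minus :: "'v set \<Rightarrow> bool" where
  "conn_minus R \<longleftrightarrow> (\<forall>A. A \<subseteq> V - R \<longrightarrow> A \<noteq> {} \<longrightarrow> A \<noteq> V - R \<longrightarrow>
     (\<exists>e\<in>E. inc G e \<inter> A \<noteq> {} \<and> inc G e \<inter> (V - R - A) \<noteq> {}))"

end

locale uncol = cover_matching +
  assumes conn: "cut_connected G"
    and deg: "\<And>v. v \<in> verts G \<Longrightarrow> degree G v \<le> card (X v)"
    and unc: "\<not> ptrans X H (verts G) \<phi>"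
begin

text \<open>Vertices are coloured in order of decreasing distance from \<open>v\<close>, so that each of them still
  has an edge with an uncoloured vertex when it is coloured.\<close>

lemma ptrans_minus_vertex:
  assumes v: "v \<in> V"
  shows "\<exists>\<phi>. ptrans X H (V - {v}) \<phi>"
proof -
  define \<U> where "\<U> = {U. v \<in> U \<and> U \<subseteq> V \<and>
    (\<forall>\<phi>. ptrans X H (V - U) \<phi> \<longrightarrow> (\<exists>\<psi>. ptrans X H (V - {v}) \<psi>))}"
  have fin: "finite \<U>" using finV unfolding \<U>_def by (auto intro: finite_subset[of _ "Pow V"])
  have "{v} \<in> \<U>" using v unfolding \<U>_def by blast
  then have "Max (card ` \<U>) \<in> card ` \<U>" using fin by (intro Max_in) auto
  then obtain U where U: "U \<in> \<U>" "card U = Max (card ` \<U>)" by auto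
  have max: "card W \<le> card U" if "W \<in> \<U>" for W
    unfolding U(2) using that fin by (intro Max_ge) auto
  have "U = V"
  proof (rule ccontr)
    assume "U \<noteq> V"
    have "U \<subseteq> V" "U \<noteq> {}" using U(1) unfolding \<U>_def by blast+
    then obtain e where e: "e \<in> E" "inc G e \<inter> U \<noteq> {}" "inc G e \<inter> (V - U) \<noteq> {}"
      using conn \<open>U \<noteq> V\<close> unfolding cut_connected_def by blast
    then obtain u where u: "u \<in> inc G e" "u \<in> V" "u \<notin> U" by blast
    have "insert u U \<in> \<U>"
      unfolding \<U>_def
    proof (intro CollectI conjI allI impI)
      show "v \<in> insert u U" "insert u U \<subseteq> V" using U(1) u(2) unfolding \<U>_def by auto
      fix \<phi> assume \<phi>: "ptrans X H (V - insert u U) \<phi>"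
      let ?S = "V - insert u U"
      \<comment> \<open>The edge \<open>e\<close> meets the uncoloured set \<open>U\<close>, so it
        imposes nothing on \<open>u\<close> yet; this leaves fewer constraints than the degree of
        \<open>u\<close>.\<close>
      have "{e \<in> E. u \<in> inc G e \<and> inc G e \<subseteq> insert u ?S} \<subset> {e \<in> E. u \<in> inc G e}"
        using e u by blast
      then have "card {e \<in> E. u \<in> inc G e \<and> inc G e \<subseteq> insert u ?S} < degree G u"
        unfolding degree_def using finE by (intro psubset_card_mono) auto
      then have "\<exists>x\<in>X u. ptrans X H (insert u ?S) (\<phi>(u := x))"
        using deg[OF u(2)] by (intro ptrans_extend_card[OF \<phi> _ u(2)]) auto
      moreover have "insert u ?S = V - U" using u by blast
      ultimately show "\<exists>\<psi>. ptrans X H (V - {v}) \<psi>" using U(1) unfolding \<U>_def by auto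
    qed
    then have "card (insert u U) \<le> card U" by (rule max)
    moreover have "finite U" using U(1) finV unfolding \<U>_def by (auto intro: finite_subset)
    ultimately show False using u(3) by simp
  qed
  moreover have "ptrans X H {} \<phi>" for \<phi>
    unfolding ptrans_def using wf_hypergraph_inc(3)[OF wfH] by auto
  ultimately show ?thesis using U(1) unfolding \<U>_def by auto
qed

text \<open>Every colour is blocked by some edge, as otherwise the hole could be filled; each edge
  blocks at most one colour; and there are at least as many colours as edges. Hence blocking is a
  bijection.\<close>

lemma exact:
  assumes v: "v \<in> V" and \<phi>: "ptrans X H (V - {v}) \<phi>"
  shows "\<exists>g. bij_betw g (X v) {e \<in> E. v \<in> inc G e} \<and>
    (\<forall>x\<in>X v. \<forall>e\<in>E. v \<in> inc G e \<longrightarrow> blocks \<phi> v x e \<longleftrightarrow> e = g x)"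
proof -
  let ?F = "{e \<in> E. v \<in> inc G e}"
  have ins: "insert v (V - {v}) = V" using v by blast
  have "\<forall>x\<in>X v. \<exists>e. e \<in> ?F \<and> blocks \<phi> v x e"
  proof
    fix x assume "x \<in> X v"
    then show "\<exists>e. e \<in> ?F \<and> blocks \<phi> v x e"
      using ptrans_extend[OF \<phi> Diff_subset v, of x] unc unfolding ins by blast
  qed
  from bchoice[OF this] obtain g where g: "\<forall>x\<in>X v. g x \<in> ?F \<and> blocks \<phi> v x (g x)" ..
  have inj: "inj_on g (X v)"
  proof (rule inj_onI)
    fix x y assume "x \<in> X v" "y \<in> X v" "g x = g y"
    then show "x = y" using blocks_functional[of "g x" v \<phi> x y] g by auto
  qed
  have "g ` X v \<subseteq> ?F" using g by blast
  moreover have "card ?F \<le> card (g ` X v)"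
    using deg[OF v] card_image[OF inj] unfolding degree_def by simp
  ultimately have im: "g ` X v = ?F" using finE by (intro card_seteq) auto
  have "blocks \<phi> v x e \<longleftrightarrow> e = g x" if x: "x \<in> X v" and e: "e \<in> E" "v \<in> inc G e" for x e
  proof
    assume b: "blocks \<phi> v x e"
    obtain y where y: "y \<in> X v" "e = g y" using im e by blast
    then have "x = y" using blocks_functional[OF e b] g x by blast
    then show "e = g x" using y by simp
  qed (use g x in blast)
  then show ?thesis using inj im unfolding bij_betw_def by blast
qed

lemma card_X: "v \<in> V \<Longrightarrow> card (X v) = degree G v"
proof -
  assume v: "v \<in> V"
  obtain \<phi> where \<phi>: "ptrans X H (V - {v}) \<phi>" using ptrans_minus_vertex[OF v] by blast
  obtain g where "bij_betw g (X v) {e \<in> E. v \<in> inc G e}" using exact[OF v \<phi>] by blast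
  then show ?thesis unfolding degree_def by (rule bij_betw_same_card)
qed

lemma exact_edge:
  assumes "v \<in> V" "ptrans X H (V - {v}) \<phi>" "e \<in> E" "v \<in> inc G e"
  obtains x where "x \<in> X v" "blocks \<phi> v x e"
  using exact[OF assms(1,2)] assms(3,4) unfolding bij_betw_def by blast

lemma exact_color:
  assumes "v \<in> V" "ptrans X H (V - {v}) \<phi>" "x \<in> X v"
  obtains e where "e \<in> E" "v \<in> inc G e" "blocks \<phi> v x e"
  using exact[OF assms(1,2)] assms(3) unfolding bij_betw_def by blast

lemma exact_unique:
  assumes "v \<in> V" "ptrans X H (V - {v}) \<phi>" "x \<in> X v" "e \<in> E" "v \<in> inc G e" "blocks \<phi> v x e"
    "e' \<in> E" "v \<in> inc G e'" "blocks \<phi> v x e'"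
  shows "e = e'"
proof -
  obtain g where "\<forall>x\<in>X v. \<forall>e\<in>E. v \<in> inc G e \<longrightarrow> blocks \<phi> v x e \<longleftrightarrow> e = g x"
    using exact[OF assms(1,2)] by blast
  then show ?thesis using assms(3-) by simp
qed

text \<open>The only edge that forbids \<open>x\<close> at \<open>v\<close> is \<open>e\<close>, and
  uncolouring another vertex of \<open>e\<close> lifts this obstruction.\<close>

lemma hole_move:
  assumes v: "v \<in> V" and \<phi>: "ptrans X H (V - {v}) \<phi>" and e: "e \<in> E" "v \<in> inc G e"
    and x: "x \<in> X v" "blocks \<phi> v x e" and w: "w \<in> inc G e" "w \<noteq> v"
  shows "ptrans X H (V - {w}) (\<phi>(v := x))"
proof -
  have wV: "w \<in> V" using w e incV by blast
  have "ptrans X H (V - {v} - {w}) \<phi>"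
    using \<phi> unfolding ptrans_def by (meson DiffD1 Diff_subset image_mono order_trans)
  then have "ptrans X H (insert v (V - {v} - {w})) (\<phi>(v := x))"
  proof (rule ptrans_extend)
    fix e' assume e': "e' \<in> E" "v \<in> inc G e'" "inc G e' \<subseteq> insert v (V - {v} - {w})"
    then have "e \<noteq> e'" using w by blast
    then show "\<not> blocks \<phi> v x e'" using exact_unique[OF v \<phi> x(1) e x(2) e'(1,2)] by blast
  qed (use v x in auto)
  moreover have "insert v (V - {v} - {w}) = V - {w}" using v w by blast
  ultimately show ?thesis by simp
qed

text \<open>The vertices a hole can reach while \<open>R\<close> keeps its colours are closed under
  crossing edges, because a move recolours only the vertex the hole leaves, and that vertex is
  outside \<open>R\<close>.\<close>

lemma hole_walk:
  assumes R: "conn_minus R" and u: "u \<in> V - R" and \<phi>: "ptrans X H (V - {u}) \<phi>" and r: "r \<in> V - R"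
  shows "\<exists>\<psi>. ptrans X H (V - {r}) \<psi> \<and> (\<forall>c\<in>R. \<psi> c = \<phi> c)"
proof -
  define A where "A = {a \<in> V - R. \<exists>\<psi>. ptrans X H (V - {a}) \<psi> \<and> (\<forall>c\<in>R. \<psi> c = \<phi> c)}"
  have "A = V - R"
  proof (rule ccontr)
    assume "A \<noteq> V - R"
    moreover have "A \<subseteq> V - R" "u \<in> A" using u \<phi> unfolding A_def by auto
    ultimately obtain e a b where e: "e \<in> E" "a \<in> inc G e" "a \<in> A" "b \<in> inc G e" "b \<in> V - R - A"
      using R unfolding conn_minus_def by blast
    then obtain \<psi> where \<psi>: "ptrans X H (V - {a}) \<psi>" "\<forall>c\<in>R. \<psi> c = \<phi> c" and a: "a \<in> V - R"
      unfolding A_def by blast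
    obtain x where x: "x \<in> X a" "blocks \<psi> a x e" using exact_edge[OF _ \<psi>(1) e(1,2)] a by blast
    have "ptrans X H (V - {b}) (\<psi>(a := x))"
      using hole_move[OF _ \<psi>(1) e(1,2) x e(4)] a e(3,5) by blast
    moreover have "\<forall>c\<in>R. (\<psi>(a := x)) c = \<phi> c" using \<psi>(2) a by auto
    ultimately have "b \<in> A" using e(5) unfolding A_def by blast
    then show False using e(5) by blast
  qed
  then show ?thesis using r unfolding A_def by blast
qed

section \<open>Hyperedges\<close>

text \<open>Moving the hole from \<open>v\<close> to \<open>a\<close> along \<open>e'\<close> and
  back along \<open>e\<close> changes the colour of \<open>a\<close> and nothing else. In both
  colourings \<open>e\<close> blocks a colour at \<open>v\<close>; a third vertex of
  \<open>e\<close> forces the same edge of \<open>H\<close> both times, which would then contain two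
  colours of \<open>a\<close>.\<close>

lemma hyperedge_linear:
  assumes e: "e \<in> E" "card (inc G e) \<ge> 3" and e': "e' \<in> E" "e' \<noteq> e"
    and v: "v \<in> inc G e" "v \<in> inc G e'" and a: "a \<in> inc G e" "a \<in> inc G e'" "a \<noteq> v"
  shows False
proof -
  have vV: "v \<in> V" and aV: "a \<in> V" using v a e incV by blast+
  obtain \<phi> where \<phi>: "ptrans X H (V - {v}) \<phi>" using ptrans_minus_vertex[OF vV] by blast
  obtain x where x: "x \<in> X v" "blocks \<phi> v x e'" using exact_edge[OF vV \<phi> e'(1) v(2)] .
  let ?\<psi> = "\<phi>(v := x)"
  have \<psi>: "ptrans X H (V - {a}) ?\<psi>" using hole_move[OF vV \<phi> e'(1) v(2) x a(2,3)] .
  have \<phi>a: "\<phi> a \<in> X a" using \<phi> aV a(3) unfolding ptrans_def by blast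
  have ba: "blocks ?\<psi> a (\<phi> a) e'"
    using x(2) a v unfolding blocks_def by auto
  obtain y where y: "y \<in> X a" "blocks ?\<psi> a y e" using exact_edge[OF aV \<psi> e(1) a(1)] .
  \<comment> \<open>After the move \<open>e'\<close> blocks the former colour of \<open>a\<close>,
    so the colour blocked by \<open>e\<close> must be a different one.\<close>
  have "y \<noteq> \<phi> a" using exact_unique[OF aV \<psi> y(1) e(1) a(1) y(2) e'(1) a(2)] ba e'(2) by blast
  have "ptrans X H (V - {v}) (?\<psi>(a := y))"
    using hole_move[OF aV \<psi> e(1) a(1) y v(1)] a(3) by blast
  then have \<chi>: "ptrans X H (V - {v}) (\<phi>(a := y))"
    by (subst ptrans_cong[of _ _ "?\<psi>(a := y)"]) auto
  obtain z where z: "z \<in> X v" "blocks \<phi> v z e" using exact_edge[OF vV \<phi> e(1) v(1)] .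
  obtain z' where z': "z' \<in> X v" "blocks (\<phi>(a := y)) v z' e" using exact_edge[OF vV \<chi> e(1) v(1)] .
  obtain f where f: "f \<in> M e" "\<forall>w\<in>inc G e - {v}. \<phi> w \<in> inc H f" using z unfolding blocks_def by blast
  obtain f' where f': "f' \<in> M e" "\<forall>w\<in>inc G e - {v}. (\<phi>(a := y)) w \<in> inc H f'"
    using z' unfolding blocks_def by blast
  have "\<not> inc G e \<subseteq> {v, a}"
  proof
    assume "inc G e \<subseteq> {v, a}"
    then have "card (inc G e) \<le> card {v, a}" by (intro card_mono) auto
    then show False using e(2) card_insert_le_m1[of 2 "{a}" v] by simp
  qed
  then obtain c where c: "c \<in> inc G e - {v}" "c \<noteq> a" by blast
  have "\<phi> c \<in> inc H f" "\<phi> c \<in> inc H f'" using bspec[OF f(2) c(1)] bspec[OF f'(2) c(1)] c(2) by auto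
  then have "f = f'" using M_eq[OF e(1) f(1) f'(1)] by blast
  then have "\<phi> a \<in> inc H f" "y \<in> inc H f"
    using bspec[OF f(2), of a] bspec[OF f'(2), of a] a(1,3) by auto
  then show False using M_single[OF e(1) f(1) a(1)] \<phi>a y(1) \<open>y \<noteq> \<phi> a\<close> by blast
qed

text \<open>The hole leaves \<open>b\<close> along \<open>e'\<close>, giving \<open>b\<close> a
  colour outside the edge \<open>f\<close> that contains the colours on the rest of
  \<open>e\<close>. It walks outside \<open>b\<close> until it enters \<open>e\<close> at some
  \<open>w\<close>. There \<open>e\<close> must block a colour by an edge of \<open>H\<close> that
  agrees with \<open>f\<close> at a third vertex, hence equals \<open>f\<close>, although it
  contains the wrong colour of \<open>b\<close>.\<close>

lemma hyperedge_isolated: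
  assumes block: "\<And>v. v \<in> V \<Longrightarrow> conn_minus {v}"
    and e: "e \<in> E" "card (inc G e) \<ge> 3" and e': "e' \<in> E" "e' \<noteq> e"
    and b: "b \<in> inc G e" "b \<in> inc G e'"
  shows False
proof -
  have bV: "b \<in> V" using b e incV by blast
  obtain \<phi> where \<phi>: "ptrans X H (V - {b}) \<phi>" using ptrans_minus_vertex[OF bV] by blast
  obtain x0 where x0: "x0 \<in> X b" "blocks \<phi> b x0 e" using exact_edge[OF bV \<phi> e(1) b(1)] .
  obtain f where f: "f \<in> M e" "x0 \<in> inc H f" "\<forall>w\<in>inc G e - {b}. \<phi> w \<in> inc H f"
    using x0 unfolding blocks_def by blast
  obtain x where x: "x \<in> X b" "blocks \<phi> b x e'" using exact_edge[OF bV \<phi> e'(1) b(2)] .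
  have "x \<noteq> x0" using exact_unique[OF bV \<phi> x(1) e'(1) b(2) x(2) e(1) b(1)] x0 e'(2) by blast
  then have xf: "x \<notin> inc H f" using M_single[OF e(1) f(1) b(1)] x(1) x0(1) f(2) by blast
  \<comment> \<open>Positions of the hole outside \<open>e\<close> with the colours on
    \<open>e\<close> intact. Since \<open>b\<close> does not separate, an edge leads from here to a
    vertex other than \<open>b\<close>, and stopping at the earliest such exit guarantees that only
    one vertex of \<open>e\<close> is uncoloured.\<close>
  define D where "D = {u \<in> V - inc G e. \<exists>\<psi>. ptrans X H (V - {u}) \<psi> \<and> \<psi> b = x \<and>
    (\<forall>c\<in>inc G e - {b}. \<psi> c = \<phi> c)}"
  obtain u where u: "u \<in> inc G e'" "u \<noteq> b" using other_vertex[OF e'(1)] .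
  have "u \<notin> inc G e" using hyperedge_linear[OF e e' b _ u] by blast
  moreover have "u \<in> V" using u e' incV by blast
  moreover have "ptrans X H (V - {u}) (\<phi>(b := x))" using hole_move[OF bV \<phi> e'(1) b(2) x u] .
  moreover have "(\<phi>(b := x)) b = x" "\<forall>c\<in>inc G e - {b}. (\<phi>(b := x)) c = \<phi> c" by simp_all
  ultimately have "u \<in> D" unfolding D_def by blast
  obtain c0 where c0: "c0 \<in> inc G e" "c0 \<noteq> b" using other_vertex[OF e(1)] .
  then have "D \<noteq> V - {b}" using incV[OF e(1)] unfolding D_def by blast
  moreover have "D \<subseteq> V - {b}" using b(1) unfolding D_def by blast
  ultimately obtain g a w where g: "g \<in> E" "a \<in> inc G g" "a \<in> D" "w \<in> inc G g" "w \<in> V - {b} - D"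
    using block[OF bV] \<open>u \<in> D\<close> unfolding conn_minus_def by blast
  then obtain \<psi> where \<psi>: "ptrans X H (V - {a}) \<psi>" "\<psi> b = x" "\<forall>c\<in>inc G e - {b}. \<psi> c = \<phi> c"
    and a: "a \<in> V" "a \<notin> inc G e" unfolding D_def by blast
  obtain y where y: "y \<in> X a" "blocks \<psi> a y g" using exact_edge[OF a(1) \<psi>(1) g(1,2)] .
  let ?\<psi> = "\<psi>(a := y)"
  have w: "w \<in> V" "w \<noteq> a" "w \<noteq> b" using g(3,5) by auto
  have \<psi>': "ptrans X H (V - {w}) ?\<psi>" using hole_move[OF a(1) \<psi>(1) g(1,2) y g(4) w(2)] .
  have keep: "?\<psi> b = x" "\<forall>c\<in>inc G e - {b}. ?\<psi> c = \<phi> c" using \<psi>(2,3) a(2) b(1) by auto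
  have we: "w \<in> inc G e"
  proof (rule ccontr)
    assume "w \<notin> inc G e"
    then have "w \<in> D" using \<psi>' keep w(1) unfolding D_def by blast
    then show False using g(5) by blast
  qed
  have "\<not> inc G e \<subseteq> {b, w}"
  proof
    assume "inc G e \<subseteq> {b, w}"
    then have "card (inc G e) \<le> card {b, w}" by (intro card_mono) auto
    then show False using e(2) card_insert_le_m1[of 2 "{w}" b] by simp
  qed
  then obtain c where c: "c \<in> inc G e" "c \<noteq> b" "c \<noteq> w" by blast
  obtain z where "blocks ?\<psi> w z e" using exact_edge[OF w(1) \<psi>' e(1) we] .
  then obtain f' where f': "f' \<in> M e" "\<forall>v\<in>inc G e - {w}. ?\<psi> v \<in> inc H f'" unfolding blocks_def by blast
  then have "?\<psi> c \<in> inc H f'" "?\<psi> b \<in> inc H f'" using c b(1) w(3) by blast+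
  then have "\<phi> c \<in> inc H f'" "x \<in> inc H f'" using c keep by auto
  moreover have "\<phi> c \<in> inc H f" using c f(3) by blast
  ultimately have "x \<in> inc H f" using M_eq[OF e(1) f(1) f'(1)] by blast
  then show False using xf by blast
qed

end

section \<open>Blocks with ordinary edges: neighbourhoods of colours\<close>

locale block_graph = uncol G X H M
  for G :: "('v, 'e) hypergraph" and X :: "'v \<Rightarrow> 'x set" and H :: "('x, 'f) hypergraph"
    and M :: "'e \<Rightarrow> 'f set" +
  assumes block: "\<And>v. v \<in> verts G \<Longrightarrow> conn_minus {v}"
    and graph: "\<And>e. e \<in> edges G \<Longrightarrow> card (inc G e) = 2"
begin

definition nb :: "'x \<Rightarrow> 'x \<Rightarrow> bool" where
  "nb x y \<longleftrightarrow> (\<exists>f\<in>edges H. inc H f = {x, y})"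

definition N :: "'x \<Rightarrow> 'v \<Rightarrow> 'x set" where
  "N x v = {y \<in> X v. nb x y}"

definition adj :: "'v \<Rightarrow> 'v \<Rightarrow> bool" where
  "adj u v \<longleftrightarrow> u \<noteq> v \<and> (\<exists>e\<in>edges G. inc G e = {u, v})"

lemma nb_sym: "nb x y \<longleftrightarrow> nb y x"
  unfolding nb_def by (simp add: insert_commute)

lemma adj_sym: "adj u v \<longleftrightarrow> adj v u"
  unfolding adj_def by (auto simp: insert_commute)

lemma mult_sym: "mult G u v = mult G v u"
  unfolding mult_def by (simp add: insert_commute)

lemma adj_V: "adj u v \<Longrightarrow> u \<in> V \<and> v \<in> V"
  unfolding adj_def using incV by blast

lemma edge_pair:
  assumes "e \<in> E" "v \<in> inc G e"
  obtains w where "inc G e = {v, w}" "w \<noteq> v" "w \<in> V" "adj v w"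
proof -
  obtain w where w: "w \<in> inc G e" "w \<noteq> v" using other_vertex[OF assms(1)] .
  have "{v, w} = inc G e"
    using w assms(2) graph[OF assms(1)] inc_finite[OF assms(1)] by (intro card_seteq) auto
  then show ?thesis using that[of w] w assms incV[OF assms(1)] unfolding adj_def by blast
qed

lemma M_pair:
  assumes "e \<in> E" "inc G e = {v, w}" "v \<noteq> w" "x \<in> X v" "y \<in> X w" "f \<in> M e" "x \<in> inc H f" "y \<in> inc H f"
  shows "inc H f = {x, y}"
proof -
  have "inc H f \<subseteq> X v \<union> X w" using M_sub[OF assms(1,6)] assms(2) by simp
  moreover have "z = x" if "z \<in> inc H f" "z \<in> X v" for z
    using M_single[OF assms(1,6), of v] that assms by blast
  moreover have "z = y" if "z \<in> inc H f" "z \<in> X w" for z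
    using M_single[OF assms(1,6), of w] that assms by blast
  ultimately show ?thesis using assms(7,8) by blast
qed

lemma nb_edge:
  assumes "f \<in> edges H" "inc H f = {x, y}" "x \<in> X u" "y \<in> X v" "u \<in> V" "v \<in> V"
  shows "u \<noteq> v" "\<exists>e\<in>E. inc G e = {u, v} \<and> f \<in> M e"
proof -
  obtain e where e: "e \<in> E" "f \<in> M e" using assms(1) edgesH by blast
  have "w = u \<or> w = v" if w: "w \<in> inc G e" for w
  proof -
    obtain z where z: "z \<in> inc H f" "z \<in> X w" using M_point[OF e w] .
    have "w \<in> V" using w incV[OF e(1)] by blast
    have "z = x \<or> z = y" using z(1) assms(2) by simp
    then show ?thesis
      using X_unique[of z w u] X_unique[of z w v] z(2) assms(3-6) \<open>w \<in> V\<close> by auto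
  qed
  then have "inc G e \<subseteq> {u, v}" by blast
  moreover have c: "card (inc G e) = 2" using graph[OF e(1)] .
  ultimately have *: "inc G e = {u, v}" by (intro card_seteq) (auto simp: card_insert_if)
  then show "u \<noteq> v" using c by auto
  show "\<exists>e\<in>E. inc G e = {u, v} \<and> f \<in> M e" using e * by blast
qed

lemma edge_H_pair:
  assumes "f \<in> edges H"
  obtains u v x y where "u \<in> V" "v \<in> V" "u \<noteq> v" "x \<in> X u" "y \<in> X v" "inc H f = {x, y}" "adj u v"
proof -
  obtain e where e: "e \<in> E" "f \<in> M e" using assms edgesH by blast
  obtain u where "u \<in> inc G e" using other_vertex[OF e(1)] .
  then obtain v where v: "inc G e = {u, v}" "v \<noteq> u" "adj u v" using edge_pair[OF e(1)] by metis
  obtain x where x: "x \<in> inc H f" "x \<in> X u" using M_point[OF e] v(1) by blast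
  obtain y where y: "y \<in> inc H f" "y \<in> X v" using M_point[OF e] v(1) by blast
  show ?thesis using that[of u v x y] M_pair[OF e(1) v(1) v(2)[symmetric] x(2) y(2) e(2) x(1) y(1)]
    v x y incV[OF e(1)] by blast
qed

lemma nb_adj: "nb x y \<Longrightarrow> x \<in> X u \<Longrightarrow> y \<in> X v \<Longrightarrow> u \<in> V \<Longrightarrow> v \<in> V \<Longrightarrow> adj u v"
proof -
  assume a: "nb x y" "x \<in> X u" "y \<in> X v" "u \<in> V" "v \<in> V"
  then obtain f where f: "f \<in> edges H" "inc H f = {x, y}" unfolding nb_def by blast
  show "adj u v" using nb_edge[OF f a(2-5)] unfolding adj_def by blast
qed

lemma nb_blocks:
  assumes "v \<in> V" "ptrans X H (V - {v}) \<phi>" "x \<in> X v" "u \<in> V" "u \<noteq> v" "nb x (\<phi> u)"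
  obtains e where "e \<in> E" "inc G e = {v, u}" "blocks \<phi> v x e"
proof -
  have "\<phi> u \<in> X u" using assms(2,4,5) unfolding ptrans_def by blast
  moreover obtain f where f: "f \<in> edges H" "inc H f = {x, \<phi> u}" using assms(6) unfolding nb_def by blast
  ultimately obtain e where e: "e \<in> E" "inc G e = {v, u}" "f \<in> M e"
    using nb_edge(2)[OF f assms(3) _ assms(1,4)] by blast
  have "blocks \<phi> v x e" unfolding blocks_def using e(2,3) f(2) by (intro bexI[of _ f]) auto
  then show ?thesis using that e by blast
qed

lemma blocks_pair_nb:
  assumes "\<phi> u \<in> X u" "x \<in> X v" "u \<noteq> v" "e \<in> E" "inc G e = {v, u}" "blocks \<phi> v x e"
  shows "nb x (\<phi> u)"
proof -
  obtain f where f: "f \<in> M e" "x \<in> inc H f" "\<phi> u \<in> inc H f"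
    using assms(3,5,6) unfolding blocks_def by auto
  then have "inc H f = {x, \<phi> u}"
    using M_pair[OF assms(4,5) assms(3)[symmetric] assms(2,1) f] by blast
  then show ?thesis unfolding nb_def using f(1) assms(4) edgesH by blast
qed

lemma blocks_nb:
  assumes "v \<in> V" "ptrans X H (V - {v}) \<phi>" "x \<in> X v" "u \<noteq> v" "e \<in> E" "inc G e = {v, u}" "blocks \<phi> v x e"
  shows "nb x (\<phi> u)"
proof (rule blocks_pair_nb[OF _ assms(3-7)])
  show "\<phi> u \<in> X u" using incV[OF assms(5)] assms(2,4,6) unfolding ptrans_def by blast
qed

lemma exact_nb:
  assumes "v \<in> V" "ptrans X H (V - {v}) \<phi>" "x \<in> X v"
    "u \<in> V" "u \<noteq> v" "nb x (\<phi> u)" "w \<in> V" "w \<noteq> v" "nb x (\<phi> w)"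
  shows "u = w"
proof -
  obtain e where e: "e \<in> E" "inc G e = {v, u}" "blocks \<phi> v x e" using nb_blocks[OF assms(1-6)] .
  obtain e' where e': "e' \<in> E" "inc G e' = {v, w}" "blocks \<phi> v x e'" using nb_blocks[OF assms(1-3,7-9)] .
  have "e = e'" using exact_unique[OF assms(1-3) e(1) _ e(3) e'(1) _ e'(3)] e(2) e'(2) by blast
  then show ?thesis using e(2) e'(2) assms(5,8) by (auto simp: doubleton_eq_iff)
qed

lemma exact_nb_ex:
  assumes "v \<in> V" "ptrans X H (V - {v}) \<phi>" "x \<in> X v"
  obtains u where "u \<in> V" "u \<noteq> v" "adj v u" "nb x (\<phi> u)" "ptrans X H (V - {u}) (\<phi>(v := x))"
proof -
  obtain e where e: "e \<in> E" "v \<in> inc G e" "blocks \<phi> v x e" using exact_color[OF assms] .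
  obtain u where u: "inc G e = {v, u}" "u \<noteq> v" "u \<in> V" "adj v u" using edge_pair[OF e(1,2)] .
  then show ?thesis
    using that[of u] blocks_nb[OF assms u(2) e(1) u(1) e(3)] hole_move[OF assms(1,2) e(1,2) assms(3) e(3)]
    by blast
qed

text \<open>From a hole at \<open>u\<close>, the edge blocking \<open>y\<close> lets
  \<open>u\<close> take the colour \<open>y\<close>; afterwards the hole travels to \<open>v\<close>
  around \<open>u\<close>, which is not separating.\<close>

lemma color_at:
  assumes "u \<in> V" "v \<in> V" "u \<noteq> v" "y \<in> X u"
  obtains \<phi> where "ptrans X H (V - {v}) \<phi>" "\<phi> u = y"
proof -
  obtain \<phi> where \<phi>: "ptrans X H (V - {u}) \<phi>" using ptrans_minus_vertex[OF assms(1)] by blast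
  obtain w where w: "w \<in> V" "w \<noteq> u" "ptrans X H (V - {w}) (\<phi>(u := y))"
    using exact_nb_ex[OF assms(1) \<phi> assms(4)] by metis
  have "\<exists>\<psi>. ptrans X H (V - {v}) \<psi> \<and> (\<forall>c\<in>{u}. \<psi> c = (\<phi>(u := y)) c)"
    by (rule hole_walk[OF block[OF assms(1)] _ w(3)]) (use w assms in auto)
  then show ?thesis using that by auto
qed

text \<open>Put a hole at \<open>v\<close> with colour \<open>y\<close> at \<open>u\<close>. The
  colours of \<open>v\<close> blocked by edges between \<open>u\<close> and \<open>v\<close> are the
  neighbours of \<open>y\<close>, and the bijection of \<open>exact\<close> matches them with these
  edges.\<close>

lemma card_N:
  assumes "u \<in> V" "v \<in> V" "u \<noteq> v" "y \<in> X u"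
  shows "card (N y v) = mult G u v"
proof -
  obtain \<phi> where \<phi>: "ptrans X H (V - {v}) \<phi>" "\<phi> u = y" using color_at[OF assms] .
  obtain g where g: "bij_betw g (X v) {e \<in> E. v \<in> inc G e}"
    "\<And>x e. x \<in> X v \<Longrightarrow> e \<in> E \<Longrightarrow> v \<in> inc G e \<Longrightarrow> blocks \<phi> v x e \<longleftrightarrow> e = g x"
    using exact[OF assms(2) \<phi>(1)] by blast
  have "g ` N y v = {e \<in> E. inc G e = {u, v}}"
  proof (intro equalityI subsetI)
    fix e assume "e \<in> g ` N y v"
    then obtain x where x: "x \<in> X v" "nb x (\<phi> u)" "e = g x" unfolding N_def using \<phi>(2) nb_sym by blast
    obtain e' where e': "e' \<in> E" "inc G e' = {v, u}" "blocks \<phi> v x e'"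
      using nb_blocks[OF assms(2) \<phi>(1) x(1) assms(1,3) x(2)] .
    then have "e' = e" using g(2)[OF x(1) e'(1)] x(3) by blast
    then show "e \<in> {e \<in> E. inc G e = {u, v}}" using e' by blast
  next
    fix e assume e: "e \<in> {e \<in> E. inc G e = {u, v}}"
    then have e1: "e \<in> E" "inc G e = {v, u}" "v \<in> inc G e" by auto
    then obtain x where x: "x \<in> X v" "e = g x" using g(1) unfolding bij_betw_def by blast
    then have "nb x (\<phi> u)" using blocks_nb[OF assms(2) \<phi>(1) x(1) assms(3) e1(1,2)] g(2)[OF x(1) e1(1,3)] by blast
    then show "e \<in> g ` N y v" unfolding N_def using x \<phi>(2) nb_sym by blast
  qed
  moreover have "inj_on g (N y v)"
    using g(1) unfolding bij_betw_def N_def by (auto intro: inj_on_subset)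
  ultimately show ?thesis unfolding mult_def by (metis card_image)
qed

lemma mult_pos: "adj u v \<longleftrightarrow> u \<noteq> v \<and> mult G u v \<ge> 1"
proof -
  have "finite {e \<in> E. inc G e = {u, v}}" using finE by simp
  then have "mult G u v \<ge> 1 \<longleftrightarrow> {e \<in> E. inc G e = {u, v}} \<noteq> {}"
    unfolding mult_def by (simp add: Suc_le_eq card_gt_0_iff)
  then show ?thesis unfolding adj_def by blast
qed

lemma N_nonempty:
  assumes "adj u v" "y \<in> X u"
  obtains x where "x \<in> X v" "nb y x"
proof -
  have "card (N y v) \<ge> 1" using card_N adj_V assms mult_pos by metis
  then have "N y v \<noteq> {}" by auto
  then show ?thesis using that unfolding N_def by blast
qed

lemma finN: "v \<in> V \<Longrightarrow> finite (N x v)"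
  unfolding N_def using finX by simp

lemma X_nonempty:
  assumes "adj u v" shows "X u \<noteq> {}"
proof -
  obtain e where e: "e \<in> E" "inc G e = {u, v}" using assms unfolding adj_def by blast
  then have "{e \<in> E. u \<in> inc G e} \<noteq> {}" by blast
  then have "degree G u \<noteq> 0" unfolding degree_def using finE by simp
  then show ?thesis using card_X[of u] adj_V[OF assms] by auto
qed

text \<open>Colouring \<open>u\<close> and \<open>w\<close> with non-adjacent \<open>x\<close> and \<open>y\<close> leaves a connected rest; there every
  colour is blocked by exactly one edge.\<close>

lemma disjoint_neighbourhoods:
  assumes "u \<in> V" "w \<in> V" "u \<noteq> w" "conn_minus {u, w}" "x \<in> X u" "y \<in> X w" "\<not> nb x y"
    "r \<in> V" "r \<noteq> u" "r \<noteq> w" "z \<in> X r" "nb z x" "nb z y"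
  shows False
proof -
  obtain \<phi> where \<phi>: "ptrans X H (V - {w}) \<phi>" "\<phi> u = x" using color_at[OF assms(1,2,3,5)] .
  obtain c where c: "c \<in> V" "c \<noteq> w" "nb y (\<phi> c)" "ptrans X H (V - {c}) (\<phi>(w := y))"
    using exact_nb_ex[OF assms(2) \<phi>(1) assms(6)] by metis
  \<comment> \<open>Since \<open>x\<close> and \<open>y\<close> are not adjacent, the edge blocking
    \<open>y\<close> does not end in \<open>u\<close>; the hole therefore leaves \<open>w\<close>
    into the connected rest.\<close>
  have "c \<noteq> u" using c(3) \<phi>(2) assms(7) nb_sym by blast
  then have "\<exists>\<psi>. ptrans X H (V - {r}) \<psi> \<and> (\<forall>c\<in>{u, w}. \<psi> c = (\<phi>(w := y)) c)"
    using c assms(8-10) by (intro hole_walk[OF assms(4) _ c(4)]) auto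
  then obtain \<psi> where \<psi>: "ptrans X H (V - {r}) \<psi>" "\<psi> u = x" "\<psi> w = y" using \<phi>(2) assms(3) by auto
  show False
    using exact_nb[OF assms(8) \<psi>(1) assms(11) assms(1) _ _ assms(2)] \<psi>(2,3) assms(3,9,10,12,13) by metis
qed

text \<open>A colour \<open>z\<close> at the common neighbour has neighbours \<open>x\<close> at
  \<open>u\<close> and \<open>y\<close> at \<open>w\<close>, and these are not adjacent because
  \<open>u\<close> and \<open>w\<close> are not. If the rest were connected, \<open>z\<close> could
  be blocked twice.\<close>

lemma not_conn_minus_pair:
  assumes "u \<noteq> w" "\<not> adj u w" "adj r u" "adj r w"
  shows "\<not> conn_minus {u, w}"
proof
  assume c: "conn_minus {u, w}"
  have V: "u \<in> V" "w \<in> V" "r \<in> V" "r \<noteq> u" "r \<noteq> w" using assms adj_V unfolding adj_def by auto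
  obtain z where z: "z \<in> X r" using X_nonempty[OF assms(3)] by blast
  obtain x where x: "x \<in> X u" "nb z x" using N_nonempty[OF assms(3) z] .
  obtain y where y: "y \<in> X w" "nb z y" using N_nonempty[OF assms(4) z] .
  have "\<not> nb x y" using nb_adj[of x y u w] x y V assms(2) by blast
  then show False using disjoint_neighbourhoods[OF V(1,2) assms(1) c x(1) y(1) _ V(3-5) z x(2) y(2)] by blast
qed

lemma degree_sum:
  assumes "v \<in> V"
  shows "degree G v = (\<Sum>u\<in>V - {v}. mult G v u)"
proof -
  have "{e \<in> E. v \<in> inc G e} = (\<Union>u\<in>V - {v}. {e \<in> E. inc G e = {v, u}})"
  proof (intro equalityI subsetI)
    fix e assume "e \<in> {e \<in> E. v \<in> inc G e}"
    then have e: "e \<in> E" "v \<in> inc G e" by auto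
    obtain w where "inc G e = {v, w}" "w \<noteq> v" "w \<in> V" using edge_pair[OF e] by metis
    then show "e \<in> (\<Union>u\<in>V - {v}. {e \<in> E. inc G e = {v, u}})" using e(1) by blast
  qed auto
  moreover have "card (\<Union>u\<in>V - {v}. {e \<in> E. inc G e = {v, u}}) = (\<Sum>u\<in>V - {v}. card {e \<in> E. inc G e = {v, u}})"
    by (rule card_UN_disjoint) (use finV finE in \<open>auto simp: doubleton_eq_iff\<close>)
  ultimately show ?thesis unfolding degree_def mult_def by simp
qed

section \<open>Blocks without a connected pair deletion are complete or cycles\<close>

lemma conn_minusE:
  assumes "conn_minus R" "A \<subseteq> V - R" "A \<noteq> {}" "A \<noteq> V - R"
  obtains e p q where "e \<in> E" "p \<in> inc G e" "p \<in> A" "q \<in> inc G e" "q \<in> V - R - A"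
  using assms(1)[unfolded conn_minus_def, rule_format, OF assms(2-4)] that by blast

lemma block_cross:
  assumes "v \<in> V" "A \<subseteq> V - {v}" "A \<noteq> {}" "c \<in> V" "c \<noteq> v" "c \<notin> A"
  obtains p q where "p \<in> A" "q \<in> V" "q \<noteq> v" "q \<notin> A" "adj p q"
proof -
  have "A \<noteq> V - {v}" using assms by blast
  then obtain e p q where e: "e \<in> E" "p \<in> inc G e" "p \<in> A" "q \<in> inc G e" "q \<in> V - {v} - A"
    using conn_minusE[OF block[OF assms(1)] assms(2,3)] by blast
  obtain q' where "inc G e = {p, q'}" "adj p q'" using edge_pair[OF e(1,2)] by metis
  then have "adj p q" using e by auto
  then show ?thesis using that e by blast
qed

definition sep :: "'v \<Rightarrow> 'v \<Rightarrow> 'v set \<Rightarrow> 'v set \<Rightarrow> bool" where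
  "sep u w A B \<longleftrightarrow> A \<union> B = V - {u, w} \<and> A \<inter> B = {} \<and> A \<noteq> {} \<and> B \<noteq> {} \<and>
     (\<forall>p\<in>A. \<forall>q\<in>B. \<not> adj p q)"

lemma sep_sym: "sep u w A B \<Longrightarrow> sep u w B A"
  unfolding sep_def using adj_sym by blast

lemma sep_exists:
  assumes "u \<noteq> w" "\<not> adj u w" "adj r u" "adj r w"
  obtains A B where "sep u w A B"
proof -
  obtain A where A: "A \<subseteq> V - {u, w}" "A \<noteq> {}" "A \<noteq> V - {u, w}"
    "\<not> (\<exists>e\<in>E. inc G e \<inter> A \<noteq> {} \<and> inc G e \<inter> (V - {u, w} - A) \<noteq> {})"
    using not_conn_minus_pair[OF assms] unfolding conn_minus_def by blast
  have "sep u w A (V - {u, w} - A)"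
    unfolding sep_def adj_def using A by (intro conjI ballI notI) blast+
  then show ?thesis using that by blast
qed

text \<open>The vertices \<open>a\<close>, \<open>b\<close> are non-adjacent with common neighbour
  \<open>u\<close>, so they separate as well. If \<open>w\<close> were on the side of
  \<open>u\<close>, the other side \<open>Q\<close> could be left within \<open>A\<close> only
  through \<open>a\<close> and within \<open>B\<close> only through \<open>b\<close>, and one of
  these would be a cut vertex.\<close>

lemma sep_opposite:
  assumes s: "sep u w A B" and uw: "u \<in> V" "w \<in> V" "u \<noteq> w"
    and a: "a \<in> A" "adj u a" and b: "b \<in> B" "adj u b"
  obtains P Q where "sep a b P Q" "u \<in> P" "w \<in> Q"
proof -
  have ab: "a \<in> V" "b \<in> V" "a \<noteq> b" "\<not> adj a b" "a \<noteq> u" "a \<noteq> w" "b \<noteq> u" "b \<noteq> w"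
    using s a b unfolding sep_def by blast+
  obtain P0 Q0 where "sep a b P0 Q0" using sep_exists[OF ab(3,4) a(2) b(2)] .
  moreover from this have "u \<in> P0 \<or> u \<in> Q0" using uw ab unfolding sep_def by blast
  ultimately obtain P Q where PQ: "sep a b P Q" "u \<in> P" using sep_sym by blast
  have "w \<in> Q"
  proof (rule ccontr)
    assume "w \<notin> Q"
    then have w: "w \<in> P" using PQ(1) uw(2) ab(6,8) unfolding sep_def by blast
    have Q: "Q \<subseteq> A \<union> B" "u \<notin> Q" "w \<notin> Q" "a \<notin> Q" "b \<notin> Q"
      using PQ w s unfolding sep_def by blast+
    have nbr: "q \<in> Q \<or> q = a \<or> q = b" if "p \<in> Q" "adj p q" for p q
      using sep_sym[OF PQ(1)] adj_V that unfolding sep_def by blast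
    have sA: "q \<in> A \<or> q = u \<or> q = w" if "p \<in> A" "adj p q" for p q
      using s adj_V that unfolding sep_def by blast
    have sB: "q \<in> B \<or> q = u \<or> q = w" if "p \<in> B" "adj p q" for p q
      using sep_sym[OF s] adj_V that unfolding sep_def by blast
    have AB: "A \<inter> B = {}" "A \<subseteq> V" "B \<subseteq> V" using s unfolding sep_def by blast+
    show False
    proof (cases "Q \<inter> A = {}")
      case False
      have "Q \<inter> A \<subseteq> V - {a}" "u \<noteq> a" "u \<notin> Q \<inter> A" using Q(2,4,5) AB(2,3) ab by blast+
      then obtain p q where pq: "p \<in> Q \<inter> A" "q \<in> V" "q \<noteq> a" "q \<notin> Q \<inter> A" "adj p q"
        using block_cross[OF ab(1) _ False uw(1)] by metis
      have "q \<in> Q \<or> q = a \<or> q = b" "q \<in> A \<or> q = u \<or> q = w"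
        using nbr[of p q] sA[of p q] pq(1,5) by blast+
      moreover have "b \<notin> A" using b(1) AB(1) by blast
      ultimately show False using pq(3,4) Q(2,3) ab(7,8) by auto
    next
      case True
      then have ne: "Q \<inter> B \<noteq> {}" using Q(1) PQ(1) unfolding sep_def by blast
      have "Q \<inter> B \<subseteq> V - {b}" "u \<noteq> b" "u \<notin> Q \<inter> B" using Q(2,4,5) AB(2,3) ab by blast+
      then obtain p q where pq: "p \<in> Q \<inter> B" "q \<in> V" "q \<noteq> b" "q \<notin> Q \<inter> B" "adj p q"
        using block_cross[OF ab(2) _ ne uw(1)] by metis
      have "q \<in> Q \<or> q = a \<or> q = b" "q \<in> B \<or> q = u \<or> q = w"
        using nbr[of p q] sB[of p q] pq(1,5) by blast+
      moreover have "a \<notin> B" using a(1) AB(1) by blast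
      ultimately show False using pq(3,4) Q(2,3) ab(5,6) by auto
    qed
  qed
  then show ?thesis using that PQ by blast
qed

text \<open>With two neighbours \<open>a\<close>, \<open>a'\<close> of \<open>u\<close> in
  \<open>A\<close>, the pairs \<open>{a, b}\<close> and \<open>{a', b}\<close> both separate
  \<open>u\<close> from \<open>w\<close>. Uncrossing the two separations inside \<open>A\<close>
  yields a nonempty set that can be left only through \<open>u\<close>, contrary to \<open>u\<close>
  not being a cut vertex.\<close>

lemma sep_unique_neighbour:
  assumes s: "sep u w A B" and uw: "u \<in> V" "w \<in> V" "u \<noteq> w"
    and a: "a \<in> A" "adj u a" and a': "a' \<in> A" "adj u a'" and b: "b \<in> B" "adj u b"
  shows "a = a'"
proof (rule ccontr)
  assume ne: "a \<noteq> a'"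
  obtain P Q where PQ: "sep a b P Q" "u \<in> P" "w \<in> Q" using sep_opposite[OF s uw a b] .
  obtain P' Q' where PQ': "sep a' b P' Q'" "u \<in> P'" "w \<in> Q'" using sep_opposite[OF s uw a' b] .
  have AB: "A \<inter> B = {}" "A \<subseteq> V" "B \<subseteq> V" "u \<notin> A" "w \<notin> A" "b \<notin> A" "b \<noteq> w"
    using s b(1) unfolding sep_def by blast+
  have sA: "q \<in> A \<or> q = u \<or> q = w" if "p \<in> A" "adj p q" for p q
    using s adj_V that unfolding sep_def by blast
  have nP: "q \<in> P \<or> q = a \<or> q = b" if "p \<in> P" "adj p q" for p q
    using PQ(1) adj_V that unfolding sep_def by blast
  have nQ: "q \<in> Q \<or> q = a \<or> q = b" if "p \<in> Q" "adj p q" for p q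
    using sep_sym[OF PQ(1)] adj_V that unfolding sep_def by blast
  have nP': "q \<in> P' \<or> q = a' \<or> q = b" if "p \<in> P'" "adj p q" for p q
    using PQ'(1) adj_V that unfolding sep_def by blast
  have nQ': "q \<in> Q' \<or> q = a' \<or> q = b" if "p \<in> Q'" "adj p q" for p q
    using sep_sym[OF PQ'(1)] adj_V that unfolding sep_def by blast
  have d: "P \<inter> Q = {}" "P' \<inter> Q' = {}" "a \<notin> P" "a \<notin> Q" "a' \<notin> P'" "a' \<notin> Q'"
    "V \<subseteq> P \<union> Q \<union> {a, b}" "V \<subseteq> P' \<union> Q' \<union> {a', b}"
    using PQ(1) PQ'(1) unfolding sep_def by blast+
  have bu: "b \<noteq> u" using b(2) unfolding adj_def by blast
  have a'P: "a' \<in> P" using nP[OF PQ(2) a'(2)] ne a'(1) AB by blast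
  have aP': "a \<in> P'" using nP'[OF PQ'(2) a(2)] ne a(1) AB by blast
  have aV: "a \<in> V" "a' \<in> V" "a \<noteq> u" "a' \<noteq> u" using a a' AB by blast+
  \<comment> \<open>The only exit from this corner is \<open>a\<close>, so a nonempty corner would
    make \<open>a\<close> a cut vertex; \<open>W2\<close> is the mirror image with
    \<open>a'\<close>.\<close>
  have W1: "Q \<inter> P' \<inter> A = {}"
  proof (rule ccontr)
    assume ne: "Q \<inter> P' \<inter> A \<noteq> {}"
    have "Q \<inter> P' \<inter> A \<subseteq> V - {a}" "u \<noteq> a" "u \<notin> Q \<inter> P' \<inter> A" using d(4,6) AB(2,4) aV by blast+
    then obtain p q where pq: "p \<in> Q \<inter> P' \<inter> A" "q \<noteq> a" "q \<notin> Q \<inter> P' \<inter> A" "adj p q"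
      using block_cross[OF aV(1) _ ne uw(1)] by metis
    have q: "q \<in> A \<or> q = u \<or> q = w" using sA pq by blast
    then have qb: "q \<noteq> b" using AB(6,7) bu by blast
    have "q \<in> Q" using nQ[of p q] pq qb by blast
    then have "q \<noteq> a'" "q \<noteq> u" using a'P d(1) PQ(2) by blast+
    then have "q \<in> P'" using nP'[of p q] pq qb by blast
    then have "q \<noteq> w" using d(2) PQ'(3) by blast
    then show False using q pq(3) \<open>q \<in> Q\<close> \<open>q \<in> P'\<close> \<open>q \<noteq> u\<close> by blast
  qed
  have W2: "Q' \<inter> P \<inter> A = {}"
  proof (rule ccontr)
    assume ne: "Q' \<inter> P \<inter> A \<noteq> {}"
    have "Q' \<inter> P \<inter> A \<subseteq> V - {a'}" "u \<noteq> a'" "u \<notin> Q' \<inter> P \<inter> A" using d(4,6) AB(2,4) aV by blast+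
    then obtain p q where pq: "p \<in> Q' \<inter> P \<inter> A" "q \<noteq> a'" "q \<notin> Q' \<inter> P \<inter> A" "adj p q"
      using block_cross[OF aV(2) _ ne uw(1)] by metis
    have q: "q \<in> A \<or> q = u \<or> q = w" using sA pq by blast
    then have qb: "q \<noteq> b" using AB(6,7) bu by blast
    have "q \<in> Q'" using nQ'[of p q] pq qb by blast
    then have "q \<noteq> a" "q \<noteq> u" using aP' d(2) PQ'(2) by blast+
    then have "q \<in> P" using nP[of p q] pq qb by blast
    then have "q \<noteq> w" using d(1) PQ(3) by blast
    then show False using q pq(3) \<open>q \<in> Q'\<close> \<open>q \<in> P\<close> \<open>q \<noteq> u\<close> by blast
  qed
  \<comment> \<open>The corner of \<open>A\<close> on the side of \<open>u\<close> in both
    separations, together with \<open>a\<close> and \<open>a'\<close>; as the mixed corners are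
    empty, nothing but \<open>u\<close> adjoins it.\<close>
  define W where "W = (P \<union> {a}) \<inter> (P' \<union> {a'}) \<inter> A"
  have "a \<in> W" using aP' a(1) unfolding W_def by blast
  then have ne: "W \<noteq> {}" by blast
  have "W \<subseteq> V - {u}" "w \<noteq> u" "w \<notin> W" using AB uw(3) unfolding W_def by blast+
  then obtain p q where pq: "p \<in> W" "q \<noteq> u" "q \<notin> W" "adj p q"
    using block_cross[OF uw(1) _ ne uw(2)] by metis
  have pA: "p \<in> A" using pq unfolding W_def by blast
  have q: "q \<in> A \<or> q = w" using sA[OF pA pq(4)] pq(2) by blast
  then have qb: "q \<noteq> b" using AB by blast
  have qp: "q \<noteq> p" using pq(4) unfolding adj_def by blast
  consider "p = a" | "p = a'" | "p \<in> P" "p \<in> P'" using pq(1) unfolding W_def by blast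
  then show False
  proof cases
    case 1
    then have q': "q \<in> P' \<or> q = a'" using nP'[of p q] aP' pq(4) qb by blast
    then have "q \<in> A" using q PQ'(3) d a' AB by blast
    moreover have "q \<in> P \<or> q \<in> Q" using d(7) AB(2) \<open>q \<in> A\<close> qb qp 1 by blast
    ultimately show False using q' W1 a'P d pq(3) unfolding W_def by blast
  next
    case 2
    then have q': "q \<in> P \<or> q = a" using nP[of p q] a'P pq(4) qb by blast
    then have "q \<in> A" using q PQ(3) d a AB by blast
    moreover have "q \<in> P' \<or> q \<in> Q'" using d(8) AB(2) \<open>q \<in> A\<close> qb qp 2 by blast
    ultimately show False using q' W2 aP' d pq(3) unfolding W_def by blast
  next
    case 3
    then have "q \<in> P \<or> q = a" "q \<in> P' \<or> q = a'" using nP[of p q] nP'[of p q] pq(4) qb by blast+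
    then show False using q pq(3) PQ(3) d a AB unfolding W_def by blast
  qed
qed

text \<open>Non-adjacency of the two neighbours lets the property spread along edges, since they
  form a new non-adjacent pair with a common neighbour; it also excludes triangles, which count as
  complete.\<close>

definition two_nbrs :: "'v \<Rightarrow> bool" where
  "two_nbrs u \<longleftrightarrow> (\<exists>a b. a \<noteq> b \<and> \<not> adj a b \<and> {c. adj u c} = {a, b})"

text \<open>The pair \<open>{u, w}\<close> separates. Each side contains a neighbour of
  \<open>u\<close>, since otherwise \<open>w\<close> alone would cut it off, and by uncrossing it
  contains only one.\<close>

lemma two_nbrs_if:
  assumes "u \<noteq> w" "\<not> adj u w" "adj r u" "adj r w"
  shows "two_nbrs u"
proof -
  have uw: "u \<in> V" "w \<in> V" using assms adj_V by blast+
  obtain A B where s: "sep u w A B" using sep_exists[OF assms] .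
  have side: "\<exists>a\<in>A. adj u a" if s: "sep u w A B" for A B
  proof -
    have A: "A \<noteq> {}" "A \<subseteq> V - {w}" "u \<notin> A" "\<forall>p\<in>A. \<forall>q\<in>B. \<not> adj p q" "V \<subseteq> A \<union> B \<union> {u, w}"
      using s unfolding sep_def by blast+
    obtain p q where "p \<in> A" "q \<in> V" "q \<noteq> w" "q \<notin> A" "adj p q"
      using block_cross[OF uw(2) A(2,1) uw(1) assms(1) A(3)] .
    then show ?thesis using A adj_sym by blast
  qed
  obtain a where a: "a \<in> A" "adj u a" using side[OF s] by blast
  obtain b where b: "b \<in> B" "adj u b" using side[OF sep_sym[OF s]] by blast
  have "a \<noteq> b" "\<not> adj a b" using s a b unfolding sep_def by blast+
  moreover have "{c. adj u c} = {a, b}"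
  proof (intro equalityI subsetI)
    fix c assume "c \<in> {c. adj u c}"
    then have c: "adj u c" by blast
    then have "c \<in> V" "c \<noteq> u" "c \<noteq> w" using adj_V assms(2) unfolding adj_def by blast+
    moreover have "A \<union> B = V - {u, w}" using s unfolding sep_def by blast
    ultimately have "c \<in> A \<or> c \<in> B" by blast
    then show "c \<in> {a, b}"
      using sep_unique_neighbour[OF s uw assms(1) a _ c b]
        sep_unique_neighbour[OF sep_sym[OF s] uw assms(1) b _ c a] by blast
  qed (use a b in auto)
  ultimately show ?thesis unfolding two_nbrs_def by blast
qed

lemma adj_closed:
  assumes "D \<subseteq> V" "D \<noteq> {}" "\<And>p q. p \<in> D \<Longrightarrow> adj p q \<Longrightarrow> q \<in> D"
  shows "D = V"
proof (rule ccontr)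
  assume "D \<noteq> V"
  then obtain e p q where e: "e \<in> E" "p \<in> inc G e" "p \<in> D" "q \<in> inc G e" "q \<in> V - D"
    using conn assms(1,2) unfolding cut_connected_def by blast
  obtain q' where "inc G e = {p, q'}" "adj p q'" using edge_pair[OF e(1,2)] by metis
  then show False using e assms(3)[of p q'] by auto
qed

text \<open>If \<open>u\<close> is not adjacent to everything, connectivity provides a vertex
  \<open>q\<close> at distance two, so \<open>u\<close> has exactly two neighbours. These are
  non-adjacent with common neighbour \<open>u\<close>, so the property reaches them and, by
  connectivity, all vertices.\<close>

lemma complete_or_two_nbrs:
  "(\<forall>u\<in>V. \<forall>v\<in>V. u \<noteq> v \<longrightarrow> adj u v) \<or> (\<forall>u\<in>V. two_nbrs u)"
proof (rule disjCI)
  assume "\<not> (\<forall>u\<in>V. two_nbrs u)"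
  show "\<forall>u\<in>V. \<forall>v\<in>V. u \<noteq> v \<longrightarrow> adj u v"
  proof (rule ccontr)
    assume "\<not> ?thesis"
    then obtain u v where uv: "u \<in> V" "v \<in> V" "u \<noteq> v" "\<not> adj u v" by blast
    have "v \<notin> insert u {c. adj u c}" using uv(3,4) by simp
    then have "insert u {c. adj u c} \<noteq> V" using uv(2) by blast
    then obtain p q where pq: "p \<in> insert u {c. adj u c}" "adj p q" "q \<notin> insert u {c. adj u c}"
      using adj_closed[of "insert u {c. adj u c}"] uv(1) adj_V by blast
    then have "two_nbrs u" using two_nbrs_if[of u q p] adj_sym by blast
    moreover have "two_nbrs q" if "p \<in> V" "two_nbrs p" "adj p q" for p q
    proof -
      obtain a b where ab: "a \<noteq> b" "\<not> adj a b" "{c. adj p c} = {a, b}"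
        using \<open>two_nbrs p\<close> unfolding two_nbrs_def by blast
      then have "adj p a" "adj p b" "q = a \<or> q = b" using \<open>adj p q\<close> by auto
      then show ?thesis using two_nbrs_if[of a b p] two_nbrs_if[of b a p] ab adj_sym by metis
    qed
    ultimately have "{u \<in> V. two_nbrs u} = V"
      using uv(1) adj_V by (intro adj_closed) blast+
    then show False using \<open>\<not> (\<forall>u\<in>V. two_nbrs u)\<close> by blast
  qed
qed

end

section \<open>Complete blocks give K-configurations\<close>

locale complete_block = block_graph +
  assumes complete: "\<And>u v. u \<in> verts G \<Longrightarrow> v \<in> verts G \<Longrightarrow> u \<noteq> v \<Longrightarrow> adj u v"
begin

lemma conn_minus_any: "conn_minus R"
  unfolding conn_minus_def
proof (intro allI impI)
  fix A assume A: "A \<subseteq> V - R" "A \<noteq> {}" "A \<noteq> V - R"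
  then obtain p q where pq: "p \<in> A" "q \<in> V - R - A" by blast
  then have "adj p q" using complete[of p q] A(1) by blast
  then obtain e where "e \<in> E" "inc G e = {p, q}" unfolding adj_def by blast
  then show "\<exists>e\<in>E. inc G e \<inter> A \<noteq> {} \<and> inc G e \<inter> (V - R - A) \<noteq> {}" using pq by blast
qed

text \<open>No deletion disconnects a complete graph, so two non-adjacent colours cannot have a
  common neighbour at a third vertex. Adjacency of colours is thus transitive over three distinct
  vertices, which is the origin of the multipartite classes.\<close>

lemma nb_triangle:
  assumes "u \<in> V" "w \<in> V" "r \<in> V" "u \<noteq> w" "r \<noteq> u" "r \<noteq> w" "x \<in> X u" "y \<in> X w" "z \<in> X r" "nb z x" "nb z y"
  shows "nb x y"
  using disjoint_neighbourhoods[OF assms(1,2,4) conn_minus_any assms(7,8) _ assms(3,5,6,9-11)] by blast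

text \<open>The two multiplicities count the neighbours in \<open>X w\<close> of adjacent colours
  \<open>z\<close> and \<open>x\<close>, and by transitivity every neighbour of \<open>z\<close> is
  one of \<open>x\<close>.\<close>

lemma mult_le:
  assumes "u \<in> V" "w \<in> V" "r \<in> V" "u \<noteq> w" "r \<noteq> u" "r \<noteq> w"
  shows "mult G r w \<le> mult G u w"
proof -
  have a: "adj r u" using complete assms by blast
  obtain z where z: "z \<in> X r" using X_nonempty[OF a] by blast
  obtain x where x: "x \<in> X u" "nb z x" using N_nonempty[OF a z] .
  have "N z w \<subseteq> N x w"
    using nb_triangle[OF assms x(1) _ z x(2)] unfolding N_def by blast
  then have "card (N z w) \<le> card (N x w)" using finN[OF assms(2)] by (intro card_mono)
  then show ?thesis using card_N assms z x(1) by simp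
qed

lemma mult_eq:
  assumes "u \<in> V" "w \<in> V" "r \<in> V" "u \<noteq> w" "r \<noteq> w"
  shows "mult G r w = mult G u w"
proof (cases "r = u")
  case False
  then show ?thesis using mult_le[of u w r] mult_le[of r w u] assms by simp
qed simp

lemma mult_const: "\<exists>t\<ge>1. \<forall>u\<in>V. \<forall>v\<in>V. u \<noteq> v \<longrightarrow> mult G u v = t"
proof (cases "\<exists>u\<in>V. \<exists>v\<in>V. u \<noteq> v")
  case True
  then obtain a b where ab: "a \<in> V" "b \<in> V" "a \<noteq> b" by blast
  have 1: "mult G u b = mult G a b" if "u \<in> V" "u \<noteq> b" for u using mult_eq ab that by blast
  have "mult G u v = mult G a b" if uv: "u \<in> V" "v \<in> V" "u \<noteq> v" for u v
  proof (cases "v = b")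
    case False
    have "mult G u v = mult G b v" using mult_eq[of b v u] uv ab False by blast
    also have "\<dots> = mult G v b" by (rule mult_sym)
    finally show ?thesis using 1[OF uv(2) False] by simp
  qed (use 1 uv in blast)
  moreover have "mult G a b \<ge> 1" using complete[OF ab] mult_pos by blast
  ultimately show ?thesis by blast
next
  case False
  \<comment> \<open>At most one vertex: there is no pair to constrain \<open>t\<close>, and 1 is as
    good as any value.\<close>
  then show ?thesis by (intro exI[of _ 1]) auto
qed

text \<open>Two triangles through the common neighbour \<open>x\<close> carry neighbours of
  \<open>z\<close> over to \<open>z'\<close> at every vertex but \<open>u\<close>. At
  \<open>u\<close> itself a common neighbour at a third vertex takes the place of
  \<open>x\<close>.\<close>

lemma N_eq:
  assumes z: "z \<in> X r" "z' \<in> X r" and x: "x \<in> X u" "nb z x" "nb z' x" and V: "u \<in> V" "r \<in> V" "u \<noteq> r"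
    and w: "w \<in> V" "w \<noteq> r"
  shows "N z w = N z' w"
proof -
  have step: "nb z' y" if "z \<in> X r" "z' \<in> X r" "x \<in> X u" "nb z x" "nb z' x" "u \<in> V" "u \<noteq> r"
    "w \<in> V" "w \<noteq> r" "w \<noteq> u" "y \<in> X w" "nb z y" for z z' x u w y
  proof -
    have "nb x y"
      using nb_triangle[of u w r x y z] that V(2) by blast
    then show ?thesis
      using nb_triangle[of r w u z' y x] that V(2) nb_sym by blast
  qed
  have ne: "N z w = N z' w" if "x \<in> X u" "nb z x" "nb z' x" "u \<in> V" "u \<noteq> r" "w \<in> V" "w \<noteq> r" "w \<noteq> u"
    for x u w
    using step[OF z that(1-8)] step[OF z(2,1) that(1,3,2,4-8)] unfolding N_def by blast
  show ?thesis
  proof (cases "w = u")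
    case False
    then show ?thesis using ne[OF x V(1,3) w] by blast
  next
    case True
    show ?thesis
    proof (cases "\<exists>c\<in>V. c \<noteq> u \<and> c \<noteq> r")
      case True
      then obtain c where c: "c \<in> V" "c \<noteq> u" "c \<noteq> r" by blast
      have "adj r c" using complete[OF V(2) c(1)] c(3) by blast
      then obtain y where y: "y \<in> X c" "nb z y" using N_nonempty[OF _ z(1)] by blast
      then have "nb z' y" using step[OF z x V(1,3) c(1,3,2)] by blast
      then show ?thesis using ne[OF y _ c(1,3) V(1,3)] c(2) \<open>w = u\<close> by blast
    next
      case False
      \<comment> \<open>Only \<open>u\<close> and \<open>r\<close> exist. Then \<open>X u\<close>
        has just as many colours as there are edges between them, so every colour of
        \<open>r\<close> is adjacent to all of \<open>X u\<close>.\<close>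
      then have "V - {u} = {r}" using V by blast
      then have "card (X u) = mult G u r" using card_X[OF V(1)] degree_sum[OF V(1)] by simp
      then have "N a u = X u" if "a \<in> X r" for a
        using card_N[OF V(2,1) V(3)[symmetric] that] mult_sym finX[OF V(1)]
        by (intro card_seteq) (auto simp: N_def)
      then show ?thesis using z True by simp
    qed
  qed
qed

text \<open>Colours at a reference vertex \<open>v0\<close> are grouped by equal neighbourhoods; a
  class at \<open>v0\<close> together with its neighbourhoods elsewhere forms one multipartite
  graph. The list of \<open>v0\<close> has \<open>(n - 1) * t\<close> colours in groups of
  \<open>t\<close>, which gives the \<open>n - 1\<close> classes.\<close>

lemma K_configuration:
  assumes F: "feasible G X H" and ne: "V \<noteq> {}"
    and simple: "\<And>f g. f \<in> edges H \<Longrightarrow> g \<in> edges H \<Longrightarrow> inc H f = inc H g \<Longrightarrow> f = g"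
  shows "K_configuration G X H"
proof -
  obtain t where t: "t \<ge> 1" "\<And>u v. u \<in> V \<Longrightarrow> v \<in> V \<Longrightarrow> u \<noteq> v \<Longrightarrow> mult G u v = t"
    using mult_const by blast
  obtain v0 where v0: "v0 \<in> V" using ne by blast
  let ?n = "card V"
  have n: "?n \<ge> 1" using ne finV by (simp add: Suc_le_eq card_gt_0_iff)
  have cardX: "card (X v0) = (?n - 1) * t"
  proof -
    have "card (X v0) = (\<Sum>u\<in>V - {v0}. mult G v0 u)" using card_X degree_sum v0 by simp
    also have "\<dots> = (\<Sum>u\<in>V - {v0}. t)" using t(2)[OF v0] by (intro sum.cong) auto
    finally show ?thesis using v0 finV by simp
  qed
  define cls where "cls z = {z' \<in> X v0. \<forall>v\<in>V - {v0}. N z' v = N z v}" for z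
  define K where "K z v = (if v = v0 then cls z else N z v)" for z v
  have other: "\<exists>u. u \<in> V \<and> u \<noteq> v0" if "z \<in> X v0" for z
  proof (rule ccontr)
    assume "\<nexists>u. u \<in> V \<and> u \<noteq> v0"
    then have "V = {v0}" using v0 by blast
    then have "card (X v0) = 0" using cardX by simp
    then show False using that finX[OF v0] by auto
  qed
  have cls_self: "z \<in> cls z" if "z \<in> X v0" for z using that unfolding cls_def by blast
  \<comment> \<open>Identifying a class at \<open>v0\<close> with the neighbourhood of a colour
    elsewhere gives its size and makes \<open>v0\<close> behave like the other vertices.\<close>
  have cls_N: "cls z = N x v0" if z: "z \<in> X v0" and u: "u \<in> V" "u \<noteq> v0" and x: "x \<in> X u" "nb z x" for z u x
  proof (intro equalityI subsetI)
    fix z' assume "z' \<in> cls z"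
    then have "z' \<in> X v0" "N z' u = N z u" using u unfolding cls_def by blast+
    then show "z' \<in> N x v0" using x nb_sym unfolding N_def by blast
  next
    fix z' assume "z' \<in> N x v0"
    then have z': "z' \<in> X v0" "nb z' x" unfolding N_def using nb_sym by blast+
    then show "z' \<in> cls z"
      using N_eq[OF z'(1) z x(1) z'(2) x(2) u(1) v0 u(2)] unfolding cls_def by blast
  qed
  have cls_card: "card (cls z) = t" if z: "z \<in> X v0" for z
  proof -
    obtain u where u: "u \<in> V" "u \<noteq> v0" using other[OF z] by blast
    have "adj v0 u" using complete[OF v0 u(1)] u(2) by blast
    then obtain x where x: "x \<in> X u" "nb z x" using N_nonempty[OF _ z] by blast
    show ?thesis using cls_N[OF z u x] card_N[OF u(1) v0 u(2) x(1)] t(2)[OF u(1) v0 u(2)] by simp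
  qed
  have cls_eq: "cls z = cls z'" if "z' \<in> cls z" for z z' using that unfolding cls_def by auto
  let ?C = "cls ` X v0"
  have "?n - 1 = card ?C"
  proof -
    have "card (\<Union>?C) = t * card ?C"
    proof (rule card_partition[symmetric])
      show "finite ?C" "finite (\<Union>?C)" using finX[OF v0] unfolding cls_def by auto
      show "c1 \<inter> c2 = {}" if "c1 \<in> ?C" "c2 \<in> ?C" "c1 \<noteq> c2" for c1 c2
        using that cls_eq by blast
    qed (use cls_card in auto)
    moreover have "\<Union>?C = X v0" using cls_self unfolding cls_def by blast
    ultimately have "(?n - 1) * t = card ?C * t" using cardX by (simp add: mult.commute)
    then show ?thesis using t(1) by simp
  qed
  then have "card {1..<?n} = card ?C" by simp
  then obtain h where h: "bij_betw h {1..<?n} ?C"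
    using finite_same_card_bij[of "{1..<?n}" ?C] finX[OF v0] by blast
  have "\<forall>i\<in>{1..<?n}. \<exists>z. z \<in> X v0 \<and> h i = cls z" using h unfolding bij_betw_def by blast
  \<comment> \<open>The colour \<open>\<rho> i\<close> represents the class with index
    \<open>i\<close> at \<open>v0\<close>; its neighbourhoods define the class with index
    \<open>i\<close> at all other vertices.\<close>
  from bchoice[OF this] obtain \<rho> where \<rho>: "\<forall>i\<in>{1..<?n}. \<rho> i \<in> X v0 \<and> h i = cls (\<rho> i)" ..
  define P where "P v i = K (\<rho> i) v" for v i
  have ex_index: "\<exists>i\<in>{1..<?n}. z \<in> cls (\<rho> i)" if "z \<in> X v0" for z
  proof -
    have "cls z \<in> h ` {1..<?n}" using h that unfolding bij_betw_def by blast
    then obtain i where "i \<in> {1..<?n}" "cls z = h i" by blast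
    then show ?thesis using \<rho> cls_self[OF that] by auto
  qed
  have index_inj: "i = j" if "i \<in> {1..<?n}" "j \<in> {1..<?n}" "cls (\<rho> i) = cls (\<rho> j)" for i j
  proof -
    have "h i = h j" using that \<rho> by metis
    then show ?thesis using inj_onD[OF bij_betw_imp_inj_on[OF h]] that(1,2) by blast
  qed
  have P_sub: "P v i \<subseteq> X v" for v i unfolding P_def K_def cls_def N_def by auto
  have P_card: "card (P v i) = t" if "i \<in> {1..<?n}" "v \<in> V" for v i
    using \<rho> that cls_card card_N[OF v0 that(2)] t(2)[OF v0 that(2)] unfolding P_def K_def by auto
  have P_part: "indexed_partition {1..<?n} (P v) (X v)" if v: "v \<in> V" for v
  proof (cases "v = v0")
    case True
    have "P v0 i \<inter> P v0 j = {}" if "i \<in> {1..<?n}" "j \<in> {1..<?n}" "i \<noteq> j" for i j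
    proof -
      have "cls (\<rho> i) \<inter> cls (\<rho> j) = {}"
      proof (rule ccontr)
        assume "cls (\<rho> i) \<inter> cls (\<rho> j) \<noteq> {}"
        then obtain y where "y \<in> cls (\<rho> i)" "y \<in> cls (\<rho> j)" by blast
        then have "cls (\<rho> i) = cls (\<rho> j)" using cls_eq by metis
        then show False using index_inj[OF that(1,2)] that(3) by blast
      qed
      then show ?thesis unfolding P_def K_def by simp
    qed
    moreover have "(\<Union>i\<in>{1..<?n}. P v0 i) = X v0"
      using ex_index P_sub[of v0] unfolding P_def K_def by (auto simp: subset_iff)
    ultimately show ?thesis
      using True unfolding indexed_partition_def disjoint_family_on_def by blast
  next
    case False
    have "y \<in> (\<Union>i\<in>{1..<?n}. P v i)" if y: "y \<in> X v" for y
    proof -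
      have "adj v v0" using complete v v0 False by blast
      then obtain z where z: "z \<in> X v0" "nb y z" using N_nonempty[OF _ y] by blast
      then obtain i where i: "i \<in> {1..<?n}" "z \<in> cls (\<rho> i)" using ex_index by blast
      then have "N z v = N (\<rho> i) v" using v False unfolding cls_def by blast
      moreover have "y \<in> N z v" using y z(2) nb_sym unfolding N_def by blast
      ultimately show ?thesis using i(1) False unfolding P_def K_def by auto
    qed
    moreover have "i = j" if "i \<in> {1..<?n}" "j \<in> {1..<?n}" "y \<in> P v i" "y \<in> P v j" for i j y
    proof -
      have y: "y \<in> X v" "nb (\<rho> i) y" "nb (\<rho> j) y" using that False unfolding P_def K_def N_def by auto
      have "\<rho> i \<in> X v0" "\<rho> j \<in> X v0" using \<rho> that by blast+
      then have "cls (\<rho> i) = cls (\<rho> j)"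
        using cls_N[OF _ v False y(1)] y(2,3) by metis
      then show ?thesis using index_inj that(1,2) by blast
    qed
    ultimately show ?thesis
      using P_sub unfolding indexed_partition_def disjoint_family_on_def by blast
  qed
  \<comment> \<open>The reference vertex needs its own cases because its class is an equivalence
    class; between two other vertices the representative \<open>\<rho> i\<close> closes a
    triangle.\<close>
  have P_nb: "nb x y" if i: "i \<in> {1..<?n}" and uw: "u \<in> V" "w \<in> V" "u \<noteq> w" and xy: "x \<in> P u i" "y \<in> P w i" for i u w x y
  proof -
    have \<rho>i: "\<rho> i \<in> X v0" using \<rho> i by blast
    have cl: "nb x y" if "w \<in> V" "w \<noteq> v0" "x \<in> cls (\<rho> i)" "y \<in> N (\<rho> i) w" for w x y
    proof -
      have "N x w = N (\<rho> i) w" using that(1-3) unfolding cls_def by blast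
      then show ?thesis using that(4) unfolding N_def by blast
    qed
    consider "u = v0" | "w = v0" | "u \<noteq> v0" "w \<noteq> v0" by blast
    then show ?thesis
    proof cases
      case 1 then show ?thesis using cl[of w x y] uw xy unfolding P_def K_def by simp
    next
      case 2 then show ?thesis using cl[of u y x] uw xy nb_sym unfolding P_def K_def by simp
    next
      case 3
      then have "x \<in> X u" "nb (\<rho> i) x" "y \<in> X w" "nb (\<rho> i) y" using xy unfolding P_def K_def N_def by auto
      then show ?thesis using nb_triangle[OF uw(1,2) v0 uw(3) _ _ _ _ \<rho>i] 3 by metis
    qed
  qed
  have nb_P: "y \<in> P w i" if i: "i \<in> {1..<?n}" and uw: "u \<in> V" "w \<in> V" "u \<noteq> w"
    and xy: "x \<in> P u i" "y \<in> X w" "nb x y" for i u w x y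
  proof -
    have \<rho>i: "\<rho> i \<in> X v0" using \<rho> i by blast
    consider "u = v0" | "w = v0" | "u \<noteq> v0" "w \<noteq> v0" by blast
    then show ?thesis
    proof cases
      case 1
      then have "x \<in> cls (\<rho> i)" using xy unfolding P_def K_def by simp
      then have "N x w = N (\<rho> i) w" using uw 1 unfolding cls_def by blast
      then show ?thesis using xy 1 uw unfolding P_def K_def N_def by auto
    next
      case 2
      then have x: "x \<in> X u" "nb (\<rho> i) x" using xy uw unfolding P_def K_def N_def by auto
      have "cls (\<rho> i) = N x v0" using cls_N[OF \<rho>i uw(1) _ x] uw(3) 2 by blast
      then show ?thesis using xy 2 unfolding P_def K_def N_def by auto
    next
      case 3
      then have x: "x \<in> X u" "nb x (\<rho> i)" using xy nb_sym unfolding P_def K_def N_def by auto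
      have "nb (\<rho> i) y" using nb_triangle[OF v0 uw(2,1) _ _ uw(3) \<rho>i xy(2) x(1) x(2) xy(3)] 3 by blast
      then show ?thesis using xy(2) 3 unfolding P_def K_def N_def by simp
    qed
  qed
  have P_unique: "u = w" if "u \<in> V" "w \<in> V" "x \<in> P u i" "x \<in> P w j" for u w x i j
    using X_unique P_sub that by blast
  have P_ne: "P v i \<noteq> {}" if "i \<in> {1..<?n}" "v \<in> V" for v i using P_card[OF that] t(1) by auto
  let ?Y = "\<lambda>i. \<Union>v\<in>V. P v i"
  have edge_i: "\<exists>i\<in>{1..<?n}. f \<in> edges (induced H (?Y i))" if f: "f \<in> edges H" for f
  proof -
    obtain u v x y where uv: "u \<in> V" "v \<in> V" "u \<noteq> v" "x \<in> X u" "y \<in> X v" "inc H f = {x, y}"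
      using edge_H_pair[OF f] by metis
    obtain i where i: "i \<in> {1..<?n}" "x \<in> P u i" using P_part[OF uv(1)] uv(4) unfolding indexed_partition_def by blast
    have "nb x y" unfolding nb_def using f uv(6) by blast
    then have "y \<in> P v i" using nb_P[OF i(1) uv(1-3) i(2) uv(5)] by blast
    then show ?thesis using f uv i by auto
  qed
  have mp: "is_K_multipartite ?n t ((\<lambda>v. P v i) ` V) (induced H (?Y i))" if i: "i \<in> {1..<?n}" for i
    unfolding is_K_multipartite_def is_tfold_def
  proof (intro conjI ballI)
    show "finite ((\<lambda>v. P v i) ` V)" using finV by simp
    have "inj_on (\<lambda>v. P v i) V"
    proof (rule inj_onI)
      fix u w assume uw: "u \<in> V" "w \<in> V" "P u i = P w i"
      then show "u = w" using P_ne[OF i uw(1)] P_unique[OF uw(1,2)] by blast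
    qed
    then show "card ((\<lambda>v. P v i) ` V) = ?n" by (rule card_image)
    show "disjoint ((\<lambda>v. P v i) ` V)"
      unfolding disjoint_def using P_unique by blast
    show "finite p" if "p \<in> (\<lambda>v. P v i) ` V" for p
      using that P_sub finX finite_subset by blast
    show "card p = t" if "p \<in> (\<lambda>v. P v i) ` V" for p
      using that P_card[OF i] by blast
    show "verts (induced H (?Y i)) = \<Union>((\<lambda>v. P v i) ` V)" by simp
    show "inc (induced H (?Y i)) f \<in> {{x, y} |x y p q. p \<in> (\<lambda>v. P v i) ` V \<and> q \<in> (\<lambda>v. P v i) ` V \<and>
      p \<noteq> q \<and> x \<in> p \<and> y \<in> q}" if "f \<in> edges (induced H (?Y i))" for f
    proof -
      have f: "f \<in> edges H" "inc H f \<subseteq> ?Y i" using that by auto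
      obtain u v x y where uv: "u \<in> V" "v \<in> V" "u \<noteq> v" "x \<in> X u" "y \<in> X v" "inc H f = {x, y}"
        using edge_H_pair[OF f(1)] by metis
      have "x \<in> ?Y i" "y \<in> ?Y i" using f(2) uv(6) by auto
      then obtain u' v' where "u' \<in> V" "x \<in> P u' i" "v' \<in> V" "y \<in> P v' i" by blast
      moreover from this have "u' = u" "v' = v"
        using X_unique[of x u' u] X_unique[of y v' v] P_sub uv(1,2,4,5) by blast+
      ultimately have "x \<in> P u i" "y \<in> P v i" by simp_all
      moreover have "P u i \<noteq> P v i" using P_unique[OF uv(1,2)] uv(3) calculation by blast
      moreover have "P u i \<in> (\<lambda>v. P v i) ` V" "P v i \<in> (\<lambda>v. P v i) ` V" using uv(1,2) by blast+
      ultimately show ?thesis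
        unfolding induced_simps uv(6)
        by (intro CollectI exI[of _ x] exI[of _ y] exI[of _ "P u i"] exI[of _ "P v i"] conjI refl)
    qed
    show "card {f \<in> edges (induced H (?Y i)). inc (induced H (?Y i)) f = a} = 1"
      if a0: "a \<in> {{x, y} |x y p q. p \<in> (\<lambda>v. P v i) ` V \<and> q \<in> (\<lambda>v. P v i) ` V \<and> p \<noteq> q \<and> x \<in> p \<and> y \<in> q}" for a
    proof -
      obtain x y u w where a: "a = {x, y}" "u \<in> V" "w \<in> V" "P u i \<noteq> P w i" "x \<in> P u i" "y \<in> P w i"
        using a0 by blast
      then have "nb x y" using P_nb[OF i] by metis
      then obtain f where f: "f \<in> edges H" "inc H f = a" unfolding nb_def a(1) by blast
      have "a \<subseteq> ?Y i" using a by blast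
      \<comment> \<open>The absence of parallel edges in \<open>H\<close> is what turns adjacency
        into multiplicity one.\<close>
      then have "{f \<in> edges (induced H (?Y i)). inc (induced H (?Y i)) f = a} = {f}"
        using f simple by auto
      then show ?thesis by simp
    qed
  qed
  have un: "is_union H ((\<lambda>i. induced H (?Y i)) ` {1..<?n})"
    unfolding is_union_def
  proof (intro conjI)
    have "X v = (\<Union>i\<in>{1..<?n}. P v i)" if "v \<in> V" for v
      using P_part[OF that] unfolding indexed_partition_def by simp
    then show "verts H = (\<Union>K\<in>(\<lambda>i. induced H (?Y i)) ` {1..<?n}. verts K)"
      unfolding vertsH by auto
    show "edges H = (\<Union>K\<in>(\<lambda>i. induced H (?Y i)) ` {1..<?n}. edges K)"
      using edge_i by auto
  qed simp
  have "is_tK t ?n G"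
    unfolding is_tK_def
  proof (intro exI[of _ V] conjI)
    show "is_tfold t V {{u, v} |u v. u \<in> V \<and> v \<in> V \<and> u \<noteq> v} G"
      unfolding is_tfold_def
    proof (intro conjI ballI)
      fix e assume e: "e \<in> E"
      obtain u where "u \<in> inc G e" using other_vertex[OF e] .
      moreover from this obtain v where "inc G e = {u, v}" "v \<noteq> u" using edge_pair[OF e] by metis
      ultimately show "inc G e \<in> {{u, v} |u v. u \<in> V \<and> v \<in> V \<and> u \<noteq> v}" using incV[OF e] by blast
    next
      fix a assume "a \<in> {{u, v} |u v. u \<in> V \<and> v \<in> V \<and> u \<noteq> v}"
      then show "card {e \<in> E. inc G e = a} = t" using t(2) unfolding mult_def by blast
    qed simp
  qed (use finV in simp_all)
  then show ?thesis
    unfolding K_configuration_def using F t(1) n P_part mp un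
    by (intro conjI exI[of _ t] exI[of _ "card V"] exI[of _ P]) auto
qed

end

section \<open>Cycles give C-configurations\<close>

lemma is_K_multipartite_2I:
  assumes "A \<noteq> B" "A \<inter> B = {}" "finite A" "finite B" "card A = t" "card B = t"
    and "\<And>f. f \<in> edges (induced H (A \<union> B)) \<Longrightarrow> \<exists>x\<in>A. \<exists>y\<in>B. inc H f = {x, y}"
    and ex: "\<And>x y. x \<in> A \<Longrightarrow> y \<in> B \<Longrightarrow> card {f \<in> edges H. inc H f = {x, y}} = 1"
  shows "is_K_multipartite 2 t {A, B} (induced H (A \<union> B))"
  unfolding is_K_multipartite_def is_tfold_def
proof (intro conjI ballI)
  show "card {A, B} = 2" using assms(1) by simp
  show "disjoint {A, B}" using assms(2) unfolding disjoint_def by auto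
  show "inc (induced H (A \<union> B)) f \<in> {{x, y} |x y p q. p \<in> {A, B} \<and> q \<in> {A, B} \<and> p \<noteq> q \<and> x \<in> p \<and> y \<in> q}"
    if f: "f \<in> edges (induced H (A \<union> B))" for f
  proof -
    obtain x y where "x \<in> A" "y \<in> B" "inc H f = {x, y}" using assms(7)[OF f] by blast
    then show ?thesis using assms(1)
      unfolding induced_simps by (intro CollectI exI[of _ x] exI[of _ y] exI[of _ A] exI[of _ B]) auto
  qed
  show "card {f \<in> edges (induced H (A \<union> B)). inc (induced H (A \<union> B)) f = a} = 1"
    if a: "a \<in> {{x, y} |x y p q. p \<in> {A, B} \<and> q \<in> {A, B} \<and> p \<noteq> q \<and> x \<in> p \<and> y \<in> q}" for a
  proof -
    obtain x y p q where xy: "a = {x, y}" "p \<in> {A, B}" "q \<in> {A, B}" "p \<noteq> q" "x \<in> p" "y \<in> q"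
      using a by blast
    then have "(x \<in> A \<and> y \<in> B) \<or> (y \<in> A \<and> x \<in> B)" by auto
    then have "card {f \<in> edges H. inc H f = a} = 1"
      using ex[of x y] ex[of y x] xy(1) by (auto simp: insert_commute)
    moreover have "a \<subseteq> A \<union> B" using xy by auto
    then have "{f \<in> edges (induced H (A \<union> B)). inc (induced H (A \<union> B)) f = a} = {f \<in> edges H. inc H f = a}"
      by auto
    ultimately show ?thesis by simp
  qed
qed (use assms in auto)

locale cycle_block = block_graph +
  assumes two: "\<And>u. u \<in> verts G \<Longrightarrow> two_nbrs u"
begin

lemma adj_irrefl: "adj u v \<Longrightarrow> u \<noteq> v"
  unfolding adj_def by blast

lemma two_nbrsE:
  assumes "adj r p"
  obtains s where "s \<noteq> p" "\<not> adj p s" "\<And>c. adj r c \<longleftrightarrow> c = p \<or> c = s"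
proof -
  obtain a b where ab: "a \<noteq> b" "\<not> adj a b" "{c. adj r c} = {a, b}"
    using two[of r] adj_V[OF assms] unfolding two_nbrs_def by blast
  then have c: "adj r c \<longleftrightarrow> c = a \<or> c = b" for c by blast
  then consider "p = a" | "p = b" using assms by blast
  then show ?thesis using that[of b] that[of a] c ab(1,2) adj_sym by cases blast+
qed

lemma card_X_cycle:
  assumes "p \<noteq> s" "\<And>c. adj r c \<longleftrightarrow> c = p \<or> c = s"
  shows "card (X r) = mult G r p + mult G r s"
proof -
  have "adj r p" "adj r s" using assms(2) by blast+
  then have V: "r \<in> V" "p \<in> V - {r}" "s \<in> V - {r}" using adj_V adj_irrefl by blast+
  have "card (X r) = (\<Sum>u\<in>V - {r}. mult G r u)" using card_X degree_sum V by simp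
  also have "\<dots> = (\<Sum>u\<in>{p, s}. mult G r u)"
  proof (rule sum.mono_neutral_right)
    show "\<forall>u\<in>V - {r} - {p, s}. mult G r u = 0"
    proof
      fix u assume u: "u \<in> V - {r} - {p, s}"
      then have "\<not> adj r u" using assms(2) by blast
      then show "mult G r u = 0" using mult_pos[of r u] u by auto
    qed
  qed (use finV V in auto)
  also have "\<dots> = mult G r p + mult G r s" using assms(1) by simp
  finally show ?thesis .
qed

text \<open>Fix the colour \<open>x\<close> at \<open>p\<close> and keep \<open>s\<close> uncoloured: every colour \<open>z\<close> of \<open>r\<close> not adjacent to
  \<open>x\<close> may be used at \<open>r\<close>, and it blocks precisely the colours of \<open>s\<close> not blocked from the other
  side.\<close>

lemma same_N:
  assumes rs: "p \<noteq> s" "\<And>c. adj r c \<longleftrightarrow> c = p \<or> c = s" and x: "x \<in> X p"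
    and z1: "z1 \<in> X r" "\<not> nb x z1" and z2: "z2 \<in> X r" "\<not> nb x z2"
  shows "N z1 s = N z2 s"
proof -
  have a: "adj r p" "adj r s" using rs(2) by blast+
  then have V: "r \<in> V" "p \<in> V" "s \<in> V" "r \<noteq> p" "r \<noteq> s" using adj_V adj_irrefl by blast+
  obtain \<phi> where \<phi>: "ptrans X H (V - {s}) \<phi>" "\<phi> p = x" using color_at[OF V(2,3) rs(1) x] .
  obtain q where q: "q \<noteq> r" "\<And>c. adj s c \<longleftrightarrow> c = r \<or> c = q" using two_nbrsE[of s r] a(2) adj_sym by metis
  then have qs: "q \<in> V" "q \<noteq> s" using adj_V[of s q] unfolding adj_def by blast+
  \<comment> \<open>At \<open>s\<close> every colour is blocked from exactly one of \<open>r\<close>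
    and \<open>q\<close>. The right-hand side does not mention \<open>z\<close>, so all colours of
    \<open>r\<close> that are compatible with \<open>x\<close> have the same neighbours in
    \<open>X s\<close>.\<close>
  have "nb y z \<longleftrightarrow> \<not> nb y (\<phi> q)" if z: "z \<in> X r" "\<not> nb x z" and y: "y \<in> X s" for z y
  proof -
    have "ptrans X H (V - {s} - {r}) \<phi>"
      using \<phi>(1) unfolding ptrans_def by (meson DiffD1 Diff_subset image_mono order_trans)
    then have "ptrans X H (insert r (V - {s} - {r})) (\<phi>(r := z))"
    proof (rule ptrans_extend)
      fix e assume e: "e \<in> E" "r \<in> inc G e" "inc G e \<subseteq> insert r (V - {s} - {r})"
      obtain c where c: "inc G e = {r, c}" "c \<noteq> r" "adj r c" using edge_pair[OF e(1,2)] by metis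
      then have "c = p" using rs(2) e(3) by blast
      then show "\<not> blocks \<phi> r z e"
        using blocks_pair_nb[of \<phi> p z r e] \<phi>(2) x z c e(1) nb_sym by blast
    qed (use V z in auto)
    moreover have "insert r (V - {s} - {r}) = V - {s}" using V by blast
    ultimately have \<psi>: "ptrans X H (V - {s}) (\<phi>(r := z))" by simp
    obtain u where u: "u \<in> V" "u \<noteq> s" "adj s u" "nb y ((\<phi>(r := z)) u)"
      using exact_nb_ex[OF V(3) \<psi> y] by metis
    have "\<not> (nb y z \<and> nb y (\<phi> q))"
      using exact_nb[OF V(3) \<psi> y V(1,5) _ qs] q(1) by auto
    moreover have "nb y z \<or> nb y (\<phi> q)" using u q by (auto split: if_splits)
    ultimately show ?thesis by blast
  qed
  then show ?thesis using z1 z2 nb_sym unfolding N_def by blast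
qed

text \<open>The colours of \<open>r\<close> not adjacent to \<open>x\<close> have a common
  neighbourhood in \<open>X s\<close>; any \<open>y\<close> in it is adjacent to all of them. Both
  sets have size \<open>mult G r s\<close>, so they coincide.\<close>

lemma co_N:
  assumes rs: "p \<noteq> s" "\<And>c. adj r c \<longleftrightarrow> c = p \<or> c = s" and x: "x \<in> X p"
  obtains y where "y \<in> X s" "X r - N x r = N y r" "card (X r - N x r) = mult G r s"
    "\<And>z. z \<in> X r - N x r \<Longrightarrow> nb z y"
proof -
  have a: "adj r p" "adj r s" using rs(2) by blast+
  then have V: "r \<in> V" "p \<in> V" "s \<in> V" "r \<noteq> p" "r \<noteq> s" using adj_V adj_irrefl by blast+
  have "card (N x r) = mult G r p" using card_N[OF V(2,1) V(4)[symmetric] x] mult_sym by simp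
  then have c: "card (X r - N x r) = mult G r s"
    using card_X_cycle[OF rs] finX[OF V(1)] by (subst card_Diff_subset) (auto simp: N_def)
  have "X r - N x r \<noteq> {}"
  proof
    assume e: "X r - N x r = {}"
    have "mult G r s = 0" using c unfolding e by simp
    then show False using mult_pos[of r s] a(2) by simp
  qed
  then obtain z where z: "z \<in> X r - N x r" by blast
  then obtain y where y: "y \<in> X s" "nb z y" using N_nonempty[OF a(2), of z] by blast
  have nb: "nb z' y" if "z' \<in> X r - N x r" for z'
    using same_N[OF rs x, of z z'] that z y unfolding N_def by blast
  have "X r - N x r = N y r"
  proof (rule card_seteq)
    show "finite (N y r)" using finN[OF V(1)] .
    show "X r - N x r \<subseteq> N y r" using nb nb_sym unfolding N_def by blast
    show "card (N y r) \<le> card (X r - N x r)"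
      using c card_N[OF V(3,1) V(5)[symmetric] y(1)] mult_sym by simp
  qed
  then show ?thesis using that y(1) c nb by blast
qed

text \<open>Take adjacent \<open>z\<close> and \<open>x\<close>. As \<open>p\<close> has a second
  neighbour, \<open>X p\<close> also contains some \<open>x2\<close> not adjacent to
  \<open>z\<close>. A colour of \<open>r\<close> compatible with both \<open>x\<close> and
  \<open>x2\<close> would share its neighbours in \<open>X s\<close> with \<open>z\<close> and make
  \<open>z\<close> compatible with \<open>x\<close>. So the colours compatible with
  \<open>x2\<close>, of which there are \<open>mult G r s\<close>, are all adjacent to
  \<open>x\<close>.\<close>

lemma mult_le_cycle:
  assumes rs: "p \<noteq> s" "\<And>c. adj r c \<longleftrightarrow> c = p \<or> c = s"
  shows "mult G r s \<le> mult G r p"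
proof -
  have a: "adj r p" "adj r s" using rs(2) by blast+
  then have V: "r \<in> V" "p \<in> V" "s \<in> V" "r \<noteq> p" "r \<noteq> s" using adj_V adj_irrefl by blast+
  obtain z where z: "z \<in> X r" using X_nonempty[OF a(1)] by blast
  obtain x where x: "x \<in> X p" "nb z x" using N_nonempty[OF a(1) z] .
  obtain y where y: "y \<in> X s" "X r - N x r = N y r" "\<And>z. z \<in> X r - N x r \<Longrightarrow> nb z y"
    using co_N[OF rs x(1)] by metis
  obtain c where c: "c \<noteq> r" "\<And>d. adj p d \<longleftrightarrow> d = r \<or> d = c"
    using two_nbrsE[of p r] a(1) adj_sym by metis
  have "mult G p c \<ge> 1" using c(2)[of c] mult_pos by blast
  then have "card (N z p) < card (X p)"
    using card_X_cycle[OF c(1)[symmetric] c(2)] card_N[OF V(1,2,4) z] mult_sym[of r p] by simp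
  then have "N z p \<noteq> X p" by auto
  then obtain x2 where x2: "x2 \<in> X p" "\<not> nb z x2" unfolding N_def by blast
  have zC2: "z \<in> X r - N x2 r" using z x2(2) nb_sym unfolding N_def by blast
  have "X r - N x2 r \<subseteq> N x r"
  proof (rule ccontr)
    assume "\<not> ?thesis"
    then obtain z' where z': "z' \<in> X r - N x2 r" "z' \<in> X r - N x r" by blast
    then have "nb z' y" using y(3) by blast
    moreover have "N z' s = N z s"
      using same_N[OF rs x2(1), of z' z] z' zC2 unfolding N_def by blast
    ultimately have "nb z y" using y(1) unfolding N_def by blast
    then have "z \<in> X r - N x r" using y(2) z nb_sym unfolding N_def by blast
    then show False using x(2) nb_sym unfolding N_def by blast
  qed
  then have "card (X r - N x2 r) \<le> card (N x r)" using finN[OF V(1)] by (intro card_mono)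
  moreover have "card (X r - N x2 r) = mult G r s" using co_N[OF rs x2(1)] by metis
  moreover have "card (N x r) = mult G r p" using card_N[OF V(2,1) V(4)[symmetric] x(1)] mult_sym by simp
  ultimately show ?thesis by simp
qed

lemma mult_eq_cycle:
  assumes "adj r p" "adj r s"
  shows "mult G r s = mult G r p"
proof (cases "s = p")
  case False
  obtain s' where s': "s' \<noteq> p" "\<And>c. adj r c \<longleftrightarrow> c = p \<or> c = s'" using two_nbrsE[OF assms(1)] by metis
  then have rs: "p \<noteq> s" "\<And>c. adj r c \<longleftrightarrow> c = p \<or> c = s" using assms(2) False by blast+
  have rs': "\<And>c. adj r c \<longleftrightarrow> c = s \<or> c = p" using rs(2) by blast
  show ?thesis using mult_le_cycle[OF rs] mult_le_cycle[OF rs(1)[symmetric] rs'] by simp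
qed simp

lemma mult_const_cycle:
  assumes "V \<noteq> {}"
  obtains t where "t \<ge> 1" "\<And>u v. adj u v \<Longrightarrow> mult G u v = t" "\<And>v. v \<in> V \<Longrightarrow> card (X v) = 2 * t"
proof -
  obtain u0 where u0: "u0 \<in> V" using assms by blast
  obtain v0 where v0: "adj u0 v0" using two[OF u0] unfolding two_nbrs_def by blast
  let ?t = "mult G u0 v0"
  let ?D = "{u \<in> V. \<forall>c. adj u c \<longrightarrow> mult G u c = ?t}"
  have "?D = V"
  proof (rule adj_closed)
    show "?D \<noteq> {}" using u0 mult_eq_cycle[OF v0] by blast
    fix p q assume "p \<in> ?D" "adj p q"
    then have "adj q p" "mult G p q = ?t" using adj_sym by blast+
    then have "mult G q c = ?t" if "adj q c" for c
      using mult_eq_cycle[OF \<open>adj q p\<close> that] mult_sym[of q p] by simp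
    then show "q \<in> ?D" using adj_V[OF \<open>adj p q\<close>] by blast
  qed blast
  then have t: "mult G u v = ?t" if "adj u v" for u v using that adj_V by blast
  have "card (X v) = 2 * ?t" if v: "v \<in> V" for v
  proof -
    obtain a b where "a \<noteq> b" "{c. adj v c} = {a, b}" using two[OF v] unfolding two_nbrs_def by blast
    then have "a \<noteq> b" "\<And>c. adj v c \<longleftrightarrow> c = a \<or> c = b" by blast+
    then show ?thesis using card_X_cycle[of a b v] t by simp
  qed
  moreover have "?t \<ge> 1" using v0 mult_pos by blast
  ultimately show ?thesis using that t by blast
qed

text \<open>A half of the list of \<open>r\<close>: neighbouring colours see either exactly this
  half or exactly the other. The complement has the same property, so naming the halves consistently
  along the cycle is a separate matter.\<close>

definition cls :: "'a \<Rightarrow> 'c set \<Rightarrow> bool" where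
  "cls r Q \<longleftrightarrow> Q \<subseteq> X r \<and> (\<forall>s. adj r s \<longrightarrow> (\<forall>y\<in>X s. N y r = Q \<or> N y r = X r - Q))"

text \<open>For \<open>x\<close>, \<open>x2\<close> in the same list, the complements of their
  neighbourhoods are equal as soon as they meet; if they are disjoint, equality of multiplicities
  makes the neighbourhoods complementary. Colours at the other neighbour of \<open>r\<close> reduce
  to this case by taking complements.\<close>

lemma cls_N:
  assumes t: "\<And>u v. adj u v \<Longrightarrow> mult G u v = t" and a: "adj r p" and x: "x \<in> X p"
  shows "cls r (N x r)"
proof -
  obtain s where rs: "s \<noteq> p" "\<And>c. adj r c \<longleftrightarrow> c = p \<or> c = s" using two_nbrsE[OF a] by metis
  have rs': "\<And>c. adj r c \<longleftrightarrow> c = s \<or> c = p" using rs(2) by blast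
  have as: "adj r s" using rs(2) by blast
  then have V: "r \<in> V" "p \<in> V" "s \<in> V" "r \<noteq> p" "r \<noteq> s" "adj r s"
    using a adj_V adj_irrefl by blast+
  have sub: "N z r \<subseteq> X r" for z unfolding N_def by blast
  have fin: "finite (X r)" using finX[OF V(1)] .
  have P: "N x2 r = N x r \<or> N x2 r = X r - N x r" if x2: "x2 \<in> X p" for x2
  proof -
    obtain y where y: "y \<in> X s" "X r - N x r = N y r" "card (X r - N x r) = mult G r s"
      "\<And>z. z \<in> X r - N x r \<Longrightarrow> nb z y" using co_N[OF rs(1)[symmetric] rs(2) x] by metis
    have c2: "card (X r - N x2 r) = mult G r s" using co_N[OF rs(1)[symmetric] rs(2) x2] by metis
    have cN: "card (N x r) = mult G r s" using card_N[OF V(2,1) V(4)[symmetric] x] t[OF a] t[OF V(6)] mult_sym by simp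
    show ?thesis
    proof (cases "(X r - N x2 r) \<inter> (X r - N x r) = {}")
      case True
      then have "X r - N x2 r = N x r"
        using c2 cN sub finite_subset[OF sub fin] by (intro card_seteq) auto
      then show ?thesis using sub by blast
    next
      case False
      then obtain z' where z': "z' \<in> X r - N x2 r" "z' \<in> X r - N x r" by blast
      have "X r - N x2 r \<subseteq> X r - N x r"
      proof
        fix z assume z: "z \<in> X r - N x2 r"
        have "N z' s = N z s"
          using same_N[OF rs(1)[symmetric] rs(2) x2, of z' z] z' z unfolding N_def by blast
        then have "nb z y" using y(1) y(4)[OF z'(2)] unfolding N_def by blast
        then show "z \<in> X r - N x r" using z y(2) nb_sym unfolding N_def by blast
      qed
      then have "X r - N x2 r = X r - N x r" using c2 y(3) fin by (intro card_seteq) auto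
      then show ?thesis using sub by blast
    qed
  qed
  have "N y r = N x r \<or> N y r = X r - N x r" if "adj r c" "y \<in> X c" for c y
  proof (cases "c = p")
    case False
    then have y: "y \<in> X s" using that rs by blast
    obtain x' where x': "x' \<in> X p" "X r - N y r = N x' r" using co_N[OF rs(1) rs' y] by metis
    then have "N y r = X r - N x' r" using sub by blast
    then show ?thesis using P[OF x'(1)] sub by blast
  qed (use P that in blast)
  then show ?thesis unfolding cls_def using sub by blast
qed

text \<open>Take for \<open>R\<close> the neighbourhood of some \<open>z0\<close> in
  \<open>Q\<close>. A colour \<open>y\<close> of \<open>R\<close> sees \<open>z0\<close>, hence all
  of \<open>Q\<close> and nothing else; so the neighbourhood of a colour of \<open>r\<close>
  contains \<open>y\<close>, and is therefore \<open>R\<close>, just when the colour lies in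
  \<open>Q\<close>.\<close>

lemma cls_transfer:
  assumes t: "\<And>u v. adj u v \<Longrightarrow> mult G u v = t" "t \<ge> 1" "\<And>v. v \<in> V \<Longrightarrow> card (X v) = 2 * t"
    and a: "adj r s" and Q: "cls r Q"
  shows "card Q = t" "\<exists>R. cls s R \<and> (\<forall>z\<in>Q. N z s = R) \<and> (\<forall>z\<in>X r - Q. N z s = X s - R)"
proof -
  have V: "r \<in> V" "s \<in> V" "r \<noteq> s" using a adj_V unfolding adj_def by blast+
  have a': "adj s r" using a adj_sym by blast
  have cN: "card (N y r) = t" if "y \<in> X s" for y using card_N[OF V(2,1) V(3)[symmetric] that] t(1)[OF a'] by simp
  have Qsub: "Q \<subseteq> X r" using Q unfolding cls_def by blast
  then have Qfin: "finite Q" using finX[OF V(1)] finite_subset by blast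
  obtain y0 where y0: "y0 \<in> X s" using X_nonempty[OF a'] by blast
  have "N y0 r = Q \<or> N y0 r = X r - Q" using Q a y0 unfolding cls_def by blast
  then show cQ: "card Q = t"
  proof
    assume "N y0 r = X r - Q"
    then have "card (X r - Q) = t" using cN[OF y0] by simp
    then show ?thesis using card_Diff_subset[OF Qfin Qsub] t(3)[OF V(1)] card_mono[OF finX[OF V(1)] Qsub] by simp
  qed (use cN[OF y0] in simp)
  then have "Q \<noteq> {}" using t(2) by auto
  then obtain z0 where z0: "z0 \<in> Q" by blast
  then have z0X: "z0 \<in> X r" using Qsub by blast
  let ?R = "N z0 s"
  have R: "cls s ?R" using cls_N[OF t(1) a' z0X] by blast
  obtain y where y: "y \<in> X s" "nb z0 y" using N_nonempty[OF a z0X] .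
  have NyQ: "N y' r = Q" if "y' \<in> ?R" for y'
  proof -
    have y': "y' \<in> X s" "nb y' z0" using that nb_sym unfolding N_def by blast+
    then have "z0 \<in> N y' r" using z0X unfolding N_def by blast
    moreover have "N y' r = Q \<or> N y' r = X r - Q" using Q a y'(1) unfolding cls_def by blast
    ultimately show ?thesis using z0 by blast
  qed
  have yR: "y \<in> ?R" using y unfolding N_def by blast
  have "N z s = ?R \<or> N z s = X s - ?R" if "z \<in> X r" for z using R a' that unfolding cls_def by blast
  moreover have "y \<in> N z s \<longleftrightarrow> z \<in> Q" if "z \<in> X r" for z
    using NyQ[OF yR] that y(1) nb_sym unfolding N_def by blast
  ultimately have "(\<forall>z\<in>Q. N z s = ?R) \<and> (\<forall>z\<in>X r - Q. N z s = X s - ?R)"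
    using yR Qsub by blast
  then show "\<exists>R. cls s R \<and> (\<forall>z\<in>Q. N z s = R) \<and> (\<forall>z\<in>X r - Q. N z s = X s - R)" using R by blast
qed

definition path :: "'a list \<Rightarrow> bool" where
  "path vs \<longleftrightarrow> distinct vs \<and> set vs \<subseteq> V \<and> (\<forall>i. Suc i < length vs \<longrightarrow> adj (vs ! i) (vs ! Suc i))"

text \<open>A longest path closes up to a cycle.\<close>

lemma cycle_list:
  assumes "V \<noteq> {}"
  obtains vs where "distinct vs" "set vs = V" "length vs \<ge> 4"
    "\<And>i. i < length vs \<Longrightarrow> adj (vs ! i) (vs ! (Suc i mod length vs))"
    "\<And>u v. adj u v \<Longrightarrow> \<exists>i<length vs. {u, v} = {vs ! i, vs ! (Suc i mod length vs)}"
proof -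
  have len: "length vs \<le> card V" if "path vs" for vs
    using that finV unfolding path_def by (metis card_mono distinct_card)
  have "length ` {vs. path vs} \<subseteq> {..card V}"
  proof
    fix m assume "m \<in> length ` {vs. path vs}"
    then obtain vs where "path vs" "m = length vs" by blast
    then show "m \<in> {..card V}" using len by simp
  qed
  then have fin: "finite (length ` {vs. path vs})" by (rule finite_subset) simp
  obtain u where u: "u \<in> V" using assms by blast
  obtain a b where ab: "a \<noteq> b" "\<not> adj a b" "{c. adj u c} = {a, b}"
    using two[OF u] unfolding two_nbrs_def by blast
  then have uab: "adj u a" "adj u b" by blast+
  have p3: "path [a, u, b]"
    unfolding path_def using uab ab(1) adj_sym[of u a] adj_V[OF uab(1)] adj_V[OF uab(2)]
    by (auto simp: less_Suc_eq nth_Cons' adj_def)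
  have "Max (length ` {vs. path vs}) \<in> length ` {vs. path vs}" using fin p3 by (intro Max_in) auto
  then obtain vs where vs: "path vs" "length vs = Max (length ` {vs. path vs})" by auto
  have max: "length ws \<le> length vs" if "path ws" for ws
    unfolding vs(2) using that fin by (intro Max_ge) auto
  let ?n = "length vs"
  have n3: "?n \<ge> 3" using max[OF p3] by simp
  have d: "distinct vs" "set vs \<subseteq> V" and step: "\<And>i. Suc i < ?n \<Longrightarrow> adj (vs ! i) (vs ! Suc i)"
    using vs(1) unfolding path_def by blast+
  have neq: "vs ! i \<noteq> vs ! j" if "i < ?n" "j < ?n" "i \<noteq> j" for i j
    using that d(1) nth_eq_iff_index_eq by blast
  have two': "c = x \<or> c = y" if "adj v x" "adj v y" "x \<noteq> y" "adj v c" for v x y c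
    using two_nbrsE[OF that(1)] that by metis
  let ?l = "?n - 1"
  have l: "?l < ?n" "Suc (?l - 1) = ?l" "?l - 1 < ?n" using n3 by auto
  have adjl: "adj (vs ! ?l) (vs ! (?l - 1))" using step[of "?l - 1"] l adj_sym by simp
  obtain c where c: "c \<noteq> vs ! (?l - 1)" "\<And>x. adj (vs ! ?l) x \<longleftrightarrow> x = vs ! (?l - 1) \<or> x = c"
    using two_nbrsE[OF adjl] by metis
  have adjc: "adj (vs ! ?l) c" using c(2) by blast
  have "c \<in> set vs"
  proof (rule ccontr)
    assume "c \<notin> set vs"
    then have "path (vs @ [c])"
      using d step adjc adj_V[OF adjc] unfolding path_def
      by (auto simp: nth_append less_Suc_eq) (metis One_nat_def diff_Suc_1 less_antisym not_less_eq)
    then show False using max[of "vs @ [c]"] by simp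
  qed
  then obtain j where j: "j < ?n" "vs ! j = c" by (metis in_set_conv_nth)
  have "j \<noteq> ?l" using adjc j(2) unfolding adj_def by blast
  moreover have "j \<noteq> ?l - 1" using c(1) j(2) by blast
  ultimately have j2: "Suc j < ?l" using j(1) by simp
  \<comment> \<open>An inner vertex of the path adjacent to the last one would have three
    neighbours.\<close>
  have "j = 0"
  proof (rule ccontr)
    assume j0: "j \<noteq> 0"
    have "adj (vs ! j) (vs ! (j - 1))" using step[of "j - 1"] j0 j(1) adj_sym by simp
    moreover have "adj (vs ! j) (vs ! Suc j)" using step[of j] j2 by simp
    moreover have "adj (vs ! j) (vs ! ?l)" using adjc j(2) adj_sym by blast
    moreover have "vs ! (j - 1) \<noteq> vs ! Suc j" "vs ! ?l \<noteq> vs ! (j - 1)" "vs ! ?l \<noteq> vs ! Suc j"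
      using j2 j0 by (intro neq; simp)+
    ultimately show False using two' by blast
  qed
  have cyc: "adj (vs ! i) (vs ! (Suc i mod ?n))" if i: "i < ?n" for i
  proof (cases "Suc i = ?n")
    case True
    then have "i = ?l" "Suc i mod ?n = 0" by auto
    then show ?thesis using adjc j(2) \<open>j = 0\<close> by simp
  next
    case False
    then show ?thesis using step[of i] i by simp
  qed
  have nbrs: "\<exists>k<?n. v = vs ! k \<and> {vs ! i, v} = {vs ! k, vs ! i} \<and> (k = Suc i mod ?n \<or> i = Suc k mod ?n)"
    if i: "i < ?n" and v: "adj (vs ! i) v" for i v
  proof -
    define k where "k = (if i = 0 then ?l else i - 1)"
    have k: "k < ?n" "Suc k mod ?n = i" using i l unfolding k_def by auto
    have "Suc i mod ?n < ?n" using n3 by (intro mod_less_divisor) linarith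
    moreover have "k \<noteq> Suc i mod ?n"
      using i n3 unfolding k_def by (cases "Suc i = ?n") auto
    ultimately have "vs ! (Suc i mod ?n) \<noteq> vs ! k" using neq k(1) by metis
    moreover have "adj (vs ! i) (vs ! k)" using cyc[OF k(1)] k(2) adj_sym by simp
    ultimately have "v = vs ! (Suc i mod ?n) \<or> v = vs ! k" using two'[OF cyc[OF i] _ _ v] by blast
    then show ?thesis using k \<open>Suc i mod ?n < ?n\<close> by (auto simp: insert_commute)
  qed
  have setV: "set vs = V"
  proof (rule adj_closed)
    show "set vs \<noteq> {}" using n3 by auto
    fix p q assume "p \<in> set vs" "adj p q"
    then obtain i where "i < ?n" "p = vs ! i" by (metis in_set_conv_nth)
    then show "q \<in> set vs" using nbrs[of i q] \<open>adj p q\<close> by auto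
  qed (rule d(2))
  \<comment> \<open>In a triangle the two neighbours of a vertex are adjacent, which
    \<open>two_nbrs\<close> forbids.\<close>
  have "?n \<noteq> 3"
  proof
    assume n: "?n = 3"
    have a01: "adj (vs ! 0) (vs ! 1)" and a12: "adj (vs ! 1) (vs ! 2)" and a20: "adj (vs ! 2) (vs ! 0)"
      using cyc[of 0] cyc[of 1] cyc[of 2] n by (simp_all add: numeral_2_eq_2)
    obtain s where s: "\<not> adj (vs ! 1) s" "s \<noteq> vs ! 1" "\<And>c. adj (vs ! 0) c \<longleftrightarrow> c = vs ! 1 \<or> c = s"
      using two_nbrsE[OF a01] by metis
    have "vs ! 2 \<noteq> vs ! 1" using adj_irrefl[OF a12] by (rule not_sym)
    then have "s = vs ! 2" using s(3)[of "vs ! 2"] a20 adj_sym by blast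
    then show False using s(1) a12 by blast
  qed
  moreover have "\<exists>i<?n. {u, v} = {vs ! i, vs ! (Suc i mod ?n)}" if uv: "adj u v" for u v
  proof -
    obtain i where i: "i < ?n" "u = vs ! i" using adj_V[OF uv] setV by (metis in_set_conv_nth)
    then obtain k where "k < ?n" "v = vs ! k" "k = Suc i mod ?n \<or> i = Suc k mod ?n"
      using nbrs[of i v] uv by blast
    then show ?thesis using i by (metis insert_commute)
  qed
  ultimately show ?thesis using that[of vs] d(1) setV n3 cyc by simp
qed

text \<open>A half of the list at the starting vertex is transported once round the cycle. It
  returns either to itself or to its complement, and this decides whether one pair of classes is
  swapped. The parity of \<open>n\<close> must match, because otherwise alternating signs would give
  a colouring.\<close>

lemma C_configuration:
  assumes F: "feasible G X H" and ne: "V \<noteq> {}"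
    and simple: "\<And>f g. f \<in> edges H \<Longrightarrow> g \<in> edges H \<Longrightarrow> inc H f = inc H g \<Longrightarrow> f = g"
  shows "C_configuration G X H"
proof -
  obtain t where t: "t \<ge> 1" "\<And>u v. adj u v \<Longrightarrow> mult G u v = t" "\<And>v. v \<in> V \<Longrightarrow> card (X v) = 2 * t"
    using mult_const_cycle[OF ne] by metis
  obtain vs where vs: "distinct vs" "set vs = V" "length vs \<ge> 4"
    "\<And>i. i < length vs \<Longrightarrow> adj (vs ! i) (vs ! (Suc i mod length vs))"
    "\<And>u v. adj u v \<Longrightarrow> \<exists>i<length vs. {u, v} = {vs ! i, vs ! (Suc i mod length vs)}"
    using cycle_list[OF ne] by metis
  define n where "n = length vs"
  define nx where "nx k = Suc k mod n" for k
  have n: "n \<ge> 4" "n > 0" using vs(3) unfolding n_def by auto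
  have nx: "nx k < n" for k using n unfolding nx_def by simp
  have nx': "nx k = (if Suc k = n then 0 else Suc k)" if "k < n" for k using that unfolding nx_def by auto
  have cyc: "adj (vs ! k) (vs ! nx k)" if "k < n" for k using vs(4) that unfolding n_def nx_def by blast
  have pairs: "\<exists>k<n. {u, v} = {vs ! k, vs ! nx k}" if "adj u v" for u v
    using vs(5)[OF that] unfolding n_def nx_def by blast
  have nthV: "vs ! k \<in> V" if "k < n" for k using vs(2) that nth_mem unfolding n_def by blast
  define ix where "ix v = (THE k. k < n \<and> vs ! k = v)" for v
  have ix: "ix (vs ! k) = k" if "k < n" for k
    unfolding ix_def using that vs(1) nth_eq_iff_index_eq unfolding n_def by blast
  have ixV: "\<exists>k<n. v = vs ! k" if "v \<in> V" for v
    using that vs(2) unfolding n_def by (metis in_set_conv_nth)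
  define tr where "tr r s Q = (SOME R. cls s R \<and> (\<forall>z\<in>Q. N z s = R) \<and> (\<forall>z\<in>X r - Q. N z s = X s - R))"
    for r s Q
  have tr: "cls s (tr r s Q) \<and> (\<forall>z\<in>Q. N z s = tr r s Q) \<and> (\<forall>z\<in>X r - Q. N z s = X s - tr r s Q)"
    if "adj r s" "cls r Q" for r s Q
    unfolding tr_def by (rule someI_ex) (rule cls_transfer(2)[OF t(2,1,3) that])
  let ?v0 = "vs ! 0" and ?l = "n - 1"
  have adj01: "adj ?v0 (vs ! nx 0)" using cyc n by blast
  obtain x0 where x0: "x0 \<in> X (vs ! nx 0)" using X_nonempty adj01 adj_sym by blast
  define Q0 where "Q0 = N x0 ?v0"
  have Q0: "cls ?v0 Q0" unfolding Q0_def by (rule cls_N[OF t(2) adj01 x0])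
  define Qs where "Qs = rec_nat Q0 (\<lambda>k Q. tr (vs ! k) (vs ! Suc k) Q)"
  have Qs0: "Qs 0 = Q0" and QsS: "Qs (Suc k) = tr (vs ! k) (vs ! Suc k) (Qs k)" for k
    unfolding Qs_def by simp_all
  have cls_Qs: "cls (vs ! k) (Qs k)" if "k < n" for k
    using that
  proof (induction k)
    case 0
    then show ?case using Q0 Qs0 by simp
  next
    case (Suc k)
    then have "adj (vs ! k) (vs ! Suc k)" using cyc[of k] nx'[of k] by simp
    then show ?case using tr Suc unfolding QsS by simp
  qed
  have l: "?l < n" "nx ?l = 0" using n nx'[of ?l] by auto
  have adjl: "adj (vs ! ?l) ?v0" using cyc[OF l(1)] l(2) by simp
  define R where "R = tr (vs ! ?l) ?v0 (Qs ?l)"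
  note R = tr[OF adjl cls_Qs[OF l(1)], folded R_def]
  have Qsub: "Qs k \<subseteq> X (vs ! k)" if "k < n" for k using cls_Qs[OF that] unfolding cls_def by blast
  have Qcard: "card (Qs k) = t" if "k < n" for k using cls_transfer(1)[OF t(2,1,3) cyc[OF that] cls_Qs[OF that]] .
  \<comment> \<open>The transported half is the neighbourhood of a colour at the last vertex, and
    such neighbourhoods at the starting vertex are \<open>Q0\<close> or its complement.\<close>
  have R2: "R = Q0 \<or> R = X ?v0 - Q0"
  proof -
    have "Qs ?l \<noteq> {}" using Qcard[OF l(1)] t(1) by auto
    then obtain z where z: "z \<in> Qs ?l" by blast
    then have "N z ?v0 = R" "z \<in> X (vs ! ?l)" using R Qsub[OF l(1)] by blast+
    then show ?thesis using Q0 adjl adj_sym unfolding cls_def by metis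
  qed
  define Q where "Q v s = (if s = 1 then Qs (ix v) else X v - Qs (ix v))" for v and s :: int
  \<comment> \<open>All transfers are straight by construction; a mismatch can only show at the edge
    closing the cycle.\<close>
  define \<tau> where "\<tau> k = (if k = ?l \<and> R \<noteq> Q0 then -1 else 1 :: int)" for k
  have \<tau>: "\<tau> k \<in> {1, -1}" for k unfolding \<tau>_def by simp
  have \<tau>s: "\<tau> k * s \<in> {1, -1}" if "s \<in> {1, -1}" for k s using \<tau>[of k] that by auto
  have Qv: "Q (vs ! k) s = (if s = 1 then Qs k else X (vs ! k) - Qs k)" if "k < n" for k s
    unfolding Q_def using ix[OF that] by simp
  have Q_sub: "Q (vs ! k) s \<subseteq> X (vs ! k)" if "k < n" for k s using Qv[OF that] Qsub[OF that] by auto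
  have Q_card: "card (Q (vs ! k) s) = t" if "k < n" for k s
  proof -
    have "card (X (vs ! k) - Qs k) = 2 * t - t"
      using Qcard[OF that] t(3)[OF nthV[OF that]] Qsub[OF that] finX[OF nthV[OF that]]
      by (subst card_Diff_subset) (auto intro: finite_subset)
    then show ?thesis using Qv[OF that] Qcard[OF that] by simp
  qed
  have Q_fin: "finite (Q (vs ! k) s)" if "k < n" for k s
    using Q_sub[OF that] finX[OF nthV[OF that]] finite_subset by blast
  have Q_un: "X (vs ! k) = Q (vs ! k) 1 \<union> Q (vs ! k) (-1)" if "k < n" for k
    using Qv[OF that] Qsub[OF that] by auto
  have Q_dis: "Q (vs ! k) s \<inter> Q (vs ! k) (- s) = {}" if "k < n" "s \<in> {1, -1}" for k s
    using Qv[OF that(1)] that(2) by auto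
  have key: "N z (vs ! nx k) = Q (vs ! nx k) (\<tau> k * s)" if k: "k < n" and s: "s \<in> {1, -1}" and z: "z \<in> Q (vs ! k) s" for k s z
  proof (cases "k = ?l")
    case False
    then have k': "nx k = Suc k" "Suc k < n" using k nx'[OF k] by auto
    have "adj (vs ! k) (vs ! Suc k)" using cyc[OF k] k' by simp
    note T = tr[OF this cls_Qs[OF k], folded QsS]
    show ?thesis using T s z Qv[OF k] Qv[OF k'(2)] False k'(1) unfolding \<tau>_def by auto
  next
    case True
    have Q0X: "Q0 \<subseteq> X ?v0" using Q0 unfolding cls_def by blast
    have v0: "Q ?v0 s = (if s = 1 then Q0 else X ?v0 - Q0)" for s using Qv[of 0 s] n(2) Qs0 by simp
    have "N z ?v0 = (if s = 1 then R else X ?v0 - R)"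
      using R z s Qv[OF k] unfolding True by auto
    then show ?thesis using v0 R2 s Q0X l(2) unfolding True \<tau>_def by auto
  qed
  have nbQ: "nb z y \<longleftrightarrow> y \<in> Q (vs ! nx k) (\<tau> k * s)"
    if "k < n" "s \<in> {1, -1}" "z \<in> Q (vs ! k) s" "y \<in> X (vs ! nx k)" for k s z y
    using key[OF that(1-3)] that(4) unfolding N_def by blast
  have edgeF: "\<exists>k<n. \<exists>s\<in>{1, -1}. \<exists>x\<in>Q (vs ! k) s. \<exists>y\<in>Q (vs ! nx k) (\<tau> k * s). inc H f = {x, y}"
    if f: "f \<in> edges H" for f
  proof -
    obtain u v x y where uv: "x \<in> X u" "y \<in> X v" "inc H f = {x, y}" "adj u v"
      using edge_H_pair[OF f] by metis
    obtain k where k: "k < n" "{u, v} = {vs ! k, vs ! nx k}" using pairs[OF uv(4)] by blast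
    have "\<exists>x y. x \<in> X (vs ! k) \<and> y \<in> X (vs ! nx k) \<and> inc H f = {x, y}"
    proof (cases "u = vs ! k")
      case True
      then have "v = vs ! nx k" using k(2) by (auto simp: doubleton_eq_iff)
      then show ?thesis using True uv by blast
    next
      case False
      then have "u = vs ! nx k" "v = vs ! k" using k(2) by (auto simp: doubleton_eq_iff)
      then show ?thesis using uv by (intro exI[of _ y] exI[of _ x]) auto
    qed
    then obtain x y where xy: "x \<in> X (vs ! k)" "y \<in> X (vs ! nx k)" "inc H f = {x, y}" by blast
    then have "nb x y" unfolding nb_def using f by blast
    moreover obtain s where s: "s \<in> {1, -1}" "x \<in> Q (vs ! k) s" using xy(1) Q_un[OF k(1)] by blast
    ultimately show ?thesis using nbQ[OF k(1) s xy(2)] xy(3) s k(1) by blast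
  qed
  let ?B = "\<lambda>k s. Q (vs ! k) s \<union> Q (vs ! nx k) (\<tau> k * s)"
  have bip: "is_K_multipartite 2 t {Q (vs ! k) s, Q (vs ! nx k) (\<tau> k * s)} (induced H (?B k s))"
    if k: "k < n" and s: "s \<in> {1, -1}" for k s
  proof (rule is_K_multipartite_2I)
    have ne: "vs ! k \<noteq> vs ! nx k" using cyc[OF k] adj_irrefl by blast
    have dis: "X (vs ! k) \<inter> X (vs ! nx k) = {}" using X_unique[OF _ _ nthV[OF k] nthV[OF nx]] ne by blast
    then show int: "Q (vs ! k) s \<inter> Q (vs ! nx k) (\<tau> k * s) = {}" using Q_sub[OF k] Q_sub[OF nx] by blast
    have "Q (vs ! k) s \<noteq> {}" using Q_card[OF k, of s] t(1) by auto
    then show "Q (vs ! k) s \<noteq> Q (vs ! nx k) (\<tau> k * s)" using int by blast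
    show "finite (Q (vs ! k) s)" "finite (Q (vs ! nx k) (\<tau> k * s))" using Q_fin[OF k] Q_fin[OF nx] .
    show "card (Q (vs ! k) s) = t" "card (Q (vs ! nx k) (\<tau> k * s)) = t" using Q_card[OF k] Q_card[OF nx] .
    show "\<exists>x\<in>Q (vs ! k) s. \<exists>y\<in>Q (vs ! nx k) (\<tau> k * s). inc H f = {x, y}" if f: "f \<in> edges (induced H (?B k s))" for f
    proof -
      have f': "f \<in> edges H" "inc H f \<subseteq> ?B k s" using f by auto
      obtain u v x y where uv: "u \<in> V" "v \<in> V" "u \<noteq> v" "x \<in> X u" "y \<in> X v" "inc H f = {x, y}"
        using edge_H_pair[OF f'(1)] by metis
      have notboth: "\<not> (x \<in> X w \<and> y \<in> X w)" if "w \<in> V" for w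
        using X_unique[OF uv(4) _ uv(1) that] X_unique[OF uv(5) _ uv(2) that] uv(3) by blast
      have xy: "x \<in> ?B k s" "y \<in> ?B k s" using f'(2) uv(6) by auto
      then consider "x \<in> Q (vs ! k) s" "y \<in> Q (vs ! nx k) (\<tau> k * s)" | "y \<in> Q (vs ! k) s" "x \<in> Q (vs ! nx k) (\<tau> k * s)"
        using notboth[OF nthV[OF k]] notboth[OF nthV[OF nx]] Q_sub[OF k] Q_sub[OF nx] by blast
      then show ?thesis using uv(6) by cases (auto simp: insert_commute)
    qed
    show "card {f \<in> edges H. inc H f = {x, y}} = 1" if "x \<in> Q (vs ! k) s" "y \<in> Q (vs ! nx k) (\<tau> k * s)" for x y
    proof -
      have "nb x y" using nbQ[OF k s that(1)] that(2) Q_sub[OF nx] by blast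
      then obtain f where f: "f \<in> edges H" "inc H f = {x, y}" unfolding nb_def by blast
      then have "{f \<in> edges H. inc H f = {x, y}} = {f}" using simple by auto
      then show ?thesis by simp
    qed
  qed
  \<comment> \<open>With product 1 a sign sequence obeying \<open>- \<tau> k\<close> at every edge
    closes up. Colours picked from the corresponding halves are then non-adjacent along the cycle
    and form a colouring.\<close>
  have prod_ne: "(\<Prod>k<n. - \<tau> k) \<noteq> 1"
  proof
    assume 1: "(\<Prod>k<n. - \<tau> k) = 1"
    obtain s where "(\<forall>k<n. s k \<in> {1, -1}) \<and> (\<forall>k<n. k \<noteq> 0 \<longrightarrow> s (Suc k mod n) = - \<tau> k * s k) \<and>
      s (Suc 0 mod n) = (1 :: int)"
      using signed_cycle_exists[of 0 n \<tau> 1] \<tau> n(2) by auto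
    then have s: "\<And>k. k < n \<Longrightarrow> s k \<in> {1, -1}" "\<And>k. k < n \<Longrightarrow> k \<noteq> 0 \<Longrightarrow> s (Suc k mod n) = - \<tau> k * s k"
      by simp_all
    have s0: "s (Suc 0 mod n) = - \<tau> 0 * s 0"
      using signed_cycle_closing[of 0 n s \<tau>] s \<tau> n(2) 1 by simp
    have step: "s (nx k) = - \<tau> k * s k" if "k < n" for k
      using s(2)[OF that] s0 unfolding nx_def by (cases "k = 0") auto
    define \<phi> where "\<phi> v = (SOME z. z \<in> Q v (s (ix v)))" for v
    have \<phi>: "\<phi> (vs ! k) \<in> Q (vs ! k) (s k)" if "k < n" for k
    proof -
      have "Q (vs ! k) (s k) \<noteq> {}" using Q_card[OF that, of "s k"] t(1) by auto
      then have "\<exists>z. z \<in> Q (vs ! k) (s k)" by blast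
      from someI_ex[OF this] show ?thesis unfolding \<phi>_def ix[OF that] .
    qed
    have \<phi>X: "\<forall>v\<in>V. \<phi> v \<in> X v" using \<phi> Q_sub ixV by blast
    have "\<not> inc H f \<subseteq> \<phi> ` V" if f: "f \<in> edges H" for f
    proof
      assume sub: "inc H f \<subseteq> \<phi> ` V"
      obtain k r x y where k: "k < n" "r \<in> {1, -1}" "x \<in> Q (vs ! k) r" "y \<in> Q (vs ! nx k) (\<tau> k * r)" "inc H f = {x, y}"
        using edgeF[OF f] by blast
      have "\<phi> (vs ! k) = x"
        using disjoint_family_image_eq[OF disj \<phi>X nthV[OF k(1)], of x] k(3,5) Q_sub[OF k(1)] sub by blast
      moreover have "\<phi> (vs ! nx k) = y"
        using disjoint_family_image_eq[OF disj \<phi>X nthV[OF nx], of y] k(4,5) Q_sub[OF nx] sub by blast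
      ultimately have "x \<in> Q (vs ! k) (s k)" "y \<in> Q (vs ! nx k) (- (\<tau> k * s k))"
        using \<phi>[OF k(1)] \<phi>[OF nx, of k] step[OF k(1)] by simp_all
      moreover from this have "s k = r"
        using Q_dis[OF k(1,2)] k(2,3) s(1)[OF k(1)] by auto
      ultimately show False using Q_dis[OF nx \<tau>s[OF k(2)], of k k] k(4) by blast
    qed
    then have "ptrans X H V \<phi>" using \<phi>X unfolding ptrans_def by blast
    then show False using unc by blast
  qed
  have prod_eq: "(\<Prod>k<n. - \<tau> k) = (-1) ^ n * \<tau> ?l"
  proof -
    have "(\<Prod>k<n. - \<tau> k) = - \<tau> ?l * (\<Prod>k\<in>{..<n} - {?l}. - \<tau> k)"
      using l(1) by (subst prod.remove[of _ ?l]) auto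
    also have "(\<Prod>k\<in>{..<n} - {?l}. - \<tau> k) = (\<Prod>k\<in>{..<n} - {?l}. - 1)"
      by (rule prod.cong) (auto simp: \<tau>_def)
    also have "\<dots> = (-1) ^ (n - 1)" using l(1) by simp
    finally show ?thesis using n(2) by (cases n) auto
  qed
  have tC: "is_tC t n G"
    unfolding is_tC_def
  proof (intro conjI exI[of _ vs])
    show "is_tfold t (set vs) {{vs ! i, vs ! ((i + 1) mod n)} |i. i < n} G"
      unfolding is_tfold_def
    proof (intro conjI ballI)
      fix e assume e: "e \<in> E"
      obtain u where "u \<in> inc G e" using other_vertex[OF e] .
      then obtain v where "inc G e = {u, v}" "adj u v" using edge_pair[OF e] by metis
      moreover from this obtain k where "k < n" "{u, v} = {vs ! k, vs ! nx k}" using pairs by blast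
      ultimately show "inc G e \<in> {{vs ! i, vs ! ((i + 1) mod n)} |i. i < n}"
        unfolding nx_def by (intro CollectI exI[of _ k]) simp
    next
      fix a assume "a \<in> {{vs ! i, vs ! ((i + 1) mod n)} |i. i < n}"
      then obtain k where k: "k < n" "a = {vs ! k, vs ! nx k}" unfolding nx_def by auto
      then show "card {e \<in> E. inc G e = a} = t" using t(2)[OF cyc[OF k(1)]] unfolding mult_def by simp
    qed (use vs in simp)
  qed (use vs n n_def in auto)
  have adjp: "{u, v} \<in> adj_pairs G \<longleftrightarrow> adj u v" for u v
  proof
    assume "{u, v} \<in> adj_pairs G"
    then obtain a b where "{u, v} = {a, b}" "adj a b" unfolding adj_pairs_def using mult_pos by blast
    then show "adj u v" using adj_sym by (auto simp: doubleton_eq_iff)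
  qed (use adj_V mult_pos in \<open>auto simp: adj_pairs_def\<close>)
  define P where "P v i = Q v (if i = (1 :: nat) then 1 else -1)" for v i
  have part: "indexed_partition {1, 2} (P v) (X v)" if v: "v \<in> V" for v
  proof -
    obtain k where k: "k < n" "v = vs ! k" using ixV[OF v] by blast
    have "Q (vs ! k) 1 \<inter> Q (vs ! k) (-1) = {}" using Q_dis[OF k(1), of 1] by simp
    then show ?thesis
      using Q_un[OF k(1)] k(2) unfolding indexed_partition_def disjoint_family_on_def P_def by auto
  qed
  have P_sub: "P v i \<subseteq> X v" if "v \<in> V" for v i using ixV[OF that] Q_sub unfolding P_def by blast
  \<comment> \<open>Any family of induced subgraphs that includes all the bipartite graphs will do,
    so one argument serves the odd and the even form.\<close>
  have union: "is_union H S" if S1: "\<And>K. K \<in> S \<Longrightarrow> \<exists>Y\<subseteq>verts H. K = induced H Y"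
    and S2: "\<And>k s. k < n \<Longrightarrow> s \<in> {1, -1} \<Longrightarrow> induced H (?B k s) \<in> S" for S
    unfolding is_union_def
  proof (intro conjI equalityI)
    show "verts H \<subseteq> (\<Union>K\<in>S. verts K)"
    proof
      fix x assume "x \<in> verts H"
      then obtain v where "v \<in> V" "x \<in> X v" using vertsH by blast
      then obtain k where k: "k < n" "x \<in> X (vs ! k)" using ixV by blast
      then obtain s where s: "s \<in> {1, -1}" "x \<in> Q (vs ! k) s" using Q_un by blast
      then have "x \<in> verts (induced H (?B k s))" by simp
      then show "x \<in> (\<Union>K\<in>S. verts K)" using S2[OF k(1) s(1)] by blast
    qed
    show "edges H \<subseteq> (\<Union>K\<in>S. edges K)"
    proof
      fix f assume f: "f \<in> edges H"
      then obtain k s x y where k: "k < n" "s \<in> {1, -1}" "x \<in> Q (vs ! k) s" "y \<in> Q (vs ! nx k) (\<tau> k * s)" "inc H f = {x, y}"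
        using edgeF[OF f] by blast
      then have "f \<in> edges (induced H (?B k s))" using f by simp
      then show "f \<in> (\<Union>K\<in>S. edges K)" using S2[OF k(1,2)] by blast
    qed
    show "\<forall>K\<in>S. \<forall>e\<in>edges K. inc H e = inc K e" using S1 by fastforce
    show "(\<Union>K\<in>S. verts K) \<subseteq> verts H" using S1 by fastforce
    show "(\<Union>K\<in>S. edges K) \<subseteq> edges H" using S1 by fastforce
  qed
  have VH: "P v i \<subseteq> verts H" if "v \<in> V" for v i using P_sub[OF that] vertsH that by blast
  have P1: "P v 1 = Q v 1" "P v 2 = Q v (-1)" for v unfolding P_def by simp_all
  have straight: "is_K_multipartite 2 t {P u i, P v i} (induced H (P u i \<union> P v i))"
    if "{u, v} = {vs ! k, vs ! nx k}" "k < n" "\<tau> k = 1" for u v i k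
  proof -
    have "(if i = (1::nat) then 1 else -1) \<in> {1, -1 :: int}" by simp
    from bip[OF that(2) this] have "is_K_multipartite 2 t {P (vs ! k) i, P (vs ! nx k) i} (induced H (P (vs ! k) i \<union> P (vs ! nx k) i))"
      using that(3) unfolding P_def by simp
    then show ?thesis using that(1) by (auto simp: doubleton_eq_iff insert_commute Un_commute)
  qed
  have BP: "induced H (?B k s) = induced H (P (vs ! k) (if s = 1 then 1 else 2) \<union> P (vs ! nx k) (if s = 1 then 1 else 2))"
    if "s \<in> {1, -1}" "\<tau> k = 1" for k s
    using that unfolding P_def by auto
  show ?thesis
  proof (cases "R = Q0")
    case True
    then have \<tau>1: "\<tau> k = 1" for k unfolding \<tau>_def by simp
    have "odd n" using prod_ne prod_eq \<tau>1 by auto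
    \<comment> \<open>Triangles are already excluded, so the cycle has length at least 4, and an odd
      one has length at least 5.\<close>
    then have "n \<ge> 5" using n(1) by (cases "n = 4") auto
    have "odd_C_configuration G X H"
      unfolding odd_C_configuration_def
    proof (rule conjI[OF F], rule exI[of _ t], rule exI[of _ n],
        rule conjI[OF t(1)], rule conjI[OF \<open>n \<ge> 5\<close>], rule conjI[OF \<open>odd n\<close>], rule conjI[OF tC],
        rule exI[of _ P], intro conjI ballI allI impI)
      show "is_K_multipartite 2 t {P u i, P v i} (induced H (P u i \<union> P v i))"
        if "{u, v} \<in> adj_pairs G" for u v i
        using pairs[of u v] adjp[of u v] that straight \<tau>1 by blast
      show "is_union H {induced H (P u i \<union> P v i) |u v i. i \<in> {1, 2} \<and> {u, v} \<in> adj_pairs G}" (is "is_union H ?S")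
      proof (rule union)
        show "\<exists>Y\<subseteq>verts H. K = induced H Y" if K: "K \<in> ?S" for K
        proof -
          obtain u v i where "K = induced H (P u i \<union> P v i)" "{u, v} \<in> adj_pairs G" using K by blast
          then show ?thesis using VH adj_V adjp by (intro exI[of _ "P u i \<union> P v i"]) blast
        qed
        show "induced H (?B k s) \<in> ?S" if "k < n" "s \<in> {1, -1}" for k s
          unfolding BP[OF that(2) \<tau>1] using adjp cyc[OF that(1)] by auto
      qed
    qed (rule part)
    then show ?thesis unfolding C_configuration_def by blast
  next
    case False
    then have \<tau>l: "\<tau> ?l = -1" unfolding \<tau>_def by simp
    have \<tau>1: "\<tau> k = 1" if "k \<noteq> ?l" for k using that unfolding \<tau>_def by simp
    have "even n" using prod_ne prod_eq \<tau>l by (cases "even n") auto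
    let ?w = "vs ! ?l"
    have BL: "?B ?l 1 = P ?w 1 \<union> P ?v0 2" "?B ?l (-1) = P ?w 2 \<union> P ?v0 1"
      using \<tau>l l(2) unfolding P1 by simp_all
    have other: "\<exists>k<n. {u, v} = {vs ! k, vs ! nx k} \<and> \<tau> k = 1" if uv: "{u, v} \<in> adj_pairs G - {{?w, ?v0}}" for u v
    proof -
      have "adj u v" using uv adjp[of u v] by blast
      from pairs[OF this] obtain k where k: "k < n \<and> {u, v} = {vs ! k, vs ! nx k}" ..
      have "k \<noteq> ?l"
      proof
        assume "k = ?l"
        then have "{u, v} = {?w, ?v0}" using k l(2) by simp
        then show False using uv by simp
      qed
      then have "\<tau> k = 1" by (rule \<tau>1)
      then show ?thesis using k by (intro exI[of _ k]) simp
    qed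
    have neq: "{vs ! k, vs ! nx k} \<noteq> {?w, ?v0}" if k: "k < n" "k \<noteq> ?l" for k
    proof
      assume "{vs ! k, vs ! nx k} = {?w, ?v0}"
      then have "vs ! k = ?v0 \<and> vs ! nx k = ?w"
        using k l nth_eq_iff_index_eq[OF vs(1)] unfolding n_def by (auto simp: doubleton_eq_iff)
      then have "k = 0" "nx k = ?l"
        using k l(1) n(2) nx nth_eq_iff_index_eq[OF vs(1)] unfolding n_def by blast+
      then show False using nx'[of 0] n(1) by (auto split: if_splits)
    qed
    have "even_C_configuration G X H"
      unfolding even_C_configuration_def
    proof (rule conjI[OF F], rule exI[of _ t], rule exI[of _ n],
        rule conjI[OF t(1)], rule conjI[OF n(1)], rule conjI[OF \<open>even n\<close>], rule conjI[OF tC],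
        rule exI[of _ P], rule exI[of _ ?w], rule exI[of _ ?v0], intro conjI ballI allI impI)
      show "{?w, ?v0} \<in> adj_pairs G" using adjp adjl by blast
      show "is_K_multipartite 2 t {P u i, P v i} (induced H (P u i \<union> P v i))"
        if "{u, v} \<in> adj_pairs G - {{?w, ?v0}}" for u v i
        using other[OF that] straight by blast
      show "is_K_multipartite 2 t {P ?w 1, P ?v0 2} (induced H (P ?w 1 \<union> P ?v0 2))"
        using bip[OF l(1), of 1] BL(1) \<tau>l l(2) unfolding P1 by simp
      show "is_K_multipartite 2 t {P ?w 2, P ?v0 1} (induced H (P ?w 2 \<union> P ?v0 1))"
        using bip[OF l(1), of "-1"] BL(2) \<tau>l l(2) unfolding P1 by simp
      show "is_union H ({induced H (P u i \<union> P v i) |u v i. i \<in> {1, 2} \<and> {u, v} \<in> adj_pairs G - {{?w, ?v0}}} \<union>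
        {induced H (P ?w 1 \<union> P ?v0 2), induced H (P ?w 2 \<union> P ?v0 1)})" (is "is_union H (?S \<union> ?S')")
      proof (rule union)
        have wV: "?w \<in> V" "?v0 \<in> V" using nthV l(1) n(2) by blast+
        show "\<exists>Y\<subseteq>verts H. K = induced H Y" if K: "K \<in> ?S \<union> ?S'" for K
        proof -
          consider u v i where "K = induced H (P u i \<union> P v i)" "{u, v} \<in> adj_pairs G"
            | "K = induced H (P ?w 1 \<union> P ?v0 2)" | "K = induced H (P ?w 2 \<union> P ?v0 1)" using K by blast
          then show ?thesis
          proof cases
            case (1 u v i)
            then show ?thesis using VH adj_V adjp by (intro exI[of _ "P u i \<union> P v i"]) blast
          next
            case 2
            then show ?thesis using VH[OF wV(1), of 1] VH[OF wV(2), of 2] by blast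
          next
            case 3
            then show ?thesis using VH[OF wV(1), of 2] VH[OF wV(2), of 1] by blast
          qed
        qed
        show "induced H (?B k s) \<in> ?S \<union> ?S'" if k: "k < n" and s: "s \<in> {1, -1}" for k s
        proof (cases "k = ?l")
          case True
          from s consider "s = 1" | "s = -1" by blast
          then show ?thesis using BL unfolding True by cases auto
        next
          case False
          have "{vs ! k, vs ! nx k} \<in> adj_pairs G - {{?w, ?v0}}" using adjp cyc[OF k] neq[OF k False] by blast
          moreover have "(if s = 1 then 1 else 2 :: nat) \<in> {1, 2}" by simp
          ultimately show ?thesis unfolding BP[OF s \<tau>1[OF False]] by blast
        qed
      qed
    qed (rule part)
    then show ?thesis unfolding C_configuration_def by blast
  qed
qed

end

section \<open>Splitting at a separating vertex\<close>

context uncol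
begin

definition splits :: "'a \<Rightarrow> 'a set \<Rightarrow> 'a set \<Rightarrow> bool" where
  "splits v A B \<longleftrightarrow> v \<in> V \<and> A \<union> B = V - {v} \<and> A \<inter> B = {} \<and> A \<noteq> {} \<and> B \<noteq> {} \<and>
     (\<forall>e\<in>E. inc G e \<inter> A = {} \<or> inc G e \<inter> B = {})"

definition part_edges :: "'a set \<Rightarrow> 'b set" where
  "part_edges A = {e \<in> E. inc G e \<inter> A \<noteq> {}}"

text \<open>The blocked colours are read off from one arbitrary hole at \<open>v\<close>;
  \<open>part_blocks\<close> shows that they remain blocked from this side whatever its
  colouring.\<close>

definition part_colors :: "'a \<Rightarrow> 'a set \<Rightarrow> 'c set" where
  "part_colors v A = {x \<in> X v. \<exists>e\<in>part_edges A. v \<in> inc G e \<and>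
     blocks (SOME \<phi>. ptrans X H (V - {v}) \<phi>) v x e}"

text \<open>The separating vertex gets a new name \<open>u\<close> in each part, because merging
  starts from disjoint vertex sets and produces a vertex belonging to neither.\<close>

definition part_G :: "'a \<Rightarrow> 'a set \<Rightarrow> 'a \<Rightarrow> ('a, 'b) hypergraph" where
  "part_G v A u = \<lparr>verts = insert u A, edges = part_edges A,
     inc = \<lambda>e. (if v \<in> inc G e then insert u (inc G e - {v}) else inc G e)\<rparr>"

definition part_X :: "'a \<Rightarrow> 'a set \<Rightarrow> 'a \<Rightarrow> 'a \<Rightarrow> 'c set" where
  "part_X v A u = X(u := part_colors v A)"

text \<open>Edges that reach a colour of \<open>v\<close> assigned to the other side are left out.
  Minimality of the configuration shows later that no edge of \<open>H\<close> is lost in this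
  way.\<close>

definition part_H :: "'a \<Rightarrow> 'a set \<Rightarrow> ('c, 'd) hypergraph" where
  "part_H v A = \<lparr>verts = part_colors v A \<union> (\<Union>a\<in>A. X a),
     edges = {f \<in> edges H. (\<exists>e\<in>part_edges A. f \<in> M e) \<and> inc H f \<subseteq> part_colors v A \<union> (\<Union>a\<in>A. X a)},
     inc = inc H\<rparr>"

lemma splits_sym: "splits v A B \<Longrightarrow> splits v B A"
  unfolding splits_def by blast

lemma splitsD:
  assumes "splits v A B"
  shows "v \<in> V" "A \<subseteq> V" "B \<subseteq> V" "v \<notin> A" "v \<notin> B" "A \<inter> B = {}" "A \<noteq> {}" "B \<noteq> {}"
    "V = insert v (A \<union> B)"
  using assms unfolding splits_def by blast+

lemma part_edge_inc:
  assumes "splits v A B" "e \<in> part_edges A"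
  shows "e \<in> E" "inc G e \<subseteq> insert v A"
proof -
  show e: "e \<in> E" using assms(2) unfolding part_edges_def by blast
  have "inc G e \<inter> B = {}" using assms e unfolding splits_def part_edges_def by blast
  then show "inc G e \<subseteq> insert v A" using splitsD(9)[OF assms(1)] incV[OF e] by blast
qed

lemma part_edges_Un:
  assumes "splits v A B"
  shows "E = part_edges A \<union> part_edges B" "part_edges A \<inter> part_edges B = {}"
proof -
  show "E = part_edges A \<union> part_edges B"
  proof (intro equalityI subsetI)
    fix e assume e: "e \<in> E"
    obtain w where "w \<in> inc G e" "w \<noteq> v" using other_vertex[OF e] .
    then show "e \<in> part_edges A \<union> part_edges B"
      using splitsD(9)[OF assms] incV[OF e] e unfolding part_edges_def by blast
  qed (auto simp: part_edges_def)
  show "part_edges A \<inter> part_edges B = {}" using assms unfolding splits_def part_edges_def by blast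
qed

lemma blocks_cong:
  assumes "\<And>w. w \<in> inc G e \<Longrightarrow> w \<noteq> v \<Longrightarrow> \<phi> w = \<psi> w"
  shows "blocks \<phi> v x e \<longleftrightarrow> blocks \<psi> v x e"
  unfolding blocks_def using assms by auto

lemma ptrans_mono:
  assumes "ptrans X K S \<phi>" "T \<subseteq> S" shows "ptrans X K T \<phi>"
  using assms unfolding ptrans_def by (meson image_mono order_trans subsetD)

abbreviation "base v \<equiv> (SOME \<phi>. ptrans X H (V - {v}) \<phi>)"

lemma base: "v \<in> V \<Longrightarrow> ptrans X H (V - {v}) (base v)"
  using someI_ex[OF ptrans_minus_vertex] .

text \<open>In the chosen hole every colour of \<open>v\<close> is blocked by exactly one edge, and
  every edge lies on exactly one side.\<close>

lemma part_colors_Un: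
  assumes s: "splits v A B"
  shows "X v = part_colors v A \<union> part_colors v B" "part_colors v A \<inter> part_colors v B = {}"
proof -
  note b = base[OF splitsD(1)[OF s]] and v = splitsD(1)[OF s] and EU = part_edges_Un[OF s]
  show "X v = part_colors v A \<union> part_colors v B"
  proof (intro equalityI subsetI)
    fix x assume x: "x \<in> X v"
    obtain e where "e \<in> E" "v \<in> inc G e" "blocks (base v) v x e" using exact_color[OF v b x] .
    then show "x \<in> part_colors v A \<union> part_colors v B"
      using x EU(1) unfolding part_colors_def by blast
  qed (auto simp: part_colors_def)
  show "part_colors v A \<inter> part_colors v B = {}"
  proof (rule ccontr)
    assume "part_colors v A \<inter> part_colors v B \<noteq> {}"
    then obtain x e e' where x: "x \<in> X v" "e \<in> part_edges A" "v \<in> inc G e" "blocks (base v) v x e"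
      "e' \<in> part_edges B" "v \<in> inc G e'" "blocks (base v) v x e'"
      unfolding part_colors_def by blast
    then have "e = e'" using exact_unique[OF v b x(1) _ x(3,4) _ x(6,7)] EU(1) by blast
    then show False using EU(2) x(2,5) by blast
  qed
qed

text \<open>The bijection between colours and edges at \<open>v\<close> restricts to each side; this
  is the degree condition at the copy of \<open>v\<close>.\<close>

lemma card_part_colors:
  assumes s: "splits v A B"
  shows "card (part_colors v A) = card {e \<in> part_edges A. v \<in> inc G e}"
proof -
  note b = base[OF splitsD(1)[OF s]] and v = splitsD(1)[OF s]
  obtain g where g: "bij_betw g (X v) {e \<in> E. v \<in> inc G e}"
    "\<And>x e. x \<in> X v \<Longrightarrow> e \<in> E \<Longrightarrow> v \<in> inc G e \<Longrightarrow> blocks (base v) v x e \<longleftrightarrow> e = g x"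
    using exact[OF v b] by blast
  have "g ` part_colors v A = {e \<in> part_edges A. v \<in> inc G e}"
  proof (intro equalityI subsetI)
    fix e assume "e \<in> g ` part_colors v A"
    then obtain x e' where x: "x \<in> X v" "e = g x" "e' \<in> part_edges A" "v \<in> inc G e'" "blocks (base v) v x e'"
      unfolding part_colors_def by blast
    then have "e' = e" using g(2)[OF x(1) _ x(4)] part_edge_inc(1)[OF s x(3)] by blast
    then show "e \<in> {e \<in> part_edges A. v \<in> inc G e}" using x by blast
  next
    fix e assume e: "e \<in> {e \<in> part_edges A. v \<in> inc G e}"
    then have e': "e \<in> E" "v \<in> inc G e" using part_edge_inc(1)[OF s] by blast+
    then obtain x where x: "x \<in> X v" "e = g x" using g(1) unfolding bij_betw_def by blast
    then have "blocks (base v) v x e" using g(2)[OF x(1) e'] by blast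
    then show "e \<in> g ` part_colors v A" using x e unfolding part_colors_def by blast
  qed
  moreover have "inj_on g (part_colors v A)"
    using g(1) unfolding bij_betw_def part_colors_def by (auto intro: inj_on_subset)
  ultimately show ?thesis using card_image by metis
qed

text \<open>The colours blocked from the side of \<open>A\<close> are those not blocked from the side of \<open>B\<close>;
  recolouring one side does not affect the other, so they do not depend on the colouring.\<close>

lemma part_blocks:
  assumes s: "splits v A B" and \<psi>: "ptrans X H A \<psi>" and x: "x \<in> part_colors v A"
  shows "\<exists>e\<in>part_edges A. v \<in> inc G e \<and> blocks \<psi> v x e"
proof -
  note S = splitsD[OF s]
  note b = base[OF S(1)]
  have xX: "x \<in> X v" using x unfolding part_colors_def by blast
  define \<phi> where "\<phi> u = (if u \<in> A then \<psi> u else base v u)" for u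
  have "ptrans X H (V - {v}) \<phi>"
  proof -
    have V: "V - {v} = A \<union> B" using S by blast
    have pA: "ptrans X H A \<phi>" using \<psi> by (subst ptrans_cong[of _ _ \<psi>]) (auto simp: \<phi>_def)
    have "ptrans X H B (base v)" using ptrans_mono[OF b] V by blast
    then have pB: "ptrans X H B \<phi>" using S(6) by (subst ptrans_cong[of _ _ "base v"]) (auto simp: \<phi>_def)
    have "\<exists>w\<in>inc G e. \<phi> w \<notin> inc H f" if e: "e \<in> E" "inc G e \<subseteq> V - {v}" "f \<in> M e" for e f
    proof -
      have "inc G e \<subseteq> A \<or> inc G e \<subseteq> B" using s e(1,2) unfolding splits_def by blast
      then show ?thesis using pA pB e ptrans_iff[OF S(2)] ptrans_iff[OF S(3)] by blast
    qed
    moreover have "\<forall>u\<in>V - {v}. \<phi> u \<in> X u" using pA pB V unfolding ptrans_def by auto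
    ultimately show ?thesis using ptrans_iff[of "V - {v}" \<phi>] by blast
  qed
  then obtain e where e: "e \<in> E" "v \<in> inc G e" "blocks \<phi> v x e" using exact_color[OF S(1) _ xX] by blast
  have "e \<in> part_edges A"
  proof (rule ccontr)
    assume "e \<notin> part_edges A"
    then have eB: "e \<in> part_edges B" using part_edges_Un[OF s] e(1) by blast
    then have "inc G e \<subseteq> insert v B" using part_edge_inc(2)[OF splits_sym[OF s]] by blast
    then have "blocks (base v) v x e"
      using e(3) S(6) by (subst blocks_cong[of _ _ _ \<phi>]) (auto simp: \<phi>_def)
    then have "x \<in> part_colors v B" using xX eB e(2) unfolding part_colors_def by blast
    then show False using x part_colors_Un(2)[OF s] by blast
  qed
  moreover have "blocks \<psi> v x e"
    using e(3) part_edge_inc(2)[OF s \<open>e \<in> part_edges A\<close>]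
    by (subst blocks_cong[of _ _ _ \<phi>]) (auto simp: \<phi>_def)
  ultimately show ?thesis using e(2) by blast
qed

lemma part_H_simps [simp]:
  "verts (part_H v A) = part_colors v A \<union> (\<Union>a\<in>A. X a)" "inc (part_H v A) = inc H"
  "edges (part_H v A) \<subseteq> edges H"
  unfolding part_H_def by auto

lemma part_H_sub: "f \<in> edges (part_H v A) \<Longrightarrow> f \<in> edges H"
  unfolding part_H_def by simp

lemma part_H_edge:
  assumes "f \<in> edges (part_H v A)"
  obtains e where "e \<in> part_edges A" "f \<in> M e" "f \<in> edges H" "inc H f \<subseteq> verts (part_H v A)"
  using assms unfolding part_H_def by auto

lemma part_H_edgeI:
  assumes "e \<in> part_edges A" "f \<in> M e" "inc H f \<subseteq> verts (part_H v A)"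
  shows "f \<in> edges (part_H v A)"
  using assms edgesH unfolding part_H_def part_edges_def by auto

text \<open>A colouring of the part also colours \<open>A\<close> in \<open>H\<close>, so an edge of
  this side blocks the colour chosen at \<open>u\<close>. The blocking edge of \<open>H\<close> uses
  only colours of this part and is contained in the colouring.\<close>

lemma part_uncolorable:
  assumes s: "splits v A B" and u: "u \<notin> V"
  shows "\<not> ptrans (part_X v A u) (part_H v A) (insert u A) \<psi>"
proof
  assume \<psi>: "ptrans (part_X v A u) (part_H v A) (insert u A) \<psi>"
  note S = splitsD[OF s]
  have uA: "u \<notin> A" using u S(2) by blast
  have \<psi>X: "\<psi> a \<in> X a" if "a \<in> A" for a
  proof -
    have "a \<noteq> u" using that uA by blast
    moreover have "\<psi> a \<in> part_X v A u a" using \<psi> that unfolding ptrans_def by blast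
    ultimately show ?thesis unfolding part_X_def by simp
  qed
  have \<psi>u: "\<psi> u \<in> part_colors v A" using \<psi> unfolding ptrans_def part_X_def by auto
  then have \<psi>uX: "\<psi> u \<in> X v" unfolding part_colors_def by blast
  have no: "\<not> inc H f \<subseteq> \<psi> ` insert u A" if "f \<in> edges (part_H v A)" for f
    using \<psi> that unfolding ptrans_def by simp
  have "ptrans X H A \<psi>"
    unfolding ptrans_iff[OF S(2)]
  proof (intro conjI ballI impI)
    fix e f assume e: "e \<in> E" "inc G e \<subseteq> A" "f \<in> M e"
    show "\<exists>w\<in>inc G e. \<psi> w \<notin> inc H f"
    proof (rule ccontr)
      assume "\<not> ?thesis"
      then have sub: "inc H f \<subseteq> \<psi> ` A" using inc_subset_image_iff[OF S(2) _ e(1,3)] \<psi>X e(2) by blast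
      have "e \<in> part_edges A" using other_vertex[OF e(1)] e unfolding part_edges_def by blast
      moreover have "inc H f \<subseteq> verts (part_H v A)" using sub \<psi>X by auto
      ultimately have "f \<in> edges (part_H v A)" using part_H_edgeI e(3) by blast
      then show False using no sub by blast
    qed
  qed (use \<psi>X in auto)
  then obtain e where e: "e \<in> part_edges A" "v \<in> inc G e" "blocks \<psi> v (\<psi> u) e"
    using part_blocks[OF s _ \<psi>u] by blast
  note eE = part_edge_inc[OF s e(1)]
  obtain f where f: "f \<in> M e" "\<psi> u \<in> inc H f" "\<forall>w\<in>inc G e - {v}. \<psi> w \<in> inc H f"
    using e(3) unfolding blocks_def by blast
  have sub: "inc H f \<subseteq> \<psi> ` insert u A"
  proof
    fix z assume z: "z \<in> inc H f"
    then obtain w where w: "w \<in> inc G e" "z \<in> X w" using M_sub[OF eE(1) f(1)] by blast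
    show "z \<in> \<psi> ` insert u A"
    proof (cases "w = v")
      case True
      then have "z = \<psi> u" using M_single[OF eE(1) f(1) e(2) z _ f(2) \<psi>uX] w by blast
      then show ?thesis by blast
    next
      case False
      then have "w \<in> A" using eE(2) w(1) by blast
      then have "z = \<psi> w" using M_single[OF eE(1) f(1) w(1) z w(2)] f(3) w(1) False \<psi>X by blast
      then show ?thesis using \<open>w \<in> A\<close> by blast
    qed
  qed
  then have "inc H f \<subseteq> verts (part_H v A)" using \<psi>X \<psi>u by auto
  then show False using no sub part_H_edgeI[OF e(1) f(1)] by blast
qed

text \<open>Copying the colour of \<open>v\<close> to \<open>u\<close> does not enlarge the image.
  The free \<open>K\<close> and \<open>K1\<close> admit both a whole part and a part with the same
  edge deleted as in \<open>H\<close>.\<close>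

lemma part_restrict:
  assumes s: "splits v A B" and u: "u \<notin> V" and \<psi>: "ptrans X K V \<psi>" "\<psi> v \<in> part_colors v A"
    and K: "edges K1 \<subseteq> edges K" "inc K = inc H" "inc K1 = inc H"
  shows "ptrans (part_X v A u) K1 (insert u A) (\<psi>(u := \<psi> v))"
proof -
  note S = splitsD[OF s]
  have "(\<psi>(u := \<psi> v)) ` insert u A \<subseteq> \<psi> ` V" using S by auto
  moreover have "(\<psi>(u := \<psi> v)) a \<in> part_X v A u a" if "a \<in> insert u A" for a
    using that \<psi> S(2) unfolding part_X_def ptrans_def by auto
  ultimately show ?thesis using \<psi>(1) K unfolding ptrans_def by (metis order_trans subsetD)
qed

lemma part_H_at:
  assumes "splits v A B" "z \<in> verts (part_H v A)" "z \<in> X v"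
  shows "z \<in> part_colors v A"
proof (rule ccontr)
  note S = splitsD[OF assms(1)]
  assume "z \<notin> part_colors v A"
  then obtain a where a: "a \<in> A" "z \<in> X a" using assms(2) by auto
  then have "a = v" using X_unique[OF a(2) assms(3) _ S(1)] S(2) by blast
  then show False using a(1) S(4) by blast
qed

lemma part_H_disjoint:
  assumes s: "splits v A B"
  shows "verts (part_H v A) \<inter> verts (part_H v B) = {}" "edges (part_H v A) \<inter> edges (part_H v B) = {}"
proof -
  note S = splitsD[OF s]
  have c: "part_colors v C \<subseteq> X v" for C unfolding part_colors_def by blast
  have "X a \<inter> X b = {}" if "a \<in> V" "b \<in> V" "a \<noteq> b" for a b using X_unique that by blast
  then have "X a \<inter> X b = {}" "X a \<inter> X v = {}" "X b \<inter> X v = {}" if "a \<in> A" "b \<in> B" for a b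
    using that S by blast+
  then show d: "verts (part_H v A) \<inter> verts (part_H v B) = {}"
    unfolding part_H_simps using c part_colors_Un(2)[OF s] S(7,8) by blast
  show "edges (part_H v A) \<inter> edges (part_H v B) = {}"
    using d wf_hypergraph_inc(3)[OF wfH] part_H_edge by (metis (no_types, lifting) disjoint_iff Int_greatest subset_empty)
qed

text \<open>Colour \<open>H\<close> without \<open>f\<close>. If the colour of \<open>v\<close>
  belonged to the side \<open>B\<close>, that part, which does not contain \<open>f\<close>, would
  be coloured; so it belongs to \<open>A\<close>, and the colouring restricts to the part of
  \<open>A\<close>.\<close>

lemma part_minimal:
  assumes s: "splits v A B" and fresh: "u \<notin> V"
    and min: "\<And>f. f \<in> edges H \<Longrightarrow> \<exists>\<psi>. ptrans X (delete_edge H f) V \<psi>"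
    and f: "f \<in> edges (part_H v A)"
  shows "\<exists>\<psi>. ptrans (part_X v A u) (delete_edge (part_H v A) f) (insert u A) \<psi>"
proof -
  note S = splitsD[OF s]
  have fH: "f \<in> edges H" using f by (rule part_H_sub)
  obtain \<psi> where \<psi>: "ptrans X (delete_edge H f) V \<psi>" using min[OF fH] by blast
  have "\<psi> v \<in> X v" using \<psi> S(1) unfolding ptrans_def by blast
  then have "\<psi> v \<in> part_colors v A \<or> \<psi> v \<in> part_colors v B" using part_colors_Un(1)[OF s] by blast
  then show ?thesis
  proof
    assume "\<psi> v \<in> part_colors v A"
    then have "ptrans (part_X v A u) (delete_edge (part_H v A) f) (insert u A) (\<psi>(u := \<psi> v))"
      by (intro part_restrict[OF s fresh \<psi>]) (auto dest: part_H_sub)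
    then show ?thesis by blast
  next
    assume "\<psi> v \<in> part_colors v B"
    then have "ptrans (part_X v B u) (part_H v B) (insert u B) (\<psi>(u := \<psi> v))"
      using part_H_disjoint(2)[OF s] f
      by (intro part_restrict[OF splits_sym[OF s] fresh \<psi>]) (auto dest: part_H_sub)
    then show ?thesis using part_uncolorable[OF splits_sym[OF s] fresh] by blast
  qed
qed

text \<open>Deleting an edge outside both parts would make \<open>H\<close> colorable, and the side
  owning the colour of \<open>v\<close> would be coloured with all its edges present.\<close>

lemma part_edges_cover:
  assumes s: "splits v A B" and fresh: "u \<notin> V"
    and min: "\<And>f. f \<in> edges H \<Longrightarrow> \<exists>\<psi>. ptrans X (delete_edge H f) V \<psi>"
  shows "edges H = edges (part_H v A) \<union> edges (part_H v B)"
proof (intro equalityI subsetI)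
  note S = splitsD[OF s]
  fix f assume f: "f \<in> edges H"
  show "f \<in> edges (part_H v A) \<union> edges (part_H v B)"
  proof (rule ccontr)
    assume n: "f \<notin> edges (part_H v A) \<union> edges (part_H v B)"
    obtain \<psi> where \<psi>: "ptrans X (delete_edge H f) V \<psi>" using min[OF f] by blast
    have "\<psi> v \<in> X v" using \<psi> S(1) unfolding ptrans_def by blast
    then have "\<psi> v \<in> part_colors v A \<or> \<psi> v \<in> part_colors v B" using part_colors_Un(1)[OF s] by blast
    then show False
    proof
      assume "\<psi> v \<in> part_colors v A"
      then have "ptrans (part_X v A u) (part_H v A) (insert u A) (\<psi>(u := \<psi> v))"
        using n by (intro part_restrict[OF s fresh \<psi>]) (auto dest: part_H_sub)
      then show ?thesis using part_uncolorable[OF s fresh] by blast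
    next
      assume "\<psi> v \<in> part_colors v B"
      then have "ptrans (part_X v B u) (part_H v B) (insert u B) (\<psi>(u := \<psi> v))"
        using n by (intro part_restrict[OF splits_sym[OF s] fresh \<psi>]) (auto dest: part_H_sub)
      then show ?thesis using part_uncolorable[OF splits_sym[OF s] fresh] by blast
    qed
  qed
qed (auto dest: part_H_sub)

lemma part_G_simps [simp]:
  "verts (part_G v A u) = insert u A" "edges (part_G v A u) = part_edges A"
  "inc (part_G v A u) e = (if v \<in> inc G e then insert u (inc G e - {v}) else inc G e)"
  unfolding part_G_def by simp_all

lemma part_G_mem:
  assumes "splits v A B" "u \<notin> V" "e \<in> part_edges A"
  shows "a \<in> A \<Longrightarrow> a \<in> inc (part_G v A u) e \<longleftrightarrow> a \<in> inc G e"
    "u \<in> inc (part_G v A u) e \<longleftrightarrow> v \<in> inc G e" "inc (part_G v A u) e \<subseteq> insert u A"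
    "card (inc (part_G v A u) e) = card (inc G e)"
proof -
  note e = part_edge_inc[OF assms(1,3)] and S = splitsD[OF assms(1)]
  show "a \<in> A \<Longrightarrow> a \<in> inc (part_G v A u) e \<longleftrightarrow> a \<in> inc G e" using S assms(2) by auto
  show "u \<in> inc (part_G v A u) e \<longleftrightarrow> v \<in> inc G e" using incV[OF e(1)] assms(2) by auto
  show "inc (part_G v A u) e \<subseteq> insert u A" using e(2) by auto
  show "card (inc (part_G v A u) e) = card (inc G e)"
    using incV[OF e(1)] assms(2) inc_finite[OF e(1)]
    by (auto simp: card_insert_if card_Diff_singleton) (metis One_nat_def Suc_pred card_gt_0_iff empty_iff)
qed

lemma part_wf:
  assumes s: "splits v A B" and u: "u \<notin> V"
  shows "wf_hypergraph (part_G v A u)"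
  unfolding wf_hypergraph_def
proof (intro conjI ballI)
  show "finite (verts (part_G v A u))" using splitsD(2)[OF s] finV by (auto intro: finite_subset)
  show "finite (edges (part_G v A u))" using finE by (simp add: part_edges_def)
  fix e assume "e \<in> edges (part_G v A u)"
  then have e: "e \<in> part_edges A" by simp
  show "inc (part_G v A u) e \<subseteq> verts (part_G v A u)" using part_G_mem(3)[OF s u e] by simp
  show "2 \<le> card (inc (part_G v A u) e)"
    unfolding part_G_mem(4)[OF s u e] using wf_hypergraph_inc(2)[OF wfG part_edge_inc(1)[OF s e]] .
qed

text \<open>Passing to the complement, the cut may be taken to avoid \<open>u\<close>. It is then a
  cut of \<open>G\<close> inside \<open>A\<close>, and an edge of \<open>G\<close> crossing it stays
  within \<open>A\<close> and \<open>v\<close>.\<close>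

lemma part_connected:
  assumes s: "splits v A B" and u: "u \<notin> V"
  shows "cut_connected (part_G v A u)"
  unfolding cut_connected_def
proof (intro allI impI)
  note S = splitsD[OF s]
  have uA: "u \<notin> A" using u S by blast
  have main: "\<exists>e\<in>part_edges A. inc (part_G v A u) e \<inter> T \<noteq> {} \<and> inc (part_G v A u) e \<inter> (insert u A - T) \<noteq> {}"
    if T: "T \<subseteq> A" "T \<noteq> {}" for T
  proof -
    have "T \<subseteq> V" "T \<noteq> V" using T S by blast+
    then obtain e p q where e: "e \<in> E" "p \<in> inc G e" "p \<in> T" "q \<in> inc G e" "q \<in> V - T"
      using conn T(2) unfolding cut_connected_def by blast
    have eA: "e \<in> part_edges A" using e T unfolding part_edges_def by blast
    have "p \<in> inc (part_G v A u) e" using part_G_mem(1)[OF s u eA, of p] e(2,3) T by blast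
    moreover have "q = v \<or> q \<in> A" using part_edge_inc(2)[OF s eA] e(4) by blast
    then have "\<exists>q'\<in>insert u A - T. q' \<in> inc (part_G v A u) e"
      using part_G_mem(1)[OF s u eA, of q] part_G_mem(2)[OF s u eA] e(4,5) uA T by blast
    ultimately show ?thesis using eA e(3) by blast
  qed
  fix T assume T: "T \<subseteq> verts (part_G v A u)" "T \<noteq> {}" "T \<noteq> verts (part_G v A u)"
  show "\<exists>e\<in>edges (part_G v A u). inc (part_G v A u) e \<inter> T \<noteq> {} \<and>
      inc (part_G v A u) e \<inter> (verts (part_G v A u) - T) \<noteq> {}"
  proof (cases "u \<in> T")
    case False
    then have "T \<subseteq> A" using T(1) by auto
    then show ?thesis using main[OF _ T(2)] unfolding part_G_simps(1,2) by blast
  next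
    case True
    then have sub: "insert u A - T \<subseteq> A" "insert u A - T \<noteq> {}" using T by auto
    have co: "insert u A - (insert u A - T) = T" using T(1) by auto
    show ?thesis using main[OF sub] unfolding co part_G_simps(1,2) by blast
  qed
qed

lemma part_cover:
  assumes s: "splits v A B" and u: "u \<notin> V"
  shows "cover (part_G v A u) (part_X v A u) (part_H v A)"
  unfolding cover_def
proof (intro conjI)
  note S = splitsD[OF s]
  let ?G = "part_G v A u" and ?X = "part_X v A u" and ?H = "part_H v A"
  have uA: "u \<notin> A" using u S by blast
  have XA: "?X a = X a" if "a \<in> A" for a using that uA unfolding part_X_def by auto
  have Xu: "?X u = part_colors v A" unfolding part_X_def by simp
  have cX: "part_colors v A \<subseteq> X v" unfolding part_colors_def by blast
  show "wf_hypergraph ?H"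
    unfolding wf_hypergraph_def
  proof (intro conjI ballI)
    have "verts ?H \<subseteq> verts H" using cX S vertsH by auto
    then show "finite (verts ?H)" using wfH unfolding wf_hypergraph_def by (auto intro: finite_subset)
    show "finite (edges ?H)"
      using finite_subset[OF part_H_simps(3)] wfH unfolding wf_hypergraph_def by blast
    fix f assume f: "f \<in> edges ?H"
    then show "inc ?H f \<subseteq> verts ?H" using part_H_edge[OF f] by (metis part_H_simps(2))
    have "f \<in> edges H" using f by (rule part_H_sub)
    then show "2 \<le> card (inc ?H f)" using wf_hypergraph_inc(2)[OF wfH] by simp
  qed
  have XS: "\<exists>b\<in>V. ?X a \<subseteq> X b \<and> (b = (if a = u then v else a))" if "a \<in> insert u A" for a
    using that Xu XA cX S by auto
  show "disjoint_family_on ?X (verts ?G)"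
    unfolding disjoint_family_on_def
  proof (intro ballI impI)
    fix a b assume ab: "a \<in> verts ?G" "b \<in> verts ?G" "a \<noteq> b"
    obtain a' where a': "a' \<in> V" "?X a \<subseteq> X a'" "a' = (if a = u then v else a)" using XS[of a] ab by auto
    obtain b' where b': "b' \<in> V" "?X b \<subseteq> X b'" "b' = (if b = u then v else b)" using XS[of b] ab by auto
    have "a' \<noteq> b'" using a'(3) b'(3) ab S by (auto split: if_splits)
    then have "X a' \<inter> X b' = {}" using X_unique a'(1) b'(1) by blast
    then show "?X a \<inter> ?X b = {}" using a'(2) b'(2) by blast
  qed
  show "verts ?H = (\<Union>v\<in>verts ?G. ?X v)" using Xu XA by auto
  have single: "card (inc H f \<inter> ?X w) = 1"
    if e: "e \<in> part_edges A" and f: "f \<in> M e" "inc H f \<subseteq> verts ?H" and w: "w \<in> inc ?G e" for e f w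
  proof (cases "w = u")
    case True
    then have ve: "v \<in> inc G e" using w part_G_mem(2)[OF s u e] by blast
    have "z \<in> part_colors v A" if "z \<in> inc H f" "z \<in> X v" for z
      using part_H_at[OF s _ that(2)] f(2) that(1) by blast
    then have "inc H f \<inter> ?X w = inc H f \<inter> X v" using True Xu cX by blast
    then show ?thesis using M_card[OF part_edge_inc(1)[OF s e] f(1) ve] by simp
  next
    case False
    then have wA: "w \<in> A" using w part_G_mem(3)[OF s u e] by blast
    then have "w \<in> inc G e" using w part_G_mem(1)[OF s u e] by blast
    then show ?thesis using M_card[OF part_edge_inc(1)[OF s e] f(1)] XA[OF wA] by simp
  qed
  show "\<forall>w\<in>verts ?G. independent ?H (?X w)"
    unfolding independent_def
  proof (intro ballI conjI)
    fix w assume w: "w \<in> verts ?G"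
    then show "?X w \<subseteq> verts ?H" using Xu XA by auto
    show "edges (induced ?H (?X w)) = {}"
    proof (rule ccontr)
      assume "edges (induced ?H (?X w)) \<noteq> {}"
      then obtain f where f: "f \<in> edges ?H" "inc H f \<subseteq> ?X w" by auto
      obtain b where b: "b \<in> V" "?X w \<subseteq> X b" using XS[of w] w by auto
      obtain e where e: "e \<in> part_edges A" "f \<in> M e" using part_H_edge[OF f(1)] by metis
      note eE = part_edge_inc(1)[OF s e(1)]
      obtain c where c: "c \<in> inc G e" "c \<noteq> b" using other_vertex[OF eE] .
      obtain z where z: "z \<in> inc H f" "z \<in> X c" using M_point[OF eE e(2) c(1)] .
      have "c \<in> V" using c incV[OF eE] by blast
      then show False using X_unique[OF z(2) _ _ b(1)] z(1) f(2) b(2) c(2) by blast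
    qed
  qed
  show "\<exists>M. (\<forall>e\<in>edges ?G. matching (induced ?H (\<Union>v\<in>inc ?G e. ?X v)) (M e) \<and>
      (\<forall>f\<in>M e. \<forall>v\<in>inc ?G e. card (inc ?H f \<inter> ?X v) = 1)) \<and> edges ?H = (\<Union>e\<in>edges ?G. M e)"
  \<comment> \<open>The witnesses are the given matchings, cut down to the edges that use only
    colours of this part.\<close>
  proof (intro exI[of _ "\<lambda>e. {f \<in> M e. inc H f \<subseteq> verts ?H}"] conjI ballI)
    fix e assume "e \<in> edges ?G"
    then have e: "e \<in> part_edges A" by simp
    note eE = part_edge_inc[OF s e]
    show "matching (induced ?H (\<Union>v\<in>inc ?G e. ?X v)) {f \<in> M e. inc H f \<subseteq> verts ?H}"
      unfolding matching_def
    proof (intro conjI ballI impI)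
      show "{f \<in> M e. inc H f \<subseteq> verts ?H} \<subseteq> edges (induced ?H (\<Union>v\<in>inc ?G e. ?X v))"
      proof
        fix f assume "f \<in> {f \<in> M e. inc H f \<subseteq> verts ?H}"
        then have f: "f \<in> M e" "inc H f \<subseteq> verts ?H" by auto
        have "z \<in> (\<Union>v\<in>inc ?G e. ?X v)" if z: "z \<in> inc H f" for z
        proof -
          obtain w where w: "w \<in> inc G e" "z \<in> X w" using M_sub[OF eE(1) f(1)] z by blast
          show ?thesis
          proof (cases "w = v")
            case True
            then have "u \<in> inc ?G e" using part_G_mem(2)[OF s u e] w(1) by blast
            moreover have "z \<in> part_colors v A"
              using part_H_at[OF s, of z] f(2) z w(2) True by blast
            ultimately show ?thesis using Xu by blast
          next
            case False
            then have "w \<in> A" using w(1) eE(2) by blast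
            then show ?thesis using part_G_mem(1)[OF s u e] w XA by blast
          qed
        qed
        then have "inc H f \<subseteq> (\<Union>v\<in>inc ?G e. ?X v)" by blast
        then show "f \<in> edges (induced ?H (\<Union>v\<in>inc ?G e. ?X v))"
          using part_H_edgeI[OF e f] unfolding induced_simps part_H_simps(2) by blast
      qed
      fix f g assume "f \<in> {f \<in> M e. inc H f \<subseteq> verts ?H}" "g \<in> {f \<in> M e. inc H f \<subseteq> verts ?H}" "f \<noteq> g"
      then show "inc (induced ?H (\<Union>v\<in>inc ?G e. ?X v)) f \<inter> inc (induced ?H (\<Union>v\<in>inc ?G e. ?X v)) g = {}"
        using M_disj[OF eE(1)] by simp
    qed
    fix f w assume "f \<in> {f \<in> M e. inc H f \<subseteq> verts ?H}" "w \<in> inc ?G e"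
    then show "card (inc ?H f \<inter> ?X w) = 1" using single[OF e] by simp
  next
    show "edges ?H = (\<Union>e\<in>edges ?G. {f \<in> M e. inc H f \<subseteq> verts ?H})"
    proof (intro equalityI subsetI)
      fix f assume f: "f \<in> edges ?H"
      then show "f \<in> (\<Union>e\<in>edges ?G. {f \<in> M e. inc H f \<subseteq> verts ?H})"
        using part_H_edge[OF f] by (metis (no_types, lifting) UN_I mem_Collect_eq part_G_simps(2))
    qed (use part_H_edgeI in auto)
  qed
qed

lemma part_degree_feasible:
  assumes s: "splits v A B" and u: "u \<notin> V"
  shows "degree_feasible (part_G v A u) (part_X v A u) (part_H v A)"
  unfolding degree_feasible_def feasible_def
proof (intro conjI ballI)
  note S = splitsD[OF s]
  show "connected_hypergraph (part_G v A u)"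
    using cut_connected_imp_connected[OF part_connected[OF s u] part_wf[OF s u]] .
  fix w assume "w \<in> verts (part_G v A u)"
  then consider "w = u" | "w \<in> A" "w \<noteq> u" by auto
  then show "degree (part_G v A u) w \<le> card (part_X v A u w)"
  proof cases
    case 1
    have "{e \<in> part_edges A. u \<in> inc (part_G v A u) e} = {e \<in> part_edges A. v \<in> inc G e}"
      using part_G_mem(2)[OF s u] by blast
    then show ?thesis using card_part_colors[OF s] 1 unfolding degree_def part_X_def by simp
  next
    case 2
    have "{e \<in> part_edges A. w \<in> inc (part_G v A u) e} = {e \<in> E. w \<in> inc G e}"
      using part_G_mem(1)[OF s u] 2(1) part_edge_inc(1)[OF s] unfolding part_edges_def by blast
    then show ?thesis using deg[of w] 2 S(2) unfolding degree_def part_X_def by auto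
  qed
qed (rule part_wf[OF s u] part_cover[OF s u])+

lemma part_minimal_uncolorable:
  assumes s: "splits v A B" and u: "u \<notin> V"
    and min: "\<And>f. f \<in> edges H \<Longrightarrow> \<exists>\<psi>. ptrans X (delete_edge H f) V \<psi>"
  shows "minimal_uncolorable (part_G v A u) (part_X v A u) (part_H v A)"
proof -
  note c = cover_props[OF part_cover[OF s u]]
  show ?thesis
    unfolding minimal_uncolorable_iff_ptrans[OF c(3,2)] part_G_simps
    using part_uncolorable[OF s u] part_minimal[OF s u min] by blast
qed

text \<open>The vertex \<open>v\<close> itself can serve as the new vertex of the merging, since the
  parts know it only as \<open>u1\<close> and \<open>u2\<close>; renaming both back to
  \<open>v\<close> restores every edge of \<open>G\<close>.\<close>

lemma part_merging:
  assumes s: "splits v A B" and u: "u1 \<notin> V" "u2 \<notin> V" "u1 \<noteq> u2"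
    and min: "\<And>f. f \<in> edges H \<Longrightarrow> \<exists>\<psi>. ptrans X (delete_edge H f) V \<psi>"
  shows "is_merging (part_G v A u1) (part_X v A u1) (part_H v A) u1
    (part_G v B u2) (part_X v B u2) (part_H v B) u2 v G X H"
proof -
  note S = splitsD[OF s] and s' = splits_sym[OF s]
  have inc_id: "inc G e = identify u1 u2 v ` inc (part_G v C w) e" if "w = u1 \<or> w = u2" "e \<in> E" for C w e
  proof -
    have e: "u1 \<notin> inc G e" "u2 \<notin> inc G e" using incV[OF that(2)] u by blast+
    then have id: "identify u1 u2 v ` D = D" if "D \<subseteq> inc G e" for D
      using that unfolding identify_def by (auto simp: image_iff subset_iff)
    have w: "identify u1 u2 v w = v" using that(1) unfolding identify_def by auto
    show ?thesis using id[of "inc G e"] id[of "inc G e - {v}"] w by auto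
  qed
  have V: "identify u1 u2 v ` (insert u1 A \<union> insert u2 B) = V"
  proof -
    have "identify u1 u2 v ` (A \<union> B) = A \<union> B"
      using u S unfolding identify_def by (auto simp: image_iff)
    moreover have "identify u1 u2 v u1 = v" "identify u1 u2 v u2 = v" unfolding identify_def by auto
    moreover have "insert u1 A \<union> insert u2 B = insert u1 (insert u2 (A \<union> B))" by blast
    ultimately show ?thesis using S(9) by simp
  qed
  have vertsH': "verts H = verts (part_H v A) \<union> verts (part_H v B)"
    using vertsH S(9) part_colors_Un(1)[OF s] by auto
  show ?thesis
    unfolding is_merging_def
  proof (intro conjI)
    show "verts (part_G v A u1) \<inter> verts (part_G v B u2) = {}" using S u by auto
    show "edges (part_G v A u1) \<inter> edges (part_G v B u2) = {}" using part_edges_Un(2)[OF s] by simp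
    show "verts (part_H v A) \<inter> verts (part_H v B) = {}" "edges (part_H v A) \<inter> edges (part_H v B) = {}"
      using part_H_disjoint[OF s] .
    show "v \<notin> verts (part_G v A u1) \<union> verts (part_G v B u2)" using S u by auto
    show "V = identify u1 u2 v ` (verts (part_G v A u1) \<union> verts (part_G v B u2))" using V by simp
    show "E = edges (part_G v A u1) \<union> edges (part_G v B u2)" using part_edges_Un(1)[OF s] by simp
    show "\<forall>e\<in>edges (part_G v A u1). inc G e = identify u1 u2 v ` inc (part_G v A u1) e"
      using inc_id part_edge_inc(1)[OF s] by (metis part_G_simps(2))
    show "\<forall>e\<in>edges (part_G v B u2). inc G e = identify u1 u2 v ` inc (part_G v B u2) e"
      using inc_id part_edge_inc(1)[OF s'] by (metis part_G_simps(2))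
    show "is_union H {part_H v A, part_H v B}"
      unfolding is_union_def using part_edges_cover[OF s u(1) min] vertsH' by auto
    show "X v = part_X v A u1 u1 \<union> part_X v B u2 u2" using part_colors_Un(1)[OF s] unfolding part_X_def by simp
    show "\<forall>w\<in>verts (part_G v A u1) - {u1}. X w = part_X v A u1 w"
      "\<forall>w\<in>verts (part_G v B u2) - {u2}. X w = part_X v B u2 w" unfolding part_X_def by auto
  qed auto
qed

text \<open>A hyperedge of a block meets no other edge, so by connectivity it covers all of
  \<open>G\<close> and is the only edge. All degrees and hence all lists have size 1, which makes
  every edge of \<open>H\<close> contain all vertices of \<open>H\<close>.\<close>

lemma hyperedge_block_E:
  assumes F: "feasible G X H"
    and simple: "\<And>f g. f \<in> edges H \<Longrightarrow> g \<in> edges H \<Longrightarrow> inc H f = inc H g \<Longrightarrow> f = g"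
    and block: "\<And>v. v \<in> V \<Longrightarrow> conn_minus {v}"
    and e: "e \<in> E" "card (inc G e) \<ge> 3"
  shows "E_configuration G X H"
proof -
  have iso: "e' = e" if "e' \<in> E" "inc G e \<inter> inc G e' \<noteq> {}" for e'
    using hyperedge_isolated[OF block e that(1)] that(2) by blast
  have VE: "V = inc G e"
  proof (rule ccontr)
    assume "V \<noteq> inc G e"
    moreover have "inc G e \<noteq> {}" using wf_hypergraph_inc(3)[OF wfG e(1)] .
    ultimately obtain e' where e': "e' \<in> E" "inc G e' \<inter> inc G e \<noteq> {}" "inc G e' \<inter> (V - inc G e) \<noteq> {}"
      using conn incV[OF e(1)] unfolding cut_connected_def by blast
    then show False using iso[of e'] by blast
  qed
  have E1: "E = {e}"
  proof -
    have "e' = e" if e': "e' \<in> E" for e'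
      using iso[OF e'] incV[OF e'] wf_hypergraph_inc(3)[OF wfG e'] VE by blast
    then show ?thesis using e(1) by blast
  qed
  have card1: "card (X v) = 1" if "v \<in> V" for v
  proof -
    have "{e' \<in> E. v \<in> inc G e'} = {e}" using E1 that VE by auto
    then show ?thesis using card_X[OF that] unfolding degree_def by simp
  qed
  define \<phi> where "\<phi> v = the_elem (X v)" for v
  have \<phi>: "X v = {\<phi> v}" if "v \<in> V" for v
    using card1[OF that] unfolding \<phi>_def by (metis card_1_singletonE the_elem_eq)
  have im: "verts H = \<phi> ` V" using vertsH \<phi> by auto
  have inj: "inj_on \<phi> V" using \<phi> X_unique by (intro inj_onI) (metis singletonI)
  have full: "inc H f = \<phi> ` V" if f: "f \<in> edges H" for f
  proof
    show "inc H f \<subseteq> \<phi> ` V" using wf_hypergraph_inc(1)[OF wfH f] im by simp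
    have fM: "f \<in> M e" using f edgesH E1 by auto
    show "\<phi> ` V \<subseteq> inc H f"
    proof
      fix z assume "z \<in> \<phi> ` V"
      then obtain v where v: "v \<in> V" "z = \<phi> v" by blast
      obtain y where "y \<in> inc H f" "y \<in> X v" using M_point[OF e(1) fM] v(1) VE by blast
      then show "z \<in> inc H f" using \<phi>[OF v(1)] v(2) by simp
    qed
  qed
  have "edges H \<noteq> {}" using unc[of \<phi>] \<phi> unfolding ptrans_def by auto
  then obtain f where f: "f \<in> edges H" by blast
  have EH: "edges H = {f}" using simple full f by blast
  have "isomorphic H G"
    unfolding isomorphic_def
  proof (intro exI conjI)
    show "bij_betw (inv_into V \<phi>) (verts H) V" unfolding im using inj by (intro bij_betw_inv_into) (simp add: bij_betw_def)
    show "bij_betw (\<lambda>_. e) (edges H) E" unfolding EH E1 by (simp add: bij_betw_def)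
    show "\<forall>f\<in>edges H. inc G e = inv_into V \<phi> ` inc H f"
    proof
      fix f assume f: "f \<in> edges H"
      have "inv_into V \<phi> ` \<phi> ` V = V" using inj by (rule inv_into_image_cancel) simp
      then show "inc G e = inv_into V \<phi> ` inc H f" unfolding full[OF f] VE[symmetric] by simp
    qed
  qed
  then show ?thesis unfolding E_configuration_def using F E1 VE card1 by blast
qed

end

section \<open>Induction on the number of vertices\<close>

lemma minimal_uncolorable_constructible:
  fixes G :: "('v::infinite, 'e) hypergraph" and X :: "'v \<Rightarrow> 'x set" and H :: "('x, 'f) hypergraph"
  assumes "degree_feasible G X H" "minimal_uncolorable G X H"
  shows "constructible G X H"
  using assms
proof (induction "card (verts G)" arbitrary: G X H rule: less_induct)
  case less
  note F = less.prems(1)[unfolded degree_feasible_def, THEN conjunct1]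
  note FP = feasible_props[OF F]
  note simple = minimal_uncolorable_simple[OF F less.prems(2)]
  note mu = less.prems(2)[unfolded minimal_uncolorable_iff_ptrans[OF FP(6,5)]]
  obtain M where M: "cover_matching G X H M" using cover_matching_exists[OF FP(1,3)] .
  interpret cover_matching G X H M by (rule M)
  interpret uncol G X H M
  proof
    show "cut_connected G" using connected_imp_cut_connected[OF FP(2)] .
  qed (use less.prems(1) mu in \<open>auto simp: degree_feasible_def\<close>)
  \<comment> \<open>The empty hypergraph counts as connected, but the empty colouring makes it
    colorable.\<close>
  have ne: "verts G \<noteq> {}"
    using mu wf_hypergraph_inc(3)[OF wfH] unfolding ptrans_def by fastforce
  show ?case
  proof (cases "\<forall>v\<in>verts G. conn_minus {v}")
    case True
    show ?thesis
    proof (cases "\<exists>e\<in>edges G. card (inc G e) \<ge> 3")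
      case True
      then obtain e where "e \<in> edges G" "card (inc G e) \<ge> 3" by blast
      then have "E_configuration G X H"
        using hyperedge_block_E[OF F simple] \<open>\<forall>v\<in>verts G. conn_minus {v}\<close> by blast
      then show ?thesis by (rule constructible.E)
    next
      case False
      have "card (inc G e) = 2" if "e \<in> edges G" for e
        using wf_hypergraph_inc(2)[OF wfG that] False that by (metis le_antisym not_less_eq_eq numeral_2_eq_2 numeral_3_eq_3)
      then interpret block_graph G X H M
        using True by unfold_locales auto
      show ?thesis
      proof (cases "\<forall>u\<in>verts G. \<forall>v\<in>verts G. u \<noteq> v \<longrightarrow> adj u v")
        case True
        then interpret complete_block G X H M by unfold_locales blast
        show ?thesis using K_configuration[OF F ne simple] by (rule constructible.K)
      next
        case False
        then have "\<forall>u\<in>verts G. two_nbrs u" using complete_or_two_nbrs by blast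
        then interpret cycle_block G X H M by unfold_locales blast
        show ?thesis using C_configuration[OF F ne simple] by (rule constructible.C)
      qed
    qed
  next
    case False
    then obtain v A where v: "v \<in> verts G" and A: "A \<subseteq> verts G - {v}" "A \<noteq> {}" "A \<noteq> verts G - {v}"
      "\<not> (\<exists>e\<in>edges G. inc G e \<inter> A \<noteq> {} \<and> inc G e \<inter> (verts G - {v} - A) \<noteq> {})"
      unfolding conn_minus_def by blast
    define B where "B = verts G - {v} - A"
    have s: "splits v A B" unfolding splits_def B_def using v A by blast
    note S = splitsD[OF s]
    \<comment> \<open>Here the infinite vertex type supplies the two names for the copies of
      \<open>v\<close>.\<close>
    obtain u1 where u1: "u1 \<notin> verts G" using ex_new_if_finite[OF infinite_UNIV finV] by blast
    have "finite (insert u1 (verts G))" using finV by simp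
    then obtain u2 where u2: "u2 \<notin> insert u1 (verts G)" using ex_new_if_finite[OF infinite_UNIV] by blast
    have min: "\<exists>\<psi>. ptrans X (delete_edge H f) (verts G) \<psi>" if "f \<in> edges H" for f using mu that by blast
    have fin: "finite A" "finite B" using S(2,3) finV finite_subset by blast+
    have "card (verts G) = Suc (card A + card B)"
      unfolding S(9) using S(4,5,6) fin by (simp add: card_Un_disjoint)
    moreover have "card A > 0" "card B > 0" using fin S(7,8) by (simp_all add: card_gt_0_iff)
    \<comment> \<open>Each part has its own side and one copy of \<open>v\<close>; it is smaller
      than \<open>G\<close> because the opposite side is nonempty.\<close>
    ultimately have card: "card (verts (part_G v A u1)) < card (verts G)" "card (verts (part_G v B u2)) < card (verts G)"
      using fin by (simp_all add: card_insert_if)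
    have "constructible (part_G v A u1) (part_X v A u1) (part_H v A)"
      using less.hyps[OF card(1) part_degree_feasible[OF s u1] part_minimal_uncolorable[OF s u1 min]] .
    moreover have "constructible (part_G v B u2) (part_X v B u2) (part_H v B)"
      using less.hyps[OF card(2) part_degree_feasible[OF splits_sym[OF s]] part_minimal_uncolorable[OF splits_sym[OF s] _ min]] u2 by blast
    moreover have "is_merging (part_G v A u1) (part_X v A u1) (part_H v A) u1
        (part_G v B u2) (part_X v B u2) (part_H v B) u2 v G X H"
      using part_merging[OF s u1 _ _ min] u2 by blast
    ultimately show ?thesis using F by (rule constructible.merge)
  qed
qed

theorem theorem2:
  fixes G :: "('v::infinite, 'e) hypergraph"
    and X :: "'v \<Rightarrow> 'x set"
    and H :: "('x, 'f) hypergraph"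
  assumes "degree_feasible G X H"
  shows "minimal_uncolorable G X H \<longleftrightarrow> constructible G X H"
  using minimal_uncolorable_constructible[OF assms] constructible_critical
    critical_imp_minimal_uncolorable constructible_feasible by blast

end
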